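(* Let $(m_t)_{0\le t\le 1}$ be the (standard) Brownian meander. Then $$\mathbb{E}\Big[\frac{1}{m_1}\int_0^1 m_u\,du\Big]=1.$$
   Context: The standard Brownian meander on $[0,1]$ is the process $m_t=\frac{1}{\sqrt{1-g}}\,|B_{g+t(1-g)}|$, $0\le t\le 1$, where $B$ is a standard Brownian motion started at $0$ and $g=\sup\{s\le 1: B_s=0\}$. *)

theory Defs
  imports "HOL-Probability.Probability"
begin

text \<open>
  A process on the index set \<open>[0, \<infinity>)\<close> is a function on all reals whose values at negative
  times are never used. The initial value and path continuity are required for every outcome,
  not merely almost surely, so that path functionals are measurable without completing \<open>M\<close>.
  The second parameter of \<^const>\<open>normal_density\<close> is the standard deviation.
\<close>

definition standard_brownian_motion :: "'a measure \<Rightarrow> (real \<Rightarrow> 'a \<Rightarrow> real) \<Rightarrow> bool" where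
  "standard_brownian_motion M B \<longleftrightarrow>
     prob_space M \<and>
     (\<forall>t\<ge>0. B t \<in> borel_measurable M) \<and>
     (\<forall>\<omega>\<in>space M. B 0 \<omega> = 0) \<and>
     (\<forall>s t. 0 \<le> s \<and> s < t \<longrightarrow>
        distributed M lborel (\<lambda>\<omega>. B t \<omega> - B s \<omega>) (normal_density 0 (sqrt (t - s)))) \<and>
     (\<forall>(n::nat) \<tau>::nat \<Rightarrow> real. 0 \<le> \<tau> 0 \<and> (\<forall>i<n. \<tau> i \<le> \<tau> (Suc i)) \<longrightarrow>
        prob_space.indep_vars M (\<lambda>_. borel) (\<lambda>i \<omega>. B (\<tau> (Suc i)) \<omega> - B (\<tau> i) \<omega>) {..<n}) \<and>
     (\<forall>\<omega>\<in>space M. continuous_on {0..} (\<lambda>t. B t \<omega>))"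

definition last_zero :: "(real \<Rightarrow> 'a \<Rightarrow> real) \<Rightarrow> 'a \<Rightarrow> real" where
  "last_zero B \<omega> = Sup {s. 0 \<le> s \<and> s \<le> 1 \<and> B s \<omega> = 0}"

text \<open>
  On the null event that the last zero is \<open>1\<close>, division by zero makes the process
  identically \<open>0\<close>.
\<close>

definition brownian_meander :: "(real \<Rightarrow> 'a \<Rightarrow> real) \<Rightarrow> real \<Rightarrow> 'a \<Rightarrow> real" where
  "brownian_meander B t \<omega> =
     (let g = last_zero B \<omega> in 1 / sqrt (1 - g) * \<bar>B (g + t * (1 - g)) \<omega>\<bar>)"

end

theory Submission
  imports Defs
begin

text \<open>
  Write \<open>g\<close> for the last zero before time \<open>1\<close>. The factors \<open>sqrt (1 - g)\<close> cancel in \<open>m u / m 1\<close>, so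
  that after the change of variable \<open>s = g + u (1 - g)\<close> the random variable in question is the
  integral over \<open>s\<close> in \<open>(0, 1)\<close> of \<open>\<bar>B s\<bar> / (\<bar>B 1\<bar> (1 - g))\<close> on the event \<open>g < s\<close>
  (\<open>normalized_area_eq\<close>). By Tonelli it suffices to know, for fixed \<open>s\<close>, the joint behaviour of
  \<open>g\<close>, \<open>B s\<close> and \<open>B 1\<close>. The singular factor \<open>1 / \<bar>B 1\<bar>\<close> is first written as a mixture over a
  parameter \<open>v\<close> in \<open>(0, 1)\<close> of the functions \<open>\<bar>z\<bar> exp (- \<kappa> z\<^sup>2 / 2)\<close> with
  \<open>\<kappa> = (1 / v\<^sup>2 - 1) / (1 - s)\<close> (\<open>inverse_as_gaussian_mixture\<close>). Each of them is the modulus of a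
  bounded odd Lipschitz function \<open>\<phi>\<close>, and this makes the reflection principle available.

  For \<open>r \<le> s\<close> the event \<open>g < r\<close> says that \<open>B\<close> has no zero in \<open>[r, 1]\<close>. On it \<open>B r\<close> and \<open>B 1\<close> have
  the same sign, so that \<open>\<bar>B s\<bar> \<bar>\<phi> (B 1)\<bar> = sgn (B r) \<bar>B s\<bar> \<phi> (B 1)\<close>. On the complement, reflecting the
  path at its first zero after \<open>r\<close> preserves the law of the path; it leaves \<open>\<bar>B s\<bar>\<close> alone, whether
  that zero comes before or after \<open>s\<close>, and changes the sign of \<open>\<phi> (B 1)\<close>. So the right hand side has
  expectation \<open>0\<close> on the complement (\<open>reflection_principle\<close>), and
  \<open>E [\<bar>B s\<bar> \<bar>\<phi> (B 1)\<bar>; g < r]\<close> is the plain Gaussian expectation of \<open>sgn (B r) \<bar>B s\<bar> \<phi> (B 1)\<close>.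
  The reflection is carried out on dyadic grids, where it only flips the signs of independent
  symmetric increments after a first passage (\<open>expectation_reflect_after\<close>). On a grid the path is
  reflected at a small level instead of at \<open>0\<close>, but the resulting error vanishes as the mesh
  and the level tend to \<open>0\<close>, because \<open>\<phi>\<close> is Lipschitz.

  The Gaussian expectation is computed in two steps: integrating out \<open>B 1 - B s\<close> turns \<open>\<phi>\<close> into
  a function of the same kind (\<open>gauss_moment_convolution\<close>), and the conditional expectation of
  \<open>sgn (B r)\<close> given \<open>B s\<close> is, up to the sign of \<open>B s\<close>, the probability that a centred normal variable
  lies in a certain symmetric interval. As \<open>r\<close> varies this identifies the law of \<open>g\<close>, under the measure with density
  \<open>\<bar>B s\<bar> \<bar>\<phi> (B 1)\<bar>\<close> on \<open>g < s\<close>, as the image of an explicit rational density in \<open>p \<ge> 0\<close> under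
  \<open>p \<mapsto> s p\<^sup>2 / (1 + p\<^sup>2)\<close> (\<open>last_zero_law\<close>). Inserting the factor \<open>1 / (1 - g)\<close> leaves a
  triple integral of a rational function over \<open>s\<close>, \<open>v\<close> and \<open>p\<close>, whose value is \<open>1\<close>
  (\<open>triple_integral_eq_1\<close>).
\<close>

section \<open>Reflecting a walk with symmetric increments\<close>

text \<open>
  Entry \<open>0\<close> is the initial value, so that the walk is the sequence of partial sums of its increments.
\<close>

definition increment :: "(nat \<Rightarrow> real) \<Rightarrow> nat \<Rightarrow> real" where
  "increment s i = s i - (if i = 0 then 0 else s (i - 1))"

lemma sum_increment: "(\<Sum>i\<le>j. increment s i) = s j"
  by (induction j) (auto simp: increment_def)

text \<open>
  The passage is of the walk turned by the sign of its initial value; that value itself counts, so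
  a walk starting within \<open>\<epsilon>\<close> of \<open>0\<close> passes at index \<open>0\<close>.
\<close>

definition first_below :: "real \<Rightarrow> (nat \<Rightarrow> real) \<Rightarrow> nat \<Rightarrow> bool" where
  "first_below \<epsilon> s k \<longleftrightarrow> (\<forall>j<k. \<epsilon> < sgn (s 0) * s j) \<and> sgn (s 0) * s k \<le> \<epsilon>"

definition reflect_after :: "nat \<Rightarrow> (nat \<Rightarrow> real) \<Rightarrow> nat \<Rightarrow> real" where
  "reflect_after k s j = (if j \<le> k then s j else 2 * s k - s j)"

lemma first_below_cong:
  assumes "\<And>j. j \<le> k \<Longrightarrow> s j = s' j"
  shows "first_below \<epsilon> s k \<longleftrightarrow> first_below \<epsilon> s' k"
  using assms unfolding first_below_def by (metis le0 less_imp_le order_refl)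

lemma measurable_first_below:
  assumes [measurable]: "\<And>j. j \<le> k \<Longrightarrow> (\<lambda>x. s x j) \<in> borel_measurable N"
  shows "Measurable.pred N (\<lambda>x. first_below \<epsilon> (s x) k)"
proof -
  have "Measurable.pred N (\<lambda>x. \<forall>j\<in>{..<k}. \<epsilon> < sgn (s x 0) * s x j)"
    by (intro pred_intros_finite) (simp_all add: borel_measurable_pred_less assms)
  moreover have "Measurable.pred N (\<lambda>x. sgn (s x 0) * s x k \<le> \<epsilon>)"
    by measurable
  ultimately show ?thesis
    unfolding first_below_def by (simp add: Ball_def)
qed

text \<open>
  The first passage indices split the event that the level is reached at all into disjoint pieces, on
  each of which the reflection happens at a fixed index.
\<close>

lemma sum_of_bool_first_below:
  "(\<Sum>k\<le>m. of_bool (first_below \<epsilon> s k)) = (of_bool (\<exists>k\<le>m. sgn (s 0) * s k \<le> \<epsilon>) :: real)"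
proof (induction m)
  case (Suc m)
  have "first_below \<epsilon> s (Suc m) \<longleftrightarrow> \<not> (\<exists>k\<le>m. sgn (s 0) * s k \<le> \<epsilon>) \<and> sgn (s 0) * s (Suc m) \<le> \<epsilon>"
    unfolding first_below_def less_Suc_eq_le not_ex de_Morgan_conj by (metis not_le)
  with Suc show ?case by (auto simp: le_Suc_eq)
qed (auto simp: first_below_def)

text \<open>
  A first passage overshoots the level \<open>\<epsilon>\<close> by at most one increment. Hence the reflection, which takes
  place at the level \<open>s k\<close>, is almost a reflection at \<open>0\<close>.
\<close>

lemma abs_le_at_first_below:
  assumes "first_below \<epsilon> s k" "0 \<le> \<epsilon>" "0 \<le> d" "\<And>i. i < k \<Longrightarrow> \<bar>s (Suc i) - s i\<bar> \<le> d"
  shows "\<bar>s k\<bar> \<le> \<epsilon> + d"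
proof (cases k)
  case 0
  then have "\<bar>s 0\<bar> \<le> \<epsilon>" using assms(1)
    by (auto simp: first_below_def sgn_mult_self_eq abs_sgn mult.commute)
  with assms 0 show ?thesis by simp
next
  case (Suc i)
  then have "\<epsilon> < sgn (s 0) * s i" "sgn (s 0) * s k \<le> \<epsilon>" using assms(1) by (auto simp: first_below_def)
  moreover have "\<bar>s k - s i\<bar> \<le> d" using assms(4)[of i] Suc by simp
  ultimately show ?thesis using assms(2,3)
    by (auto simp: sgn_if split: if_splits)
qed

text \<open>
  Independence makes the joint law a product measure, and each factor is invariant.
\<close>

lemma (in prob_space) distr_sign_flip:
  fixes X :: "nat \<Rightarrow> 'a \<Rightarrow> real"
  assumes indep: "indep_vars (\<lambda>_. borel) X I" and I: "I \<noteq> {}"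
    and sym: "\<And>i. i \<in> I \<Longrightarrow> distr M borel (\<lambda>\<omega>. c i * X i \<omega>) = distr M borel (X i)"
  shows "distr M (PiM I (\<lambda>_. borel)) (\<lambda>\<omega>. \<lambda>i\<in>I. c i * X i \<omega>)
       = distr M (PiM I (\<lambda>_. borel)) (\<lambda>\<omega>. \<lambda>i\<in>I. X i \<omega>)"
proof -
  have X: "random_variable borel (X i)" if "i \<in> I" for i
    using indep that by (auto simp: indep_vars_def)
  have indep': "indep_vars (\<lambda>_. borel) (\<lambda>i \<omega>. c i * X i \<omega>) I"
    using indep by (rule indep_vars_compose2) auto
  have "distr M (PiM I (\<lambda>_. borel)) (\<lambda>\<omega>. \<lambda>i\<in>I. c i * X i \<omega>) = PiM I (\<lambda>i. distr M borel (\<lambda>\<omega>. c i * X i \<omega>))"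
    using indep_vars_iff_distr_eq_PiM'[OF I, where M' = "\<lambda>_. borel" and X = "\<lambda>i \<omega>. c i * X i \<omega>"] indep' X by auto
  also have "\<dots> = PiM I (\<lambda>i. distr M borel (X i))"
    by (intro PiM_cong sym) auto
  also have "\<dots> = distr M (PiM I (\<lambda>_. borel)) (\<lambda>\<omega>. \<lambda>i\<in>I. X i \<omega>)"
    using indep_vars_iff_distr_eq_PiM'[OF I, where M' = "\<lambda>_. borel" and X = X] indep X by auto
  finally show ?thesis .
qed

text \<open>
  Flipping the increments after a fixed index \<open>k\<close> preserves their joint law. The event of a first
  passage at \<open>k\<close> depends only on the increments up to \<open>k\<close>, so that it survives the flip, while the
  walk after \<open>k\<close> is replaced by its mirror image at the level \<open>S k\<close>.
\<close>

lemma (in prob_space) expectation_reflect_after: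
  fixes S :: "nat \<Rightarrow> 'a \<Rightarrow> real" and \<Phi> :: "real \<Rightarrow> real \<Rightarrow> real"
  assumes indep: "indep_vars (\<lambda>_. borel) (\<lambda>i \<omega>. increment (\<lambda>j. S j \<omega>) i) {..m}"
    and sym: "\<And>i. i < m \<Longrightarrow> distr M borel (\<lambda>\<omega>. - (S (Suc i) \<omega> - S i \<omega>)) = distr M borel (\<lambda>\<omega>. S (Suc i) \<omega> - S i \<omega>)"
    and \<Phi>[measurable]: "case_prod \<Phi> \<in> borel_measurable (borel \<Otimes>\<^sub>M borel)"
    and le: "k \<le> m" "n \<le> m"
  shows "expectation (\<lambda>\<omega>. of_bool (first_below \<epsilon> (\<lambda>j. S j \<omega>) k) * (sgn (S 0 \<omega>) * \<Phi> (S n \<omega>) (S m \<omega>)))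
       = expectation (\<lambda>\<omega>. of_bool (first_below \<epsilon> (\<lambda>j. S j \<omega>) k) *
            (sgn (S 0 \<omega>) * \<Phi> (reflect_after k (\<lambda>j. S j \<omega>) n) (reflect_after k (\<lambda>j. S j \<omega>) m)))"
proof -
  define X where "X i \<omega> = increment (\<lambda>j. S j \<omega>) i" for i \<omega>
  \<comment> \<open>The signs that turn the increments of the walk into those of the reflected walk.\<close>
  define c :: "nat \<Rightarrow> real" where "c i = (if i \<le> k then 1 else - 1)" for i
  define P where "P x j = (\<Sum>i\<le>j. x i)" for x :: "nat \<Rightarrow> real" and j
  define \<psi> where "\<psi> x = of_bool (first_below \<epsilon> (P x) k) * (sgn (P x 0) * \<Phi> (P x n) (P x m))" for x
  let ?P = "PiM {..m} (\<lambda>_. borel :: real measure)"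
  have indepX: "indep_vars (\<lambda>_. borel) X {..m}" using indep by (simp add: X_def[abs_def])
  have X[measurable]: "random_variable borel (X i)" if "i \<le> m" for i
    using indepX that by (auto simp: indep_vars_def)
  have P[measurable]: "(\<lambda>x. P x j) \<in> borel_measurable ?P" if "j \<le> m" for j
    unfolding P_def using that
    by (intro borel_measurable_sum measurable_component_singleton) auto
  have "Measurable.pred ?P (\<lambda>x. first_below \<epsilon> (P x) k)"
    using le by (intro measurable_first_below P) simp
  then have \<psi>[measurable]: "\<psi> \<in> borel_measurable ?P"
    unfolding \<psi>_def using le by measurable
  have "distr M ?P (\<lambda>\<omega>. \<lambda>i\<in>{..m}. c i * X i \<omega>) = distr M ?P (\<lambda>\<omega>. \<lambda>i\<in>{..m}. X i \<omega>)"
  proof (rule distr_sign_flip[OF indepX])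
    fix i assume "i \<in> {..m}"
    then show "distr M borel (\<lambda>\<omega>. c i * X i \<omega>) = distr M borel (X i)"
      using sym[of "i - 1"] by (cases "i \<le> k") (auto simp: c_def X_def[abs_def] increment_def)
  qed simp
  then have "integral\<^sup>L (distr M ?P (\<lambda>\<omega>. \<lambda>i\<in>{..m}. X i \<omega>)) \<psi> = integral\<^sup>L (distr M ?P (\<lambda>\<omega>. \<lambda>i\<in>{..m}. c i * X i \<omega>)) \<psi>"
    by simp
  then have "expectation (\<lambda>\<omega>. \<psi> (\<lambda>i\<in>{..m}. X i \<omega>)) = expectation (\<lambda>\<omega>. \<psi> (\<lambda>i\<in>{..m}. c i * X i \<omega>))"
    by (subst (asm) (1 2) integral_distr) measurable
  moreover have PX: "P (\<lambda>i\<in>{..m}. X i \<omega>) j = S j \<omega>" if "j \<le> m" for j \<omega>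
  proof -
    have "P (\<lambda>i\<in>{..m}. X i \<omega>) j = (\<Sum>i\<le>j. X i \<omega>)"
      unfolding P_def using that by (intro sum.cong) auto
    then show ?thesis by (simp add: X_def sum_increment)
  qed
  have PcX: "P (\<lambda>i\<in>{..m}. c i * X i \<omega>) j = reflect_after k (\<lambda>j. S j \<omega>) j" if "j \<le> m" for j \<omega>
    using that
  proof (induction j)
    case 0 then show ?case by (simp add: P_def c_def X_def increment_def reflect_after_def)
  next
    case (Suc j)
    have "P (\<lambda>i\<in>{..m}. c i * X i \<omega>) (Suc j) = P (\<lambda>i\<in>{..m}. c i * X i \<omega>) j + c (Suc j) * X (Suc j) \<omega>"
      using Suc.prems by (simp add: P_def)
    moreover have "c (Suc j) * X (Suc j) \<omega> = reflect_after k (\<lambda>j. S j \<omega>) (Suc j) - reflect_after k (\<lambda>j. S j \<omega>) j"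
      by (cases "j = k") (auto simp: c_def X_def increment_def reflect_after_def)
    ultimately show ?case using Suc by (simp del: restrict_apply)
  qed
  have "\<psi> (\<lambda>i\<in>{..m}. X i \<omega>) = of_bool (first_below \<epsilon> (\<lambda>j. S j \<omega>) k) * (sgn (S 0 \<omega>) * \<Phi> (S n \<omega>) (S m \<omega>))" for \<omega>
    using le first_below_cong[of k "P (\<lambda>i\<in>{..m}. X i \<omega>)" "\<lambda>j. S j \<omega>" \<epsilon>]
    by (auto simp: \<psi>_def PX)
  moreover have "\<psi> (\<lambda>i\<in>{..m}. c i * X i \<omega>) = of_bool (first_below \<epsilon> (\<lambda>j. S j \<omega>) k) *
            (sgn (S 0 \<omega>) * \<Phi> (reflect_after k (\<lambda>j. S j \<omega>) n) (reflect_after k (\<lambda>j. S j \<omega>) m))" for \<omega>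
    using le first_below_cong[of k "P (\<lambda>i\<in>{..m}. c i * X i \<omega>)" "\<lambda>j. S j \<omega>" \<epsilon>]
    by (auto simp: \<psi>_def PcX reflect_after_def)
  ultimately show ?thesis by simp
qed

text \<open>
  The test functions of the reflection argument. Reflecting a path at \<open>0\<close> changes the sign either of both
  arguments or of the second one alone, according to whether the reflection takes place before or
  after the first of the two times; being even in the first and odd in the second argument makes
  \<open>\<Phi>\<close> change its sign in both cases. The Lipschitz bound controls the error when the reflection
  takes place at a small level instead.
\<close>

locale reflectable =
  fixes \<Phi> :: "real \<Rightarrow> real \<Rightarrow> real" and C L :: real
  assumes bounded: "\<bar>\<Phi> y z\<bar> \<le> C"
    and lipschitz: "\<bar>\<Phi> y z - \<Phi> y' z'\<bar> \<le> L * (\<bar>y - y'\<bar> + \<bar>z - z'\<bar>)"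
    and even: "\<Phi> (- y) z = \<Phi> y z"
    and odd: "\<Phi> y (- z) = - \<Phi> y z"
begin

lemma C_nonneg: "0 \<le> C" using bounded[of 0 0] by linarith

lemma L_nonneg: "0 \<le> L" using lipschitz[of 0 0 1 0] by simp

lemma continuous: "continuous_on UNIV (\<lambda>(y, z). \<Phi> y z)"
  unfolding continuous_on_def
proof
  fix x :: "real \<times> real"
  have "((\<lambda>w. \<Phi> (fst w) (snd w) - \<Phi> (fst x) (snd x)) \<longlongrightarrow> 0) (at x)"
  proof (rule Lim_null_comparison)
    show "\<forall>\<^sub>F w in at x. norm (\<Phi> (fst w) (snd w) - \<Phi> (fst x) (snd x)) \<le> L * (\<bar>fst w - fst x\<bar> + \<bar>snd w - snd x\<bar>)"
      using lipschitz by simp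
    show "((\<lambda>w. L * (\<bar>fst w - fst x\<bar> + \<bar>snd w - snd x\<bar>)) \<longlongrightarrow> 0) (at x)"
      by (auto intro!: tendsto_eq_intros)
  qed
  then show "((\<lambda>(y, z). \<Phi> y z) \<longlongrightarrow> (case x of (y, z) \<Rightarrow> \<Phi> y z)) (at x)"
    by (simp add: case_prod_beta' LIM_zero_iff)
qed

lemma measurable_\<Phi>[measurable]: "case_prod \<Phi> \<in> borel_measurable (borel \<Otimes>\<^sub>M borel)"
  using borel_measurable_continuous_onI[OF continuous] by (simp add: borel_prod)

text \<open>
  Reflection at \<open>0\<close> would make the sum vanish; reflection at \<open>s k\<close> differs from it by a shift of the
  arguments by \<open>2 * s k\<close>.
\<close>

lemma reflect_bound:
  assumes "n \<le> m" "k \<le> m"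
  shows "\<bar>\<Phi> (s n) (s m) + \<Phi> (reflect_after k s n) (reflect_after k s m)\<bar> \<le> 2 * min C (2 * L * \<bar>s k\<bar>)"
proof -
  have rm: "reflect_after k s m = 2 * s k - s m" using assms by (auto simp: reflect_after_def)
  have "\<bar>\<Phi> (s n) (s m) + \<Phi> (reflect_after k s n) (reflect_after k s m)\<bar> \<le> 4 * L * \<bar>s k\<bar>"
  proof (cases "n \<le> k")
    case True
    have "\<Phi> (reflect_after k s n) (reflect_after k s m) = - \<Phi> (s n) (s m - 2 * s k)"
      using odd[of "s n" "s m - 2 * s k"] True by (simp add: rm) (simp add: reflect_after_def)
    moreover have "\<bar>\<Phi> (s n) (s m) - \<Phi> (s n) (s m - 2 * s k)\<bar> \<le> L * (2 * \<bar>s k\<bar>)"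
      using lipschitz[of "s n" "s m" "s n" "s m - 2 * s k"] by simp
    moreover have "L * (2 * \<bar>s k\<bar>) \<le> 4 * L * \<bar>s k\<bar>" using L_nonneg by simp
    ultimately show ?thesis by linarith
  next
    case False
    have "\<Phi> (reflect_after k s n) (reflect_after k s m) = - \<Phi> (s n - 2 * s k) (s m - 2 * s k)"
      using odd[of "2 * s k - s n" "s m - 2 * s k"] even[of "s n - 2 * s k" "s m - 2 * s k"] False
      by (simp add: rm) (simp add: reflect_after_def)
    moreover have "\<bar>\<Phi> (s n) (s m) - \<Phi> (s n - 2 * s k) (s m - 2 * s k)\<bar> \<le> L * (2 * \<bar>s k\<bar> + 2 * \<bar>s k\<bar>)"
      using lipschitz[of "s n" "s m" "s n - 2 * s k" "s m - 2 * s k"] by simp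
    ultimately show ?thesis by (simp add: algebra_simps)
  qed
  moreover have "\<bar>\<Phi> (s n) (s m) + \<Phi> (reflect_after k s n) (reflect_after k s m)\<bar> \<le> 2 * C"
    using bounded[of "s n" "s m"] bounded[of "reflect_after k s n" "reflect_after k s m"] by linarith
  ultimately show ?thesis by (simp add: min_def)
qed

end

text \<open>
  Averaging the expectation over the original and the reflected walk, separately on each first passage
  event, leaves only the error of \<open>reflect_bound\<close>.
\<close>

lemma (in prob_space) discrete_reflection_bound:
  fixes S :: "nat \<Rightarrow> 'a \<Rightarrow> real" and D :: "'a \<Rightarrow> real"
  assumes "reflectable \<Phi> C L"
  assumes indep: "indep_vars (\<lambda>_. borel) (\<lambda>i \<omega>. increment (\<lambda>j. S j \<omega>) i) {..m}"
    and sym: "\<And>i. i < m \<Longrightarrow> distr M borel (\<lambda>\<omega>. - (S (Suc i) \<omega> - S i \<omega>)) = distr M borel (\<lambda>\<omega>. S (Suc i) \<omega> - S i \<omega>)"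
    and S[measurable]: "\<And>i. i \<le> m \<Longrightarrow> random_variable borel (S i)"
    and D[measurable]: "random_variable borel D"
    and inc: "\<And>i \<omega>. i < m \<Longrightarrow> \<omega> \<in> space M \<Longrightarrow> \<bar>S (Suc i) \<omega> - S i \<omega>\<bar> \<le> D \<omega>"
    and D_nonneg: "\<And>\<omega>. \<omega> \<in> space M \<Longrightarrow> 0 \<le> D \<omega>"
    and n: "n \<le> m" and \<epsilon>: "0 \<le> \<epsilon>"
  shows "\<bar>expectation (\<lambda>\<omega>. of_bool (\<exists>k\<le>m. sgn (S 0 \<omega>) * S k \<omega> \<le> \<epsilon>) * (sgn (S 0 \<omega>) * \<Phi> (S n \<omega>) (S m \<omega>)))\<bar>
       \<le> expectation (\<lambda>\<omega>. min C (2 * L * (\<epsilon> + D \<omega>)))"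
proof -
  interpret reflectable \<Phi> C L by fact
  define q where "q k \<omega> = (of_bool (first_below \<epsilon> (\<lambda>j. S j \<omega>) k) :: real)" for k \<omega>
  define f where "f \<omega> = sgn (S 0 \<omega>) * \<Phi> (S n \<omega>) (S m \<omega>)" for \<omega>
  define f' where "f' k \<omega> = sgn (S 0 \<omega>) * \<Phi> (reflect_after k (\<lambda>j. S j \<omega>) n) (reflect_after k (\<lambda>j. S j \<omega>) m)" for k \<omega>
  define b where "b \<omega> = min C (2 * L * (\<epsilon> + D \<omega>))" for \<omega>
  have qm[measurable]: "random_variable borel (q k)" if "k \<le> m" for k
  proof -
    have "Measurable.pred M (\<lambda>\<omega>. first_below \<epsilon> (\<lambda>j. S j \<omega>) k)"
      using that by (intro measurable_first_below) simp
    then show ?thesis unfolding q_def by measurable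
  qed
  have fm[measurable]: "random_variable borel f"
    unfolding f_def using n by measurable
  have fm'[measurable]: "random_variable borel (f' k)" if "k \<le> m" for k
    unfolding f'_def reflect_after_def using n that by measurable
  have bm[measurable]: "random_variable borel b"
    unfolding b_def by measurable
  have f_le: "\<bar>f \<omega>\<bar> \<le> C" for \<omega>
    unfolding f_def using bounded C_nonneg by (auto simp: abs_mult sgn_if)
  have f'_le: "\<bar>f' k \<omega>\<bar> \<le> C" for k \<omega>
    unfolding f'_def using bounded C_nonneg by (auto simp: abs_mult sgn_if)
  have b_le: "0 \<le> b \<omega>" "b \<omega> \<le> C" if "\<omega> \<in> space M" for \<omega>
    unfolding b_def using C_nonneg L_nonneg \<epsilon> D_nonneg[OF that] by auto
  have q01: "0 \<le> q k \<omega>" "q k \<omega> \<le> 1" for k \<omega> by (auto simp: q_def)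
  have int: "integrable M (\<lambda>\<omega>. q k \<omega> * f \<omega>)" "integrable M (\<lambda>\<omega>. q k \<omega> * f' k \<omega>)" "integrable M (\<lambda>\<omega>. q k \<omega> * b \<omega>)"
    if [measurable]: "k \<le> m" for k
  proof -
    have *: "\<bar>q k \<omega> * x\<bar> \<le> C" if "\<bar>x\<bar> \<le> C" for x \<omega>
      using that C_nonneg by (auto simp: q_def)
    show "integrable M (\<lambda>\<omega>. q k \<omega> * f \<omega>)" "integrable M (\<lambda>\<omega>. q k \<omega> * f' k \<omega>)" "integrable M (\<lambda>\<omega>. q k \<omega> * b \<omega>)"
      using f_le f'_le b_le
      by (auto intro!: integrable_const_bound[where B = C] AE_I2 *)
  qed
  have intb: "integrable M b"
    using b_le by (auto intro!: integrable_const_bound[where B = C] AE_I2)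
  have single: "\<bar>expectation (\<lambda>\<omega>. q k \<omega> * f \<omega>)\<bar> \<le> expectation (\<lambda>\<omega>. q k \<omega> * b \<omega>)" if k: "k \<le> m" for k
  proof -
    have "expectation (\<lambda>\<omega>. q k \<omega> * f \<omega>) = expectation (\<lambda>\<omega>. q k \<omega> * f' k \<omega>)"
      unfolding q_def f_def f'_def
      by (rule expectation_reflect_after[OF indep sym measurable_\<Phi> k n])
    \<comment> \<open>The integrand and its reflection have the same expectation and almost cancel each other.\<close>
    then have "2 * expectation (\<lambda>\<omega>. q k \<omega> * f \<omega>) = expectation (\<lambda>\<omega>. q k \<omega> * f \<omega> + q k \<omega> * f' k \<omega>)"
      using int[OF k] by simp
    also have "\<bar>\<dots>\<bar> \<le> expectation (\<lambda>\<omega>. \<bar>q k \<omega> * f \<omega> + q k \<omega> * f' k \<omega>\<bar>)"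
      by (rule integral_abs_bound)
    also have "\<dots> \<le> expectation (\<lambda>\<omega>. 2 * (q k \<omega> * b \<omega>))"
    proof (intro integral_mono integrable_abs Bochner_Integration.integrable_add integrable_mult_right int k)
      fix \<omega> assume \<omega>: "\<omega> \<in> space M"
      show "\<bar>q k \<omega> * f \<omega> + q k \<omega> * f' k \<omega>\<bar> \<le> 2 * (q k \<omega> * b \<omega>)"
      proof (cases "first_below \<epsilon> (\<lambda>j. S j \<omega>) k")
        case True
        have "\<bar>S k \<omega>\<bar> \<le> \<epsilon> + D \<omega>"
          using abs_le_at_first_below[OF True \<epsilon> D_nonneg[OF \<omega>]] inc[OF _ \<omega>] k by auto
        then have "2 * L * \<bar>S k \<omega>\<bar> \<le> 2 * L * (\<epsilon> + D \<omega>)"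
          using L_nonneg by (intro mult_left_mono) auto
        then have *: "\<bar>\<Phi> (S n \<omega>) (S m \<omega>) + \<Phi> (reflect_after k (\<lambda>j. S j \<omega>) n) (reflect_after k (\<lambda>j. S j \<omega>) m)\<bar> \<le> 2 * b \<omega>"
          using reflect_bound[OF n k, of "\<lambda>j. S j \<omega>"] unfolding b_def by linarith
        have "q k \<omega> * f \<omega> + q k \<omega> * f' k \<omega> = sgn (S 0 \<omega>) *
           (\<Phi> (S n \<omega>) (S m \<omega>) + \<Phi> (reflect_after k (\<lambda>j. S j \<omega>) n) (reflect_after k (\<lambda>j. S j \<omega>) m))"
          using True by (simp add: q_def f_def f'_def algebra_simps)
        also have "\<bar>\<dots>\<bar> \<le> 2 * b \<omega>"
          using * b_le[OF \<omega>] by (auto simp: abs_mult sgn_if)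
        finally show ?thesis using True by (simp add: q_def)
      qed (simp add: q_def)
    qed
    finally show ?thesis by simp
  qed
  have q_sum: "(\<Sum>k\<le>m. q k \<omega>) = of_bool (\<exists>k\<le>m. sgn (S 0 \<omega>) * S k \<omega> \<le> \<epsilon>)" for \<omega>
    unfolding q_def by (rule sum_of_bool_first_below)
  have "expectation (\<lambda>\<omega>. of_bool (\<exists>k\<le>m. sgn (S 0 \<omega>) * S k \<omega> \<le> \<epsilon>) * (sgn (S 0 \<omega>) * \<Phi> (S n \<omega>) (S m \<omega>)))
      = expectation (\<lambda>\<omega>. \<Sum>k\<le>m. q k \<omega> * f \<omega>)"
    by (simp add: q_sum[symmetric] sum_distrib_right f_def)
  also have "\<dots> = (\<Sum>k\<le>m. expectation (\<lambda>\<omega>. q k \<omega> * f \<omega>))"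
    using int by (intro Bochner_Integration.integral_sum) auto
  also have "\<bar>\<dots>\<bar> \<le> (\<Sum>k\<le>m. \<bar>expectation (\<lambda>\<omega>. q k \<omega> * f \<omega>)\<bar>)" by (rule sum_abs)
  also have "\<dots> \<le> (\<Sum>k\<le>m. expectation (\<lambda>\<omega>. q k \<omega> * b \<omega>))"
    using single by (intro sum_mono) auto
  also have "\<dots> = expectation (\<lambda>\<omega>. \<Sum>k\<le>m. q k \<omega> * b \<omega>)"
    using int by (intro Bochner_Integration.integral_sum[symmetric]) auto
  also have "\<dots> \<le> expectation b"
    using int intb b_le by (intro integral_mono Bochner_Integration.integrable_sum)
      (auto simp: sum_distrib_right[symmetric] q_sum)
  finally show ?thesis by (simp add: b_def[abs_def])
qed

section \<open>Passing from dyadic grids to continuous paths\<close>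

lemma dyadic_in_range: "k \<le> 2 * 2 ^ N \<Longrightarrow> real k / 2 ^ N \<in> {0..2}"
proof -
  assume "k \<le> 2 * 2 ^ N"
  then have "real k \<le> real (2 * 2 ^ N)" by (rule of_nat_mono)
  then show ?thesis by (simp add: field_simps)
qed

lemma dyadic_approx:
  fixes x d :: real
  assumes x: "x \<in> {0..2}" and d: "0 < d"
  obtains N k where "k \<le> 2 * 2 ^ N" "\<bar>real k / 2 ^ N - x\<bar> < d"
proof -
  obtain N where N: "(1 / 2 :: real) ^ N < d"
    using real_arch_pow_inv[OF d, of "1 / 2"] by auto
  define k where "k = nat \<lfloor>x * 2 ^ N\<rfloor>"
  have k: "real k = of_int \<lfloor>x * 2 ^ N\<rfloor>" using x by (simp add: k_def)
  have le: "real k \<le> x * 2 ^ N" and ge: "x * 2 ^ N < real k + 1" unfolding k by linarith+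
  have "x * 2 ^ N \<le> 2 * 2 ^ N" using x by simp
  then have "real k \<le> 2 * 2 ^ N" using le by linarith
  then have "real k \<le> real (2 * 2 ^ N)" by simp
  then have "k \<le> 2 * 2 ^ N" by (simp only: of_nat_le_iff)
  moreover have "x - real k / 2 ^ N \<ge> 0" using le by (simp add: field_simps)
  moreover have "x - real k / 2 ^ N < (1 / 2) ^ N"
  proof -
    have "(x - real k / 2 ^ N) * 2 ^ N < (1 / 2) ^ N * 2 ^ N"
      using ge by (simp add: left_diff_distrib power_mult_distrib[symmetric])
    then show ?thesis by (simp add: mult_less_cancel_right)
  qed
  ultimately show ?thesis using that N by (metis abs_minus_commute abs_of_nonneg less_trans)
qed

text \<open>
  A condition on countably many values that is equivalent, by compactness, to one on all values; it
  serves both the measurability of zero events and the limit of the discrete reflection.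
\<close>

lemma nonpos_value_iff_dyadic:
  fixes h :: "real \<Rightarrow> real"
  assumes cont: "continuous_on {0..2} h"
  shows "(\<exists>x\<in>{0..2}. h x \<le> 0) \<longleftrightarrow> (\<forall>j::nat. \<exists>N k. k \<le> 2 * 2 ^ N \<and> h (real k / 2 ^ N) \<le> 1 / real (Suc j))"
proof
  assume "\<exists>x\<in>{0..2}. h x \<le> 0"
  then obtain x where x: "x \<in> {0..2}" "h x \<le> 0" by blast
  show "\<forall>j::nat. \<exists>N k. k \<le> 2 * 2 ^ N \<and> h (real k / 2 ^ N) \<le> 1 / real (Suc j)"
  proof
    fix j :: nat
    have "0 < 1 / real (Suc j)" by simp
    then obtain d where d: "0 < d" "\<And>y. y \<in> {0..2} \<Longrightarrow> \<bar>y - x\<bar> < d \<Longrightarrow> \<bar>h y - h x\<bar> < 1 / real (Suc j)"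
      using cont x(1) unfolding continuous_on_iff dist_real_def by metis
    obtain N k where Nk: "k \<le> 2 * 2 ^ N" "\<bar>real k / 2 ^ N - x\<bar> < d"
      using dyadic_approx[OF x(1) d(1)] .
    with d(2)[OF dyadic_in_range[OF Nk(1)]] x(2) have "h (real k / 2 ^ N) \<le> 1 / real (Suc j)"
      by linarith
    with Nk show "\<exists>N k. k \<le> 2 * 2 ^ N \<and> h (real k / 2 ^ N) \<le> 1 / real (Suc j)" by blast
  qed
next
  assume *: "\<forall>j::nat. \<exists>N k. k \<le> 2 * 2 ^ N \<and> h (real k / 2 ^ N) \<le> 1 / real (Suc j)"
  obtain x where x: "x \<in> {0..2}" "\<And>y. y \<in> {0..2} \<Longrightarrow> h x \<le> h y"
    using continuous_attains_inf[OF _ _ cont] by auto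
  have "h x \<le> 0"
  proof (rule ccontr)
    assume "\<not> h x \<le> 0"
    then obtain j where "inverse (real (Suc j)) < h x" using reals_Archimedean[of "h x"] by auto
    then show False using * x(2) dyadic_in_range by (metis inverse_eq_divide leD le_less_trans)
  qed
  with x show "\<exists>x\<in>{0..2}. h x \<le> 0" by blast
qed

lemma zero_iff_dyadic:
  assumes "continuous_on {0..2} w"
  shows "(\<exists>x\<in>{0..2}. w x = (0::real)) \<longleftrightarrow> (\<forall>j::nat. \<exists>N k. k \<le> 2 * 2 ^ N \<and> \<bar>w (real k / 2 ^ N)\<bar> \<le> 1 / real (Suc j))"
  using nonpos_value_iff_dyadic[of "\<lambda>x. \<bar>w x\<bar>"] assms by (auto intro: continuous_intros)

text \<open>
  By the intermediate value theorem a continuous path vanishes somewhere iff the path turned by its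
  initial sign becomes nonpositive somewhere. In contrast to the number of sign changes on a grid,
  small values of the turned path also detect zeros at which the path does not change its sign.
\<close>

lemma zero_iff_dyadic_sgn:
  assumes cont: "continuous_on {0..2} w" and "w 0 \<noteq> (0::real)"
  shows "(\<exists>x\<in>{0..2}. w x = 0) \<longleftrightarrow>
    (\<forall>j::nat. \<exists>N k. k \<le> 2 * 2 ^ N \<and> sgn (w 0) * w (real k / 2 ^ N) \<le> 1 / real (Suc j))"
proof -
  have "(\<exists>x\<in>{0..2}. w x = 0) \<longleftrightarrow> (\<exists>x\<in>{0..2}. sgn (w 0) * w x \<le> 0)"
  proof
    assume "\<exists>x\<in>{0..2}. sgn (w 0) * w x \<le> 0"
    then obtain x where x: "x \<in> {0..2}" "sgn (w 0) * w x \<le> 0" by blast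
    have "\<exists>y. 0 \<le> y \<and> y \<le> x \<and> sgn (w 0) * w y = 0"
      using x assms(2) by (intro IVT2' continuous_intros continuous_on_subset[OF cont])
        (auto simp: sgn_if)
    then obtain y where "0 \<le> y" "y \<le> x" "sgn (w 0) * w y = 0" by blast
    then show "\<exists>x\<in>{0..2}. w x = 0" using x(1) assms(2) by (auto simp: sgn_zero_iff)
  qed (metis mult_zero_right order_refl)
  also have "\<dots> \<longleftrightarrow> (\<forall>j::nat. \<exists>N k. k \<le> 2 * 2 ^ N \<and> sgn (w 0) * w (real k / 2 ^ N) \<le> 1 / real (Suc j))"
    by (intro nonpos_value_iff_dyadic continuous_intros cont)
  finally show ?thesis .
qed

lemma dyadic_refine:
  assumes "k \<le> 2 * 2 ^ N" "N \<le> N'"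
  shows "\<exists>k'\<le>2 * 2 ^ N'. real k' / 2 ^ N' = real k / 2 ^ N"
proof (intro exI conjI)
  have "(2::nat) ^ N' = 2 ^ N * 2 ^ (N' - N)" using assms(2) by (simp add: power_add[symmetric])
  then show "k * 2 ^ (N' - N) \<le> 2 * 2 ^ N'" using assms(1) by simp
  have "(2::real) ^ N' = 2 ^ N * 2 ^ (N' - N)" using assms(2) by (simp add: power_add[symmetric])
  then show "real (k * 2 ^ (N' - N)) / 2 ^ N' = real k / 2 ^ N" by simp
qed

definition dyadic_modulus :: "nat \<Rightarrow> (real \<Rightarrow> real) \<Rightarrow> real" where
  "dyadic_modulus N w = Max ((\<lambda>i. \<bar>w (real (Suc i) / 2 ^ N) - w (real i / 2 ^ N)\<bar>) ` {..<2 * 2 ^ N})"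

lemma dyadic_modulus_ge:
  "i < 2 * 2 ^ N \<Longrightarrow> \<bar>w (real (Suc i) / 2 ^ N) - w (real i / 2 ^ N)\<bar> \<le> dyadic_modulus N w"
  unfolding dyadic_modulus_def by (intro Max_ge) auto

lemma dyadic_modulus_nonneg: "0 \<le> dyadic_modulus N w"
  using dyadic_modulus_ge[of 0 N w] by (smt (verit) abs_ge_zero mult_pos_pos zero_less_numeral zero_less_power)

lemma dyadic_modulus_tendsto_0:
  assumes "continuous_on {0..2} w"
  shows "(\<lambda>N. dyadic_modulus N w) \<longlonglongrightarrow> 0"
proof (rule LIMSEQ_I)
  fix e :: real assume "0 < e"
  have "uniformly_continuous_on {0..2} w"
    using assms by (intro compact_uniformly_continuous) auto
  then obtain d where d: "0 < d" "\<And>x y. x \<in> {0..2} \<Longrightarrow> y \<in> {0..2} \<Longrightarrow> \<bar>y - x\<bar> < d \<Longrightarrow> \<bar>w y - w x\<bar> < e"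
    unfolding uniformly_continuous_on_def dist_real_def using \<open>0 < e\<close> by metis
  obtain N0 where N0: "(1 / 2 :: real) ^ N0 < d"
    using real_arch_pow_inv[OF d(1), of "1 / 2"] by auto
  have "dyadic_modulus N w < e" if "N0 \<le> N" for N
  proof -
    have "(1 / 2 :: real) ^ N \<le> (1 / 2) ^ N0" using that by (intro power_decreasing) auto
    then have small: "1 / 2 ^ N < d" using N0 by (simp add: power_divide)
    have "\<bar>w (real (Suc i) / 2 ^ N) - w (real i / 2 ^ N)\<bar> < e" if "i < 2 * 2 ^ N" for i
    proof (rule d(2))
      show "real i / 2 ^ N \<in> {0..2}" "real (Suc i) / 2 ^ N \<in> {0..2}"
        using that by (intro dyadic_in_range; simp)+
      have "real (Suc i) / 2 ^ N - real i / 2 ^ N = 1 / 2 ^ N" by (simp add: field_simps)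
      then show "\<bar>real (Suc i) / 2 ^ N - real i / 2 ^ N\<bar> < d" using small by simp
    qed
    then show ?thesis unfolding dyadic_modulus_def by (subst Max_less_iff) (auto simp: lessThan_empty_iff bot_nat_0.extremum_unique)
  qed
  then show "\<exists>no. \<forall>n\<ge>no. norm (dyadic_modulus n w - 0) < e"
    using dyadic_modulus_nonneg by auto
qed

text \<open>
  The interval \<open>[0, 2]\<close> is chosen so that both observation times \<open>1\<close> and \<open>2\<close> lie on every dyadic grid.
  At a fixed positive level \<open>\<epsilon>\<close> the grids are refined first: the passage events increase and the overshoot
  tends to \<open>0\<close>, which bounds the expectation by \<open>2 * L * \<epsilon>\<close>. Then \<open>\<epsilon>\<close> tends to \<open>0\<close>, and
  the passage events decrease to the event of a zero. A positive level is needed because a path could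
  touch \<open>0\<close> without any grid noticing.
\<close>

lemma (in prob_space) reflection_at_two_times:
  fixes W :: "real \<Rightarrow> 'a \<Rightarrow> real"
  assumes "reflectable \<Phi> C L"
    and cont: "\<And>\<omega>. \<omega> \<in> space M \<Longrightarrow> continuous_on {0..2} (\<lambda>x. W x \<omega>)"
    and W[measurable]: "\<And>x. x \<in> {0..2} \<Longrightarrow> random_variable borel (W x)"
    and indep: "\<And>N. indep_vars (\<lambda>_. borel) (\<lambda>i \<omega>. increment (\<lambda>j. W (real j / 2 ^ N) \<omega>) i) {..2 * 2 ^ N}"
    and sym: "\<And>x y. 0 \<le> x \<Longrightarrow> x \<le> y \<Longrightarrow> y \<le> 2 \<Longrightarrow>
        distr M borel (\<lambda>\<omega>. - (W y \<omega> - W x \<omega>)) = distr M borel (\<lambda>\<omega>. W y \<omega> - W x \<omega>)"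
  shows "expectation (\<lambda>\<omega>. of_bool (\<exists>x\<in>{0..2}. W x \<omega> = 0) * (sgn (W 0 \<omega>) * \<Phi> (W 1 \<omega>) (W 2 \<omega>))) = 0"
proof -
  interpret reflectable \<Phi> C L by fact
  have Wd[measurable]: "random_variable borel (\<lambda>\<omega>. W (real k / 2 ^ N) \<omega>)" if "k \<le> 2 * 2 ^ N" for k N
    using W dyadic_in_range[OF that] by simp
  have [measurable]: "random_variable borel (W 0)" "random_variable borel (W 1)" "random_variable borel (W 2)"
    by (intro W; simp)+
  define f where "f \<omega> = sgn (W 0 \<omega>) * \<Phi> (W 1 \<omega>) (W 2 \<omega>)" for \<omega>
  define low where "low \<epsilon> N \<omega> \<longleftrightarrow> (\<exists>k\<le>2 * 2 ^ N. sgn (W 0 \<omega>) * W (real k / 2 ^ N) \<omega> \<le> \<epsilon>)" for \<epsilon> N \<omega>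
  define a where "a \<epsilon> N \<omega> = of_bool (low \<epsilon> N \<omega>) * f \<omega>" for \<epsilon> N \<omega>
  define a' where "a' \<epsilon> \<omega> = of_bool (\<exists>N. low \<epsilon> N \<omega>) * f \<omega>" for \<epsilon> \<omega>
  define b where "b \<epsilon> N \<omega> = min C (2 * L * (\<epsilon> + dyadic_modulus N (\<lambda>x. W x \<omega>)))" for \<epsilon> N \<omega>
  have fm[measurable]: "random_variable borel f" unfolding f_def by measurable
  have f_le: "\<bar>f \<omega>\<bar> \<le> C" for \<omega>
    unfolding f_def using bounded C_nonneg by (auto simp: abs_mult sgn_if)
  have lowm[measurable]: "Measurable.pred M (low \<epsilon> N)" for \<epsilon> N
  proof -
    have "Measurable.pred M (\<lambda>\<omega>. \<exists>k\<in>{..2 * 2 ^ N}. sgn (W 0 \<omega>) * W (real k / 2 ^ N) \<omega> \<le> \<epsilon>)"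
      by (intro pred_intros_finite) (simp_all add: Wd)
    then show ?thesis unfolding low_def[abs_def] by (simp add: Bex_def)
  qed
  have am[measurable]: "random_variable borel (a \<epsilon> N)" for \<epsilon> N unfolding a_def by measurable
  have am'[measurable]: "random_variable borel (a' \<epsilon>)" for \<epsilon> unfolding a'_def by measurable
  have a_le: "\<bar>a \<epsilon> N \<omega>\<bar> \<le> C" "\<bar>a' \<epsilon> \<omega>\<bar> \<le> C" for \<epsilon> N \<omega>
    using f_le C_nonneg by (auto simp: a_def a'_def)
  have Dm[measurable]: "random_variable borel (\<lambda>\<omega>. dyadic_modulus N (\<lambda>x. W x \<omega>))" for N
    unfolding dyadic_modulus_def
    by (intro borel_measurable_Max borel_measurable_abs borel_measurable_diff Wd) auto
  have bm[measurable]: "random_variable borel (b \<epsilon> N)" for \<epsilon> N unfolding b_def by measurable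
  have bound: "\<bar>expectation (a \<epsilon> N)\<bar> \<le> expectation (b \<epsilon> N)" if "0 \<le> \<epsilon>" for \<epsilon> N
  proof -
    have "\<bar>expectation (\<lambda>\<omega>. of_bool (\<exists>k\<le>2 * 2 ^ N. sgn (W (real 0 / 2 ^ N) \<omega>) * W (real k / 2 ^ N) \<omega> \<le> \<epsilon>) *
        (sgn (W (real 0 / 2 ^ N) \<omega>) * \<Phi> (W (real (2 ^ N) / 2 ^ N) \<omega>) (W (real (2 * 2 ^ N) / 2 ^ N) \<omega>)))\<bar>
      \<le> expectation (\<lambda>\<omega>. min C (2 * L * (\<epsilon> + dyadic_modulus N (\<lambda>x. W x \<omega>))))"
    proof (rule discrete_reflection_bound[where S = "\<lambda>k. W (real k / 2 ^ N)"])
      show "reflectable \<Phi> C L" by fact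
      show "indep_vars (\<lambda>_. borel) (\<lambda>i \<omega>. increment (\<lambda>j. W (real j / 2 ^ N) \<omega>) i) {..2 * 2 ^ N}"
        by (rule indep)
      fix i :: nat assume i: "i < 2 * 2 ^ N"
      show "distr M borel (\<lambda>\<omega>. - (W (real (Suc i) / 2 ^ N) \<omega> - W (real i / 2 ^ N) \<omega>))
          = distr M borel (\<lambda>\<omega>. W (real (Suc i) / 2 ^ N) \<omega> - W (real i / 2 ^ N) \<omega>)"
        using dyadic_in_range[of "Suc i" N] i by (intro sym) (auto intro: divide_right_mono)
      show "\<bar>W (real (Suc i) / 2 ^ N) \<omega> - W (real i / 2 ^ N) \<omega>\<bar> \<le> dyadic_modulus N (\<lambda>x. W x \<omega>)" for \<omega>
        using dyadic_modulus_ge[OF i, of "\<lambda>x. W x \<omega>"] .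
    qed (use that dyadic_modulus_nonneg in auto)
    then show ?thesis by (simp add: a_def[abs_def] b_def[abs_def] low_def f_def)
  qed
  have lim_a: "(\<lambda>N. a \<epsilon> N \<omega>) \<longlonglongrightarrow> a' \<epsilon> \<omega>" for \<epsilon> \<omega>
  proof (cases "\<exists>N. low \<epsilon> N \<omega>")
    case True
    then obtain N where "low \<epsilon> N \<omega>" by blast
    then have "low \<epsilon> N' \<omega>" if "N \<le> N'" for N'
      using dyadic_refine[OF _ that] unfolding low_def by metis
    then have "\<forall>\<^sub>F N' in sequentially. a \<epsilon> N' \<omega> = a' \<epsilon> \<omega>"
      unfolding eventually_sequentially a_def a'_def using True by (intro exI[of _ N]) auto
    then show ?thesis by (rule tendsto_eventually)
  qed (auto simp: a_def a'_def)
  \<comment> \<open>The grids are refined at a fixed level.\<close>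
  have bound': "\<bar>expectation (a' \<epsilon>)\<bar> \<le> 2 * L * \<epsilon>" if \<epsilon>: "0 \<le> \<epsilon>" for \<epsilon>
  proof -
    have "(\<lambda>N. expectation (a \<epsilon> N)) \<longlonglongrightarrow> expectation (a' \<epsilon>)"
      by (rule integral_dominated_convergence[where w = "\<lambda>_. C"]) (auto simp: lim_a a_le)
    moreover have "(\<lambda>N. expectation (b \<epsilon> N)) \<longlonglongrightarrow> expectation (\<lambda>\<omega>. min C (2 * L * (\<epsilon> + 0)))"
    proof (rule integral_dominated_convergence[where w = "\<lambda>_. C"])
      show "AE \<omega> in M. (\<lambda>N. b \<epsilon> N \<omega>) \<longlonglongrightarrow> min C (2 * L * (\<epsilon> + 0))"
        unfolding b_def by (intro AE_I2 tendsto_intros dyadic_modulus_tendsto_0 cont)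
      show "AE \<omega> in M. norm (b \<epsilon> N \<omega>) \<le> C" for N
        unfolding b_def using C_nonneg L_nonneg \<epsilon> dyadic_modulus_nonneg by (auto simp: min_def)
    qed auto
    ultimately have "\<bar>expectation (a' \<epsilon>)\<bar> \<le> expectation (\<lambda>\<omega>. min C (2 * L * (\<epsilon> + 0)))"
      by (intro LIMSEQ_le[OF tendsto_rabs]) (auto intro: bound[OF \<epsilon>])
    also have "\<dots> \<le> 2 * L * \<epsilon>" by (simp add: prob_space)
    finally show ?thesis .
  qed
  define h where "h \<omega> = of_bool (\<exists>x\<in>{0..2}. W x \<omega> = 0) * f \<omega>" for \<omega>
  \<comment> \<open>A path starting in 0 is harmless, because the factor \<open>sgn (W 0 \<omega>)\<close> vanishes.\<close>
  have lim_a': "(\<lambda>j. a' (1 / real (Suc j)) \<omega>) \<longlonglongrightarrow> h \<omega>" if \<omega>: "\<omega> \<in> space M" for \<omega>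
  proof (cases "W 0 \<omega> = 0")
    case True then show ?thesis by (simp add: a'_def h_def f_def)
  next
    case False
    have iff: "(\<exists>x\<in>{0..2}. W x \<omega> = 0) \<longleftrightarrow> (\<forall>j. \<exists>N. low (1 / real (Suc j)) N \<omega>)"
      using zero_iff_dyadic_sgn[OF cont[OF \<omega>] False] unfolding low_def by simp
    show ?thesis
    proof (cases "\<exists>x\<in>{0..2}. W x \<omega> = 0")
      case True then show ?thesis using iff by (simp add: a'_def h_def)
    next
      case False
      then obtain j0 where j0: "\<not> (\<exists>N. low (1 / real (Suc j0)) N \<omega>)" using iff by blast
      have "\<not> (\<exists>N. low (1 / real (Suc j)) N \<omega>)" if "j0 \<le> j" for j
      proof -
        have "1 / real (Suc j) \<le> 1 / real (Suc j0)" using that by (intro divide_left_mono) auto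
        then show ?thesis using j0 unfolding low_def by (meson order_trans)
      qed
      then have "\<forall>\<^sub>F j in sequentially. a' (1 / real (Suc j)) \<omega> = h \<omega>"
        unfolding eventually_sequentially a'_def h_def using False by (intro exI[of _ j0]) auto
      then show ?thesis by (rule tendsto_eventually)
    qed
  qed
  have hm[measurable]: "random_variable borel h"
    using lim_a' by (rule borel_measurable_LIMSEQ_metric[rotated]) measurable
  have "(\<lambda>j. expectation (a' (1 / real (Suc j)))) \<longlonglongrightarrow> expectation h"
    using lim_a' by (intro integral_dominated_convergence[where w = "\<lambda>_. C"] AE_I2) (auto simp: a_le)
  moreover have "(\<lambda>j. expectation (a' (1 / real (Suc j)))) \<longlonglongrightarrow> 0"
  proof (rule Lim_null_comparison)
    show "\<forall>\<^sub>F j in sequentially. norm (expectation (a' (1 / real (Suc j)))) \<le> 2 * L * (1 / real (Suc j))"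
    proof (intro always_eventually allI)
      show "norm (expectation (a' (1 / real (Suc j)))) \<le> 2 * L * (1 / real (Suc j))" for j
        unfolding real_norm_def by (rule bound') simp
    qed
    show "(\<lambda>j. 2 * L * (1 / real (Suc j))) \<longlonglongrightarrow> 0"
      by real_asymp
  qed
  ultimately have "expectation h = 0" by (rule LIMSEQ_unique)
  then show ?thesis by (simp add: h_def[abs_def] f_def)
qed

section \<open>Bounded odd test functions\<close>

text \<open>
  The odd functions of which \<open>1 / z\<close> is a mixture over \<open>\<kappa>\<close>.
\<close>

definition gauss_moment :: "real \<Rightarrow> real \<Rightarrow> real" where
  "gauss_moment \<kappa> z = z * exp (- (\<kappa> * z\<^sup>2 / 2))"

lemma gauss_moment_measurable[measurable]: "gauss_moment \<kappa> \<in> borel_measurable borel"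
  unfolding gauss_moment_def by measurable

lemma gauss_moment_minus: "gauss_moment \<kappa> (- z) = - gauss_moment \<kappa> z"
  by (simp add: gauss_moment_def)

lemma sgn_gauss_moment: "sgn (gauss_moment \<kappa> z) = sgn z"
  by (simp add: gauss_moment_def sgn_mult)

lemma abs_gauss_moment_le:
  assumes "0 < \<kappa>"
  shows "\<bar>gauss_moment \<kappa> z\<bar> \<le> 1 / 2 + 1 / \<kappa>"
proof -
  have "2 * \<bar>z\<bar> \<le> 1 + z\<^sup>2"
    using zero_le_power2[of "\<bar>z\<bar> - 1"] by (simp add: power2_diff)
  moreover have "1 / 2 + z\<^sup>2 / 2 \<le> (1 / 2 + 1 / \<kappa>) * (1 + \<kappa> * z\<^sup>2 / 2)"
    using assms by (simp add: field_simps)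
  moreover have "(1 / 2 + 1 / \<kappa>) * (1 + \<kappa> * z\<^sup>2 / 2) \<le> (1 / 2 + 1 / \<kappa>) * exp (\<kappa> * z\<^sup>2 / 2)"
    using assms by (intro mult_left_mono exp_ge_add_one_self) auto
  ultimately have "\<bar>z\<bar> \<le> (1 / 2 + 1 / \<kappa>) * exp (\<kappa> * z\<^sup>2 / 2)" by linarith
  then show ?thesis
    by (simp add: gauss_moment_def abs_mult exp_minus field_simps)
qed

lemma gauss_moment_lipschitz:
  assumes "0 < \<kappa>"
  shows "\<bar>gauss_moment \<kappa> z - gauss_moment \<kappa> z'\<bar> \<le> 2 * \<bar>z - z'\<bar>"
proof -
  have "norm (gauss_moment \<kappa> z - gauss_moment \<kappa> z') \<le> 2 * norm (z - z')"
  proof (rule field_differentiable_bound[of UNIV])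
    fix x :: real
    show "(gauss_moment \<kappa> has_field_derivative (1 - \<kappa> * x\<^sup>2) * exp (- (\<kappa> * x\<^sup>2 / 2))) (at x within UNIV)"
      unfolding gauss_moment_def
      by (auto intro!: derivative_eq_intros simp: power2_eq_square algebra_simps)
    have "0 \<le> \<kappa> * x\<^sup>2" using assms by simp
    then have "\<bar>1 - \<kappa> * x\<^sup>2\<bar> \<le> 2 * (1 + \<kappa> * x\<^sup>2 / 2)" by simp
    also have "\<dots> \<le> 2 * exp (\<kappa> * x\<^sup>2 / 2)" by (intro mult_left_mono exp_ge_add_one_self) auto
    finally show "norm ((1 - \<kappa> * x\<^sup>2) * exp (- (\<kappa> * x\<^sup>2 / 2))) \<le> 2"
      by (simp add: abs_mult exp_minus field_simps)
  qed auto
  then show ?thesis by simp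
qed

text \<open>
  The factor \<open>\<bar>y\<bar>\<close> is truncated to make the test function bounded and Lipschitz.
\<close>

lemma reflectable_truncation:
  assumes \<kappa>: "0 < \<kappa>" and K: "0 \<le> K"
  shows "reflectable (\<lambda>y z. min \<bar>y\<bar> K * gauss_moment \<kappa> z) (K * (1 / 2 + 1 / \<kappa>)) (1 / 2 + 1 / \<kappa> + 2 * K)"
proof
  fix y z y' z' :: real
  have mK: "\<bar>min \<bar>x\<bar> K\<bar> \<le> K" for x using K by auto
  have m1: "\<bar>min \<bar>y\<bar> K - min \<bar>y'\<bar> K\<bar> \<le> \<bar>y - y'\<bar>" by (simp add: min_def abs_if)
  note g = abs_gauss_moment_le[OF \<kappa>] gauss_moment_lipschitz[OF \<kappa>]
  show "\<bar>min \<bar>y\<bar> K * gauss_moment \<kappa> z\<bar> \<le> K * (1 / 2 + 1 / \<kappa>)"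
    unfolding abs_mult using g mK K by (intro mult_mono) auto
  have "min \<bar>y\<bar> K * gauss_moment \<kappa> z - min \<bar>y'\<bar> K * gauss_moment \<kappa> z'
      = (min \<bar>y\<bar> K - min \<bar>y'\<bar> K) * gauss_moment \<kappa> z + min \<bar>y'\<bar> K * (gauss_moment \<kappa> z - gauss_moment \<kappa> z')"
    by (simp add: algebra_simps)
  also have "\<bar>\<dots>\<bar> \<le> \<bar>y - y'\<bar> * (1 / 2 + 1 / \<kappa>) + K * (2 * \<bar>z - z'\<bar>)"
    by (intro order_trans[OF abs_triangle_ineq] add_mono; unfold abs_mult;
        intro mult_mono g m1 mK) (use \<kappa> K in auto)
  also have "\<dots> \<le> (1 / 2 + 1 / \<kappa> + 2 * K) * (\<bar>y - y'\<bar> + \<bar>z - z'\<bar>)"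
    using \<kappa> K by (simp add: algebra_simps add_nonneg_nonneg)
  finally show "\<bar>min \<bar>y\<bar> K * gauss_moment \<kappa> z - min \<bar>y'\<bar> K * gauss_moment \<kappa> z'\<bar>
      \<le> (1 / 2 + 1 / \<kappa> + 2 * K) * (\<bar>y - y'\<bar> + \<bar>z - z'\<bar>)" .
qed (simp_all add: gauss_moment_minus)


section \<open>The reflection principle for Brownian motion\<close>

lemma (in prob_space) indep_vars_cong_space:
  assumes "indep_vars M' X I" and eq: "\<And>i \<omega>. i \<in> I \<Longrightarrow> \<omega> \<in> space M \<Longrightarrow> X i \<omega> = Y i \<omega>"
  shows "indep_vars M' Y I"
proof -
  have "random_variable (M' i) (X i) \<longleftrightarrow> random_variable (M' i) (Y i)" if "i \<in> I" for i
    using eq that by (intro measurable_cong) auto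
  moreover have "{X i -` A \<inter> space M |A. A \<in> sets (M' i)} = {Y i -` A \<inter> space M |A. A \<in> sets (M' i)}" if "i \<in> I" for i
  proof -
    have "X i -` A \<inter> space M = Y i -` A \<inter> space M" for A using eq[OF that] by auto
    then show ?thesis by simp
  qed
  ultimately show ?thesis
    using assms(1) unfolding indep_vars_def2 by (simp cong: indep_sets_cong)
qed

locale brownian_motion = prob_space M for M :: "'a measure" +
  fixes B :: "real \<Rightarrow> 'a \<Rightarrow> real"
  assumes bm: "standard_brownian_motion M B"
begin

lemma B_measurable[measurable]: "0 \<le> t \<Longrightarrow> random_variable borel (B t)"
  using bm by (simp add: standard_brownian_motion_def)

lemma B_0: "\<omega> \<in> space M \<Longrightarrow> B 0 \<omega> = 0"
  using bm by (simp add: standard_brownian_motion_def)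

lemma B_continuous: "\<omega> \<in> space M \<Longrightarrow> continuous_on {0..} (\<lambda>t. B t \<omega>)"
  using bm by (simp add: standard_brownian_motion_def)

lemma increment_distributed:
  "0 \<le> s \<Longrightarrow> s < t \<Longrightarrow> distributed M lborel (\<lambda>\<omega>. B t \<omega> - B s \<omega>) (normal_density 0 (sqrt (t - s)))"
  using bm by (simp add: standard_brownian_motion_def)

lemma increments_indep:
  assumes "0 \<le> \<tau> 0" "\<And>i. i < n \<Longrightarrow> \<tau> i \<le> \<tau> (Suc i)"
  shows "indep_vars (\<lambda>_. borel) (\<lambda>i \<omega>. B (\<tau> (Suc i)) \<omega> - B (\<tau> i) \<omega>) {..<n::nat}"
  using bm assms unfolding standard_brownian_motion_def by blast

lemma increment_distr:
  assumes "0 \<le> s" "s < t"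
  shows "distr M borel (\<lambda>\<omega>. B t \<omega> - B s \<omega>) = density lborel (normal_density 0 (sqrt (t - s)))"
proof -
  have "distr M borel (\<lambda>\<omega>. B t \<omega> - B s \<omega>) = distr M lborel (\<lambda>\<omega>. B t \<omega> - B s \<omega>)"
    by (intro distr_cong) auto
  then show ?thesis using distributed_distr_eq_density[OF increment_distributed[OF assms]] by simp
qed

lemma B_distr:
  assumes "0 < t"
  shows "distr M borel (B t) = density lborel (normal_density 0 (sqrt t))"
proof -
  have "distr M borel (B t) = distr M borel (\<lambda>\<omega>. B t \<omega> - B 0 \<omega>)"
    by (intro distr_cong) (auto simp: B_0)
  with increment_distr[of 0 t] assms show ?thesis by simp
qed

lemma increment_symmetric:
  assumes "0 \<le> s" "s \<le> t"
  shows "distr M borel (\<lambda>\<omega>. - (B t \<omega> - B s \<omega>)) = distr M borel (\<lambda>\<omega>. B t \<omega> - B s \<omega>)"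
proof (cases "s = t")
  case False
  then have *: "0 \<le> s" "s < t" using assms by auto
  have "distributed M lborel (\<lambda>\<omega>. 0 + (- 1) * (B t \<omega> - B s \<omega>)) (normal_density (0 + (- 1) * 0) (\<bar>- 1\<bar> * sqrt (t - s)))"
    using * by (intro normal_density_affine increment_distributed) auto
  then have "distr M lborel (\<lambda>\<omega>. - (B t \<omega> - B s \<omega>)) = density lborel (normal_density 0 (sqrt (t - s)))"
    by (simp add: distributed_distr_eq_density)
  moreover have "distr M borel (\<lambda>\<omega>. - (B t \<omega> - B s \<omega>)) = distr M lborel (\<lambda>\<omega>. - (B t \<omega> - B s \<omega>))"
    by (intro distr_cong) auto
  ultimately show ?thesis using increment_distr[OF *] by simp
qed simp

lemma integrable_abs_B:
  assumes "0 < s" shows "integrable M (\<lambda>\<omega>. \<bar>B s \<omega>\<bar>)"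
proof -
  have "integrable lborel (\<lambda>x. normal_density 0 (sqrt s) x * \<bar>x - 0\<bar> ^ 1)"
    using assms by (intro integrable_normal_moment_abs) simp
  then have "integrable (density lborel (normal_density 0 (sqrt s))) (\<lambda>x. \<bar>x\<bar>)"
    by (subst integrable_density) auto
  then show ?thesis
    unfolding B_distr[OF assms, symmetric] using assms by (subst (asm) integrable_distr_eq) auto
qed

text \<open>
  A monotone parametrization of \<open>[r, 1]\<close> by \<open>[0, 2]\<close> that sends the dyadic points \<open>1\<close> and \<open>2\<close> to the
  observation times \<open>s\<close> and \<open>1\<close>.
\<close>

definition path_clock :: "real \<Rightarrow> real \<Rightarrow> real \<Rightarrow> real" where
  "path_clock r s x = r + (s - r) * min x 1 + (1 - s) * max 0 (x - 1)"

lemma path_clock_values: "path_clock r s 0 = r" "path_clock r s 1 = s" "path_clock r s 2 = 1"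
  by (auto simp: path_clock_def)

lemma path_clock_mono:
  assumes "r \<le> s" "s \<le> 1" "x \<le> y"
  shows "path_clock r s x \<le> path_clock r s y"
  unfolding path_clock_def using assms by (intro add_mono mult_left_mono) auto

lemma path_clock_continuous: "continuous_on A (path_clock r s)"
  unfolding path_clock_def by (intro continuous_intros)

lemma path_clock_image:
  assumes "r \<le> s" "s \<le> 1"
  shows "path_clock r s ` {0..2} = {r..1}"
proof
  show "path_clock r s ` {0..2} \<subseteq> {r..1}"
    using path_clock_mono[OF assms, of 0] path_clock_mono[OF assms, of _ 2] by (auto simp: path_clock_values)
  show "{r..1} \<subseteq> path_clock r s ` {0..2}"
  proof
    fix t assume "t \<in> {r..1}"
    then have "\<exists>x. 0 \<le> x \<and> x \<le> 2 \<and> path_clock r s x = t"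
      by (intro IVT' path_clock_continuous) (auto simp: path_clock_values)
    then show "t \<in> path_clock r s ` {0..2}" by auto
  qed
qed

lemma zero_in_interval_iff:
  assumes "r \<le> s" "s \<le> 1"
  shows "(\<exists>t\<in>{r..1}. B t \<omega> = 0) \<longleftrightarrow> (\<exists>x\<in>{0..2}. B (path_clock r s x) \<omega> = 0)"
  unfolding path_clock_image[OF assms, symmetric] by blast

lemma clocked_continuous:
  assumes "0 \<le> r" "r \<le> s" "s \<le> 1" "\<omega> \<in> space M"
  shows "continuous_on {0..2} (\<lambda>x. B (path_clock r s x) \<omega>)"
  by (rule continuous_on_compose2[OF B_continuous[OF assms(4)] path_clock_continuous])
     (use path_clock_image[OF assms(2,3)] assms(1) in auto)

lemma measurable_zero_in_interval[measurable]:
  assumes "0 \<le> r"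
  shows "Measurable.pred M (\<lambda>\<omega>. \<exists>t\<in>{r..1}. B t \<omega> = 0)"
proof (cases "r \<le> 1")
  case True
  define W where "W x \<omega> = B (path_clock r 1 x) \<omega>" for x \<omega>
  have [measurable]: "random_variable borel (W x)" if "0 \<le> x" for x
    unfolding W_def using path_clock_mono[of r 1 0 x] True that assms
    by (intro B_measurable) (auto simp: path_clock_values)
  have "Measurable.pred M (\<lambda>\<omega>. \<forall>j::nat. \<exists>N k::nat. k \<le> 2 * 2 ^ N \<and> \<bar>W (real k / 2 ^ N) \<omega>\<bar> \<le> 1 / real (Suc j))"
    by measurable
  moreover have "(\<exists>t\<in>{r..1}. B t \<omega> = 0) \<longleftrightarrow>
      (\<forall>j::nat. \<exists>N k. k \<le> 2 * 2 ^ N \<and> \<bar>W (real k / 2 ^ N) \<omega>\<bar> \<le> 1 / real (Suc j))" if "\<omega> \<in> space M" for \<omega>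
    using zero_iff_dyadic[OF clocked_continuous[OF assms True order_refl that]] True
    by (simp add: zero_in_interval_iff W_def)
  ultimately show ?thesis by (simp cong: measurable_cong)
qed simp

lemma clocked_increments_indep:
  assumes "0 \<le> r" "r \<le> s" "s \<le> 1"
  shows "indep_vars (\<lambda>_. borel) (\<lambda>i \<omega>. increment (\<lambda>j. B (path_clock r s (real j / 2 ^ N)) \<omega>) i) {..m}"
proof -
  \<comment> \<open>Time 0 is put in front, so that the initial value of the clocked path is itself an increment.\<close>
  define \<tau> where "\<tau> i = (case i of 0 \<Rightarrow> 0 | Suc j \<Rightarrow> path_clock r s (real j / 2 ^ N))" for i
  have mono: "\<tau> i \<le> \<tau> (Suc i)" for i
    using assms by (cases i) (auto simp: \<tau>_def path_clock_values intro!: path_clock_mono divide_right_mono)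
  have "indep_vars (\<lambda>_. borel) (\<lambda>i \<omega>. B (\<tau> (Suc i)) \<omega> - B (\<tau> i) \<omega>) {..<Suc m}"
    using mono by (intro increments_indep) (auto simp: \<tau>_def)
  then have "indep_vars (\<lambda>_. borel) (\<lambda>i \<omega>. increment (\<lambda>j. B (path_clock r s (real j / 2 ^ N)) \<omega>) i) {..<Suc m}"
    by (rule indep_vars_cong_space) (auto simp: \<tau>_def increment_def B_0 split: nat.split)
  then show ?thesis by (simp add: lessThan_Suc_atMost)
qed

lemma reflection_principle:
  assumes "reflectable \<Phi> C L" and rs: "0 \<le> r" "r \<le> s" "s \<le> 1"
  shows "expectation (\<lambda>\<omega>. of_bool (\<exists>t\<in>{r..1}. B t \<omega> = 0) * (sgn (B r \<omega>) * \<Phi> (B s \<omega>) (B 1 \<omega>))) = 0"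
proof -
  have nonneg: "0 \<le> path_clock r s x" if "0 \<le> x" for x
    using path_clock_mono[OF rs(2,3) that] rs by (simp add: path_clock_values)
  have "expectation (\<lambda>\<omega>. of_bool (\<exists>x\<in>{0..2}. B (path_clock r s x) \<omega> = 0) *
      (sgn (B (path_clock r s 0) \<omega>) * \<Phi> (B (path_clock r s 1) \<omega>) (B (path_clock r s 2) \<omega>))) = 0"
    using assms nonneg
    by (intro reflection_at_two_times[where W = "\<lambda>x. B (path_clock r s x)"] clocked_increments_indep
        clocked_continuous increment_symmetric B_measurable path_clock_mono) auto
  then show ?thesis by (simp add: zero_in_interval_iff[OF rs(2,3)] path_clock_values)
qed

text \<open>
  The truncation of \<open>\<bar>B s\<bar>\<close> is removed by dominated convergence.
\<close>

lemma reflection_gauss_moment: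
  assumes rs: "0 \<le> r" "r \<le> s" "s \<le> 1" and s: "0 < s" and \<kappa>: "0 < \<kappa>"
  shows "expectation (\<lambda>\<omega>. of_bool (\<exists>t\<in>{r..1}. B t \<omega> = 0) * (sgn (B r \<omega>) * (\<bar>B s \<omega>\<bar> * gauss_moment \<kappa> (B 1 \<omega>)))) = 0"
proof -
  have [measurable]: "Measurable.pred M (\<lambda>\<omega>. \<exists>t\<in>{r..1}. B t \<omega> = 0)"
    using rs by (intro measurable_zero_in_interval)
  have [measurable]: "random_variable borel (B r)" "random_variable borel (B s)" "random_variable borel (B 1)"
    using rs s by (auto intro: B_measurable)
  define h where "h y \<omega> = of_bool (\<exists>t\<in>{r..1}. B t \<omega> = 0) * (sgn (B r \<omega>) * (y * gauss_moment \<kappa> (B 1 \<omega>)))" for y \<omega>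
  have h_le: "\<bar>h y \<omega>\<bar> \<le> \<bar>y\<bar> * (1 / 2 + 1 / \<kappa>)" for y \<omega>
  proof -
    have "\<bar>h y \<omega>\<bar> \<le> \<bar>y\<bar> * \<bar>gauss_moment \<kappa> (B 1 \<omega>)\<bar>"
      by (auto simp: h_def abs_mult abs_sgn_eq)
    also have "\<dots> \<le> \<bar>y\<bar> * (1 / 2 + 1 / \<kappa>)"
      using abs_gauss_moment_le[OF \<kappa>] by (intro mult_left_mono) auto
    finally show ?thesis .
  qed
  have "(\<lambda>n. expectation (\<lambda>\<omega>. h (min \<bar>B s \<omega>\<bar> (real n)) \<omega>)) \<longlonglongrightarrow> expectation (\<lambda>\<omega>. h \<bar>B s \<omega>\<bar> \<omega>)"
  proof (rule integral_dominated_convergence[where w = "\<lambda>\<omega>. \<bar>B s \<omega>\<bar> * (1 / 2 + 1 / \<kappa>)"])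
    show "AE \<omega> in M. (\<lambda>n. h (min \<bar>B s \<omega>\<bar> (real n)) \<omega>) \<longlonglongrightarrow> h \<bar>B s \<omega>\<bar> \<omega>"
    proof (intro AE_I2 tendsto_eventually)
      fix \<omega>
      obtain n0 where "\<bar>B s \<omega>\<bar> \<le> real n0" using real_arch_simple by blast
      then show "\<forall>\<^sub>F n in sequentially. h (min \<bar>B s \<omega>\<bar> (real n)) \<omega> = h \<bar>B s \<omega>\<bar> \<omega>"
        unfolding eventually_sequentially by (intro exI[of _ n0]) (auto simp: min_def)
    qed
    show "AE \<omega> in M. norm (h (min \<bar>B s \<omega>\<bar> (real n)) \<omega>) \<le> \<bar>B s \<omega>\<bar> * (1 / 2 + 1 / \<kappa>)" for n
    proof (intro AE_I2)
      fix \<omega>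
      have "\<bar>min \<bar>B s \<omega>\<bar> (real n)\<bar> * (1 / 2 + 1 / \<kappa>) \<le> \<bar>B s \<omega>\<bar> * (1 / 2 + 1 / \<kappa>)"
        using \<kappa> by (intro mult_right_mono) auto
      then show "norm (h (min \<bar>B s \<omega>\<bar> (real n)) \<omega>) \<le> \<bar>B s \<omega>\<bar> * (1 / 2 + 1 / \<kappa>)"
        using h_le[of "min \<bar>B s \<omega>\<bar> (real n)" \<omega>] by simp
    qed
    show "integrable M (\<lambda>\<omega>. \<bar>B s \<omega>\<bar> * (1 / 2 + 1 / \<kappa>))"
      using integrable_abs_B[OF s] by (intro integrable_mult_left) auto
  qed (unfold h_def, measurable)
  moreover have "expectation (\<lambda>\<omega>. h (min \<bar>B s \<omega>\<bar> (real n)) \<omega>) = 0" for n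
    unfolding h_def using reflection_principle[OF reflectable_truncation[OF \<kappa>] rs, of "real n"] by simp
  ultimately have "expectation (\<lambda>\<omega>. h \<bar>B s \<omega>\<bar> \<omega>) = 0"
    by (simp add: LIMSEQ_const_iff)
  then show ?thesis by (simp add: h_def)
qed

lemma sgn_eq_if_no_zero:
  assumes "0 \<le> r" "r \<le> 1" "\<omega> \<in> space M" "\<not> (\<exists>t\<in>{r..1}. B t \<omega> = 0)"
  shows "sgn (B r \<omega>) = sgn (B 1 \<omega>)"
proof (rule ccontr)
  have cont: "continuous_on {r..1} (\<lambda>t. B t \<omega>)"
    using assms by (intro continuous_on_subset[OF B_continuous]) auto
  assume "sgn (B r \<omega>) \<noteq> sgn (B 1 \<omega>)"
  then have "B r \<omega> \<le> 0 \<and> 0 \<le> B 1 \<omega> \<or> B 1 \<omega> \<le> 0 \<and> 0 \<le> B r \<omega>"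
    by (auto simp: sgn_if split: if_splits)
  then have "\<exists>t. r \<le> t \<and> t \<le> 1 \<and> B t \<omega> = 0"
    using IVT'[OF _ _ assms(2) cont] IVT2'[OF _ _ assms(2) cont] by blast
  then show False using assms(4) by auto
qed

text \<open>
  Where there is no zero the signed integrand is nonnegative, because \<open>B r\<close> and \<open>B 1\<close> have the same sign;
  where there is one it contributes \<open>0\<close> by reflection.
\<close>

lemma nn_integral_no_zero:
  assumes rs: "0 \<le> r" "r \<le> s" "s \<le> 1" and s: "0 < s" and \<kappa>: "0 < \<kappa>"
  shows "(\<integral>\<^sup>+\<omega>. ennreal (\<bar>B s \<omega>\<bar> * \<bar>gauss_moment \<kappa> (B 1 \<omega>)\<bar>) * of_bool (\<not> (\<exists>t\<in>{r..1}. B t \<omega> = 0)) \<partial>M)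
    = ennreal (expectation (\<lambda>\<omega>. sgn (B r \<omega>) * (\<bar>B s \<omega>\<bar> * gauss_moment \<kappa> (B 1 \<omega>))))"
proof -
  have [measurable]: "Measurable.pred M (\<lambda>\<omega>. \<exists>t\<in>{r..1}. B t \<omega> = 0)"
    using rs by (intro measurable_zero_in_interval)
  have [measurable]: "random_variable borel (B r)" "random_variable borel (B s)" "random_variable borel (B 1)"
    using rs s by (auto intro: B_measurable)
  define f where "f \<omega> = sgn (B r \<omega>) * (\<bar>B s \<omega>\<bar> * gauss_moment \<kappa> (B 1 \<omega>))" for \<omega>
  define Z where "Z \<omega> \<longleftrightarrow> (\<exists>t\<in>{r..1}. B t \<omega> = 0)" for \<omega>
  have [measurable]: "Measurable.pred M Z" "random_variable borel f" unfolding Z_def f_def by measurable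
  have f_le: "\<bar>f \<omega>\<bar> \<le> \<bar>B s \<omega>\<bar> * (1 / 2 + 1 / \<kappa>)" for \<omega>
  proof -
    have "\<bar>f \<omega>\<bar> \<le> \<bar>B s \<omega>\<bar> * \<bar>gauss_moment \<kappa> (B 1 \<omega>)\<bar>"
      by (auto simp: f_def abs_mult abs_sgn_eq)
    also have "\<dots> \<le> \<bar>B s \<omega>\<bar> * (1 / 2 + 1 / \<kappa>)"
      using abs_gauss_moment_le[OF \<kappa>] by (intro mult_left_mono) auto
    finally show ?thesis .
  qed
  have int: "integrable M (\<lambda>\<omega>. of_bool (P \<omega>) * f \<omega>)" if [measurable]: "Measurable.pred M P" for P
  proof (rule Bochner_Integration.integrable_bound)
    show "integrable M (\<lambda>\<omega>. \<bar>B s \<omega>\<bar> * (1 / 2 + 1 / \<kappa>))"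
      using integrable_abs_B[OF s] by (intro integrable_mult_left) auto
    show "AE \<omega> in M. norm (of_bool (P \<omega>) * f \<omega>) \<le> norm (\<bar>B s \<omega>\<bar> * (1 / 2 + 1 / \<kappa>))"
    proof (intro AE_I2)
      fix \<omega>
      have "norm (of_bool (P \<omega>) * f \<omega>) \<le> \<bar>f \<omega>\<bar>" by auto
      also note f_le
      also have "\<bar>B s \<omega>\<bar> * (1 / 2 + 1 / \<kappa>) \<le> norm (\<bar>B s \<omega>\<bar> * (1 / 2 + 1 / \<kappa>))" by simp
      finally show "norm (of_bool (P \<omega>) * f \<omega>) \<le> norm (\<bar>B s \<omega>\<bar> * (1 / 2 + 1 / \<kappa>))" .
    qed
  qed measurable
  have eq: "of_bool (\<not> Z \<omega>) * f \<omega> = \<bar>B s \<omega>\<bar> * \<bar>gauss_moment \<kappa> (B 1 \<omega>)\<bar> * of_bool (\<not> Z \<omega>)" if "\<omega> \<in> space M" for \<omega>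
  proof (cases "Z \<omega>")
    case False
    then have "sgn (B r \<omega>) = sgn (gauss_moment \<kappa> (B 1 \<omega>))"
      using sgn_eq_if_no_zero[OF rs(1) _ that] rs unfolding Z_def sgn_gauss_moment by simp
    then show ?thesis using False by (simp add: f_def abs_sgn ac_simps)
  qed simp
  have "(\<integral>\<^sup>+\<omega>. ennreal (\<bar>B s \<omega>\<bar> * \<bar>gauss_moment \<kappa> (B 1 \<omega>)\<bar>) * of_bool (\<not> Z \<omega>) \<partial>M)
      = (\<integral>\<^sup>+\<omega>. ennreal (of_bool (\<not> Z \<omega>) * f \<omega>) \<partial>M)"
    by (intro nn_integral_cong) (auto simp: eq)
  also have "\<dots> = ennreal (expectation (\<lambda>\<omega>. of_bool (\<not> Z \<omega>) * f \<omega>))"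
    by (intro nn_integral_eq_integral int AE_I2) (auto simp: eq)
  also have "expectation (\<lambda>\<omega>. of_bool (\<not> Z \<omega>) * f \<omega>) = expectation (\<lambda>\<omega>. f \<omega> - of_bool (Z \<omega>) * f \<omega>)"
    by (intro Bochner_Integration.integral_cong) auto
  also have "\<dots> = expectation f - expectation (\<lambda>\<omega>. of_bool (Z \<omega>) * f \<omega>)"
    using int[of "\<lambda>_. True"] int[of Z] by (intro Bochner_Integration.integral_diff) auto
  also have "expectation (\<lambda>\<omega>. of_bool (Z \<omega>) * f \<omega>) = 0"
    unfolding Z_def f_def by (rule reflection_gauss_moment) fact+
  finally show ?thesis by (simp add: Z_def f_def[abs_def])
qed

end

section \<open>Elementary integrals\<close>

text \<open>
  Only one-sided limits of the antiderivative are required at the end points, as needed for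
  \<open>exp (- 1 / v\<^sup>2)\<close> at \<open>0\<close>.
\<close>

lemma nn_integral_FTC_Ioo:
  fixes f F :: "real \<Rightarrow> real"
  assumes "a < b"
    and deriv: "\<And>x. a < x \<Longrightarrow> x < b \<Longrightarrow> (F has_real_derivative f x) (at x)"
    and cont: "continuous_on {a<..<b} f"
    and nonneg: "\<And>x. a < x \<Longrightarrow> x < b \<Longrightarrow> 0 \<le> f x"
    and lim: "(F \<longlongrightarrow> A) (at_right a)" "(F \<longlongrightarrow> B) (at_left b)"
  shows "(\<integral>\<^sup>+x\<in>{a<..<b}. ennreal (f x) \<partial>lborel) = ennreal (B - A)"
proof -
  have lims: "((F \<circ> real_of_ereal) \<longlongrightarrow> A) (at_right (ereal a))"
    "((F \<circ> real_of_ereal) \<longlongrightarrow> B) (at_left (ereal b))"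
    using lim by (simp_all add: ereal_tendsto_simps)
  have isCont: "isCont f x" if "a < x" "x < b" for x
    using cont that by (simp add: continuous_on_eq_continuous_at)
  have AE: "AE x in lborel. ereal a < ereal x \<longrightarrow> ereal x < ereal b \<longrightarrow> 0 \<le> f x"
    using nonneg by auto
  have ab: "ereal a < ereal b" using assms(1) by simp
  note FTC = interval_integral_FTC_nonneg[OF ab _ _ AE lims, of, simplified, OF deriv isCont]
  have "(\<integral>\<^sup>+x\<in>{a<..<b}. ennreal (f x) \<partial>lborel)
      = (\<integral>\<^sup>+x. ennreal (indicator {a<..<b} x *\<^sub>R f x) \<partial>lborel)"
    by (intro nn_integral_cong) (auto split: split_indicator)
  also have "\<dots> = ennreal (LINT x|lborel. indicator {a<..<b} x *\<^sub>R f x)"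
    using FTC(1) nonneg
    by (intro nn_integral_eq_integral) (auto simp: set_integrable_def split: split_indicator)
  also have "(LINT x|lborel. indicator {a<..<b} x *\<^sub>R f x) = B - A"
    using FTC(2) \<open>a < b\<close> by (simp add: interval_lebesgue_integral_def set_lebesgue_integral_def)
  finally show ?thesis .
qed

text \<open>
  The exponential itself, divided by \<open>z\<close>, is an antiderivative in \<open>v\<close>: it increases from \<open>0\<close> to \<open>1 / z\<close>.
  The parametrization by \<open>v\<close> is the one for which averaging over an independent normal increment of variance
  \<open>\<tau>\<close> yields a factor \<open>v ^ 3\<close> (\<open>gauss_moment_convolution\<close>), which cancels the power of \<open>v\<close> in the denominator.
\<close>

lemma inverse_as_gaussian_mixture:
  assumes "0 < z" "0 < \<tau>"
  shows "(\<integral>\<^sup>+v\<in>{0<..<1}. ennreal (z * exp (- (((1 / v\<^sup>2 - 1) / \<tau>) * z\<^sup>2 / 2)) / (v ^ 3 * \<tau>)) \<partial>lborel)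
    = ennreal (1 / z)"
proof -
  define F where "F v = exp (- (((1 / v\<^sup>2 - 1) / \<tau>) * z\<^sup>2 / 2)) / z" for v
  define q where "q = z\<^sup>2 / (2 * \<tau>)"
  have q: "q > 0" using assms by (simp add: q_def)
  have F_eq: "F = (\<lambda>v. exp (- ((1 / v\<^sup>2 - 1) * q)) / z)"
    by (auto simp: F_def q_def)
  have "((\<lambda>v::real. exp (- ((1 / v\<^sup>2 - 1) * q)) / z) \<longlongrightarrow> 0) (at_right 0)"
    using q assms by real_asymp
  moreover have "((\<lambda>v::real. exp (- ((1 / v\<^sup>2 - 1) * q)) / z) \<longlongrightarrow> 1 / z) (at_left 1)"
    using assms by (auto intro!: tendsto_eq_intros)
  moreover have "(F has_real_derivative z * exp (- (((1 / v\<^sup>2 - 1) / \<tau>) * z\<^sup>2 / 2)) / (v ^ 3 * \<tau>)) (at v)"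
    if "0 < v" for v
  proof -
    have "(F has_real_derivative exp (- ((1 / v\<^sup>2 - 1) * q)) * (2 / v ^ 3 * q) / z) (at v)"
      unfolding F_eq using that assms
      by (auto intro!: derivative_eq_intros simp: power2_eq_square power3_eq_cube)
    moreover have "2 / v ^ 3 * q / z = z / (v ^ 3 * \<tau>)"
      using assms that by (simp add: q_def power2_eq_square)
    moreover have "(1 / v\<^sup>2 - 1) * q = ((1 / v\<^sup>2 - 1) / \<tau>) * z\<^sup>2 / 2"
      by (simp add: q_def)
    ultimately show ?thesis
      by (metis (no_types, opaque_lifting) mult.commute times_divide_eq_right)
  qed
  ultimately have "(\<integral>\<^sup>+v\<in>{0<..<1}. ennreal (z * exp (- (((1 / v\<^sup>2 - 1) / \<tau>) * z\<^sup>2 / 2)) / (v ^ 3 * \<tau>)) \<partial>lborel)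
      = ennreal (1 / z - 0)"
    using assms unfolding F_eq[symmetric]
    by (intro nn_integral_FTC_Ioo[where F = F]) (auto intro!: continuous_intros)
  then show ?thesis by simp
qed

lemma nn_integral_cubic_gaussian:
  assumes "0 < c"
  shows "(\<integral>\<^sup>+y\<in>{0..}. ennreal (y ^ 3 * exp (- (c * y\<^sup>2 / 2))) \<partial>lborel) = ennreal (2 / c\<^sup>2)"
proof -
  define F where "F y = - ((y\<^sup>2 / c + 2 / c\<^sup>2) * exp (- (c * y\<^sup>2 / 2)))" for y
  have "(F \<longlongrightarrow> 0) at_top"
    unfolding F_def using assms by real_asymp
  then have "(\<integral>\<^sup>+y\<in>{0..}. ennreal (y ^ 3 * exp (- (c * y\<^sup>2 / 2))) \<partial>lborel) = ennreal (0 - F 0)"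
    using assms unfolding F_def
    by (intro nn_integral_FTC_atLeast)
       (auto intro!: derivative_eq_intros simp: power2_eq_square power3_eq_cube field_simps)
  then show ?thesis by (simp add: F_def)
qed

lemma nn_integral_inverse_quadratic:
  assumes "0 < u"
  shows "(\<integral>\<^sup>+p\<in>{0..}. ennreal (1 / (1 + u * p\<^sup>2)) \<partial>lborel) = ennreal (pi / (2 * sqrt u))"
proof -
  define F where "F p = arctan (sqrt u * p) / sqrt u" for p
  have *: "(F \<longlongrightarrow> (pi / 2) / sqrt u) at_top"
    unfolding F_def
    by (intro tendsto_divide tendsto_const filterlim_compose[OF tendsto_arctan_at_top]
          filterlim_tendsto_pos_mult_at_top[OF tendsto_const] filterlim_ident) (use assms in auto)
  have "(\<integral>\<^sup>+p\<in>{0..}. ennreal (1 / (1 + u * p\<^sup>2)) \<partial>lborel) = ennreal ((pi / 2) / sqrt u - F 0)"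
  proof (intro nn_integral_FTC_atLeast[OF _ _ _ *])
    fix p :: real assume "0 \<le> p"
    show "(F has_real_derivative 1 / (1 + u * p\<^sup>2)) (at p)"
      unfolding F_def using assms
      by (auto intro!: derivative_eq_intros simp: power_mult_distrib divide_inverse)
  qed (use assms in auto)
  then show ?thesis by (simp add: F_def)
qed


text \<open>
  The substitution \<open>s = u (1 + p\<^sup>2) / (1 + u p\<^sup>2)\<close>. Under \<open>\<rho> = s p\<^sup>2 / (1 + p\<^sup>2)\<close>, the value that \<open>p\<close>
  stands for in \<open>last_zero_law\<close>, it reads \<open>u = (s - \<rho>) / (1 - \<rho>)\<close>: it recovers the time scale of the
  meander from that of the Brownian motion.
\<close>

lemma triple_integrand_substitution:
  fixes p v :: real
  assumes v: "0 < v" "v < 1"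
  shows "(\<integral>\<^sup>+s\<in>{0<..<1}. ennreal (s * (1 - s) * (1 + p\<^sup>2) /
            ((1 + (1 - s) * p\<^sup>2) * (1 + (1 - s) * p\<^sup>2 - s * v\<^sup>2)\<^sup>2)) \<partial>lborel)
       = (\<integral>\<^sup>+u\<in>{0<..<1}. ennreal (u * (1 - u) / ((1 + u * p\<^sup>2) * (1 - u * v\<^sup>2)\<^sup>2)) \<partial>lborel)"
proof -
  define G where "G s = s * (1 - s) * (1 + p\<^sup>2) /
      ((1 + (1 - s) * p\<^sup>2) * (1 + (1 - s) * p\<^sup>2 - s * v\<^sup>2)\<^sup>2)" for s
  define g where "g u = u * (1 + p\<^sup>2) / (1 + u * p\<^sup>2)" for u
  define g' where "g' u = (1 + p\<^sup>2) / (1 + u * p\<^sup>2)\<^sup>2" for u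
  have pos: "1 + u * p\<^sup>2 > 0" if "0 \<le> u" for u
    using that by (simp add: add_pos_nonneg)
  have p1: "1 + p\<^sup>2 > 0" using pos[of 1] by simp
  have g01: "g 0 = 0" "g 1 = 1" using p1 by (auto simp: g_def)
  have eq: "G (g u) * g' u = u * (1 - u) / ((1 + u * p\<^sup>2) * (1 - u * v\<^sup>2)\<^sup>2)" if u: "0 \<le> u" "u \<le> 1" for u
  proof (cases "u = 0")
    case False
    define d where "d = 1 + u * p\<^sup>2"
    define e where "e = 1 - u * v\<^sup>2"
    define P where "P = 1 + p\<^sup>2"
    have d: "d > 0" using pos u by (simp add: d_def)
    have "v\<^sup>2 < 1" using v by (simp add: power_less_one_iff)
    then have e: "e > 0" using u mult_le_one[of u "v\<^sup>2"] unfolding e_def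
      by (smt (verit) mult_left_le zero_le_power2 mult_less_cancel_right1)
    have P: "P > 0" using p1 by (simp add: P_def)
    have a: "g u = u * P / d" by (simp add: g_def P_def d_def)
    have b: "1 - g u = (1 - u) / d"
      using d unfolding a by (simp add: field_simps) (simp add: d_def P_def algebra_simps)
    have c: "1 + (1 - g u) * p\<^sup>2 = P / d"
      using d unfolding b by (simp add: field_simps) (simp add: d_def P_def algebra_simps)
    have f: "1 + (1 - g u) * p\<^sup>2 - g u * v\<^sup>2 = P * e / d"
      using d unfolding c unfolding a by (simp add: field_simps) (simp add: e_def algebra_simps)
    have "G (g u) * g' u = (u * P / d) * ((1 - u) / d) * P / ((P / d) * (P * e / d)\<^sup>2) * (P / d\<^sup>2)"
      by (simp only: G_def g'_def f) (simp only: c, simp only: b, simp only: a P_def[symmetric] d_def[symmetric])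
    also have "\<dots> = u * (1 - u) / (d * e\<^sup>2)"
      using d e P by (simp add: field_simps power2_eq_square)
    finally show ?thesis by (simp add: d_def e_def)
  qed (simp add: g01 G_def)
  have "(\<integral>\<^sup>+s\<in>{0<..<1}. ennreal (G s) \<partial>lborel) = (\<integral>\<^sup>+s. G s * indicator {g 0..g 1} s \<partial>lborel)"
    unfolding g01 by (intro nn_integral_cong) (auto simp: G_def split: split_indicator)
  also have "\<dots> = (\<integral>\<^sup>+u. G (g u) * g' u * indicator {0..1} u \<partial>lborel)"
  proof (rule nn_integral_substitution)
    show "set_borel_measurable borel {g 0..g 1} G"
      unfolding set_borel_measurable_def G_def by measurable
    show "(g has_real_derivative g' u) (at u)" if "u \<in> {0..1}" for u
      unfolding g_def g'_def using pos[of u] that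
      by (auto intro!: derivative_eq_intros simp: field_simps power2_eq_square)
    show "continuous_on {0..1} g'"
      unfolding g'_def using pos by (auto intro!: continuous_intros simp: less_imp_neq[symmetric])
    show "0 \<le> g' u" if "u \<in> {0..1}" for u
      unfolding g'_def using p1 by simp
  qed simp
  also have "\<dots> = (\<integral>\<^sup>+u\<in>{0<..<1}. ennreal (u * (1 - u) / ((1 + u * p\<^sup>2) * (1 - u * v\<^sup>2)\<^sup>2)) \<partial>lborel)"
      proof (intro nn_integral_cong)
    fix u :: real
    consider "u = 0" | "u = 1" | "0 < u" "u < 1" | "u < 0 \<or> u > 1" by linarith
    then show "ennreal (G (g u) * g' u * indicator {0..1} u)
        = ennreal (u * (1 - u) / ((1 + u * p\<^sup>2) * (1 - u * v\<^sup>2)\<^sup>2)) * indicator {0<..<1} u"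
      by cases (auto simp: eq)
  qed
  finally show ?thesis by (simp add: G_def)
qed

text \<open>
  For fixed \<open>u\<close> the inner integral is the expectation of \<open>m u / m 1\<close>. Scaling \<open>w = sqrt u * v\<close> and
  exchanging the integrals reduces the claim to \<open>\<integral> 2 (1 - u) du = (1 - w\<^sup>2)\<^sup>2\<close> over \<open>(w\<^sup>2, 1)\<close>.
\<close>

lemma double_integral_eq_1:
  "(\<integral>\<^sup>+u\<in>{0<..<1}. \<integral>\<^sup>+v\<in>{0<..<1}. ennreal (2 * sqrt u * (1 - u) / (1 - u * v\<^sup>2)\<^sup>2) \<partial>lborel \<partial>lborel) = 1"
proof -
  have inner: "(\<integral>\<^sup>+v\<in>{0<..<1}. ennreal (2 * sqrt u * (1 - u) / (1 - u * v\<^sup>2)\<^sup>2) \<partial>lborel)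
     = (\<integral>\<^sup>+w\<in>{0<..<1}. ennreal (2 * (1 - u) / (1 - w\<^sup>2)\<^sup>2) * indicator {w\<^sup>2<..<1} u \<partial>lborel)"
    if u: "0 < u" "u < 1" for u :: real
  proof -
    have *: "w < sqrt u \<longleftrightarrow> w\<^sup>2 < u" if "0 < w" for w
      using that real_less_rsqrt real_sqrt_less_iff[of "w\<^sup>2" u] by auto
    have "(\<integral>\<^sup>+w\<in>{0<..<1}. ennreal (2 * (1 - u) / (1 - w\<^sup>2)\<^sup>2) * indicator {w\<^sup>2<..<1} u \<partial>lborel)
        = (\<integral>\<^sup>+w. ennreal (2 * (1 - u) / (1 - w\<^sup>2)\<^sup>2) * indicator {0<..<sqrt u} w \<partial>lborel)"
    proof (intro nn_integral_cong)
      fix w :: real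
      have "w < 1" if "0 < w" "w\<^sup>2 < u"
        using that u by (intro power_less_imp_less_base[of w 2 1]) auto
      then show "ennreal (2 * (1 - u) / (1 - w\<^sup>2)\<^sup>2) * indicator {w\<^sup>2<..<1} u * indicator {0<..<1} w
          = ennreal (2 * (1 - u) / (1 - w\<^sup>2)\<^sup>2) * indicator {0<..<sqrt u} w"
        using u * by (auto split: split_indicator)
    qed
    also have "\<dots> = ennreal \<bar>sqrt u\<bar> * (\<integral>\<^sup>+v. ennreal (2 * (1 - u) / (1 - (0 + sqrt u * v)\<^sup>2)\<^sup>2) *
        indicator {0<..<sqrt u} (0 + sqrt u * v) \<partial>lborel)"
      using u by (intro nn_integral_real_affine) auto
    also have "\<dots> = (\<integral>\<^sup>+v. ennreal \<bar>sqrt u\<bar> * (ennreal (2 * (1 - u) / (1 - (0 + sqrt u * v)\<^sup>2)\<^sup>2) *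
        indicator {0<..<sqrt u} (0 + sqrt u * v)) \<partial>lborel)"
      by (intro nn_integral_cmult[symmetric]) measurable
    also have "\<dots> = (\<integral>\<^sup>+v\<in>{0<..<1}. ennreal (2 * sqrt u * (1 - u) / (1 - u * v\<^sup>2)\<^sup>2) \<partial>lborel)"
      using u by (intro nn_integral_cong)
        (auto simp: power_mult_distrib ennreal_mult[symmetric] zero_less_mult_iff mult.assoc
            split: split_indicator intro!: arg_cong[where f = ennreal])
    finally show ?thesis ..
  qed
  have "(\<integral>\<^sup>+u\<in>{0<..<1}. \<integral>\<^sup>+v\<in>{0<..<1}. ennreal (2 * sqrt u * (1 - u) / (1 - u * v\<^sup>2)\<^sup>2) \<partial>lborel \<partial>lborel)
      = (\<integral>\<^sup>+u\<in>{0<..<1}. \<integral>\<^sup>+w\<in>{0<..<1}. ennreal (2 * (1 - u) / (1 - w\<^sup>2)\<^sup>2) * indicator {w\<^sup>2<..<1} u \<partial>lborel \<partial>lborel)"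
    by (intro nn_integral_cong) (auto simp: inner split: split_indicator)
  also have "\<dots> = (\<integral>\<^sup>+u. \<integral>\<^sup>+w. ennreal (2 * (1 - u) / (1 - w\<^sup>2)\<^sup>2) * indicator {(u, w). w\<^sup>2 < u \<and> u < 1 \<and> 0 < w \<and> w < 1} (u, w) \<partial>lborel \<partial>lborel)"
  proof (intro nn_integral_cong)
    fix u :: real
    show "(\<integral>\<^sup>+w\<in>{0<..<1}. ennreal (2 * (1 - u) / (1 - w\<^sup>2)\<^sup>2) * indicator {w\<^sup>2<..<1} u \<partial>lborel) * indicator {0<..<1} u
        = (\<integral>\<^sup>+w. ennreal (2 * (1 - u) / (1 - w\<^sup>2)\<^sup>2) * indicator {(u, w). w\<^sup>2 < u \<and> u < 1 \<and> 0 < w \<and> w < 1} (u, w) \<partial>lborel)"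
    proof (cases "0 < u \<and> u < 1")
      case True
      then show ?thesis by (auto intro!: nn_integral_cong split: split_indicator)
    next
      case False
      then have "\<not> (w\<^sup>2 < u \<and> u < 1)" for w
        using le_less_trans[OF zero_le_power2] by blast
      with False show ?thesis by auto
    qed
  qed
  also have "\<dots> = (\<integral>\<^sup>+w. \<integral>\<^sup>+u. ennreal (2 * (1 - u) / (1 - w\<^sup>2)\<^sup>2) * indicator {(u, w). w\<^sup>2 < u \<and> u < 1 \<and> 0 < w \<and> w < 1} (u, w) \<partial>lborel \<partial>lborel)"
    by (rule lborel_pair.Fubini') measurable
  also have "\<dots> = (\<integral>\<^sup>+w. indicator {0<..<1::real} w \<partial>lborel)"
  proof (intro nn_integral_cong)
    fix w :: real
    show "(\<integral>\<^sup>+u. ennreal (2 * (1 - u) / (1 - w\<^sup>2)\<^sup>2) * indicator {(u, w). w\<^sup>2 < u \<and> u < 1 \<and> 0 < w \<and> w < 1} (u, w) \<partial>lborel)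
      = indicator {0<..<1} w"
    proof (cases "0 < w \<and> w < 1")
      case True
      define c where "c = 1 / (1 - w\<^sup>2)\<^sup>2"
      have c_pos: "c \<ge> 0" by (simp add: c_def)
      from True have w: "w\<^sup>2 < 1" by (simp add: power_less_one_iff)
      have "(\<integral>\<^sup>+u. ennreal (2 * (1 - u) / (1 - w\<^sup>2)\<^sup>2) * indicator {(u, w). w\<^sup>2 < u \<and> u < 1 \<and> 0 < w \<and> w < 1} (u, w) \<partial>lborel)
         = (\<integral>\<^sup>+u\<in>{w\<^sup>2<..<1}. ennreal (2 * (1 - u) / (1 - w\<^sup>2)\<^sup>2) \<partial>lborel)"
        using True by (intro nn_integral_cong) (auto split: split_indicator)
      also have "\<dots> = (\<integral>\<^sup>+u\<in>{w\<^sup>2<..<1}. ennreal (2 * (1 - u) * c) \<partial>lborel)"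
        by (simp add: c_def)
      also have "\<dots> = ennreal (0 - - ((1 - w\<^sup>2)\<^sup>2 * c))"
      proof (rule nn_integral_FTC_Ioo[OF w])
        show "((\<lambda>u. - ((1 - u)\<^sup>2 * c)) has_real_derivative 2 * (1 - u) * c) (at u)" for u
          by (auto intro!: derivative_eq_intros simp: algebra_simps)
        show "((\<lambda>u. - ((1 - u)\<^sup>2 * c)) \<longlongrightarrow> - ((1 - w\<^sup>2)\<^sup>2 * c)) (at_right (w\<^sup>2))"
          by (intro tendsto_intros)
        show "((\<lambda>u. - ((1 - u)\<^sup>2 * c)) \<longlongrightarrow> 0) (at_left 1)"
          by (auto intro!: tendsto_eq_intros)
      qed (auto intro!: continuous_intros simp: c_pos)
      finally show ?thesis using True w by (simp add: c_def)
    qed auto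
  qed
  finally show ?thesis by simp
qed

text \<open>
  After the substitution for \<open>s\<close>, the variable \<open>p\<close> occurs only in the factor \<open>1 / (1 + u p\<^sup>2)\<close>.
\<close>

lemma triple_integral_eq_1:
  "(\<integral>\<^sup>+s\<in>{0<..<1}. \<integral>\<^sup>+v\<in>{0<..<1}. \<integral>\<^sup>+p\<in>{0..}. ennreal (4 / pi * (s * (1 - s) * (1 + p\<^sup>2) /
      ((1 + (1 - s) * p\<^sup>2) * (1 + (1 - s) * p\<^sup>2 - s * v\<^sup>2)\<^sup>2))) \<partial>lborel \<partial>lborel \<partial>lborel) = 1"
proof -
  define K :: "real \<Rightarrow> real \<Rightarrow> real \<Rightarrow> ennreal" where
    "K = (\<lambda>s v p. ennreal (s * (1 - s) * (1 + p\<^sup>2) /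
      ((1 + (1 - s) * p\<^sup>2) * (1 + (1 - s) * p\<^sup>2 - s * v\<^sup>2)\<^sup>2)))"
  define H :: "real \<Rightarrow> real \<Rightarrow> real \<Rightarrow> ennreal" where
    "H = (\<lambda>u v p. ennreal (u * (1 - u) / ((1 + u * p\<^sup>2) * (1 - u * v\<^sup>2)\<^sup>2)))"
  define I :: "real \<Rightarrow> ennreal" where "I = indicator {0<..<1}"
  define J :: "real \<Rightarrow> ennreal" where "J = indicator {0..}"
  have [measurable]: "I \<in> borel_measurable borel" "J \<in> borel_measurable borel"
    unfolding I_def J_def by measurable
  have K[measurable]: "(\<lambda>x. K (f x) (g x) (h x)) \<in> borel_measurable N"
    if [measurable]: "f \<in> borel_measurable N" "g \<in> borel_measurable N" "h \<in> borel_measurable N"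
    for f g h and N :: "'x measure" unfolding K_def by measurable
  have H[measurable]: "(\<lambda>x. H (f x) (g x) (h x)) \<in> borel_measurable N"
    if [measurable]: "f \<in> borel_measurable N" "g \<in> borel_measurable N" "h \<in> borel_measurable N"
    for f g h and N :: "'x measure" unfolding H_def by measurable
  have pull: "ennreal (4 / pi * x) = ennreal (4 / pi) * ennreal x" for x
    by (rule ennreal_mult') simp
  have subst: "(\<integral>\<^sup>+s. K s v p * I s \<partial>lborel) * I v = (\<integral>\<^sup>+u. H u v p * I u \<partial>lborel) * I v" for v p
    unfolding K_def H_def I_def using triple_integrand_substitution[of v p] by (auto split: split_indicator)
  have pint: "ennreal (4 / pi) * (\<integral>\<^sup>+p. H u v p * J p \<partial>lborel) * I u * I v
      = ennreal (2 * sqrt u * (1 - u) / (1 - u * v\<^sup>2)\<^sup>2) * I u * I v" for u v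
  proof (cases "0 < u \<and> u < 1 \<and> 0 < v \<and> v < 1")
    case True
    have "(\<integral>\<^sup>+p. H u v p * J p \<partial>lborel)
        = (\<integral>\<^sup>+p. ennreal (u * (1 - u) / (1 - u * v\<^sup>2)\<^sup>2) * (ennreal (1 / (1 + u * p\<^sup>2)) * J p) \<partial>lborel)"
      unfolding H_def
    proof (intro nn_integral_cong)
      fix p :: real
      have "u * (1 - u) / ((1 + u * p\<^sup>2) * (1 - u * v\<^sup>2)\<^sup>2)
          = u * (1 - u) / (1 - u * v\<^sup>2)\<^sup>2 * (1 / (1 + u * p\<^sup>2))"
        by simp
      then show "ennreal (u * (1 - u) / ((1 + u * p\<^sup>2) * (1 - u * v\<^sup>2)\<^sup>2)) * J p
          = ennreal (u * (1 - u) / (1 - u * v\<^sup>2)\<^sup>2) * (ennreal (1 / (1 + u * p\<^sup>2)) * J p)"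
        using True by (simp only: mult.assoc[symmetric], subst ennreal_mult[symmetric]) auto
    qed
    also have "\<dots> = ennreal (u * (1 - u) / (1 - u * v\<^sup>2)\<^sup>2) * ennreal (pi / (2 * sqrt u))"
      unfolding J_def using True by (subst nn_integral_cmult) (auto simp: nn_integral_inverse_quadratic)
    finally have "ennreal (4 / pi) * (\<integral>\<^sup>+p. H u v p * J p \<partial>lborel)
        = ennreal (4 / pi * (u * (1 - u) / (1 - u * v\<^sup>2)\<^sup>2 * (pi / (2 * sqrt u))))"
      using True by (simp only:, subst ennreal_mult[symmetric], simp, simp, subst ennreal_mult[symmetric]) auto
    also have "4 / pi * (u * (1 - u) / (1 - u * v\<^sup>2)\<^sup>2 * (pi / (2 * sqrt u)))
        = 2 * sqrt u * (1 - u) / (1 - u * v\<^sup>2)\<^sup>2"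
    proof -
      have "4 / pi * (u * (1 - u) / (1 - u * v\<^sup>2)\<^sup>2 * (pi / (2 * sqrt u)))
          = 2 * (u / sqrt u) * (1 - u) / (1 - u * v\<^sup>2)\<^sup>2"
        by simp
      moreover have "u / sqrt u = sqrt u"
        using True by (intro real_div_sqrt) simp
      ultimately show ?thesis by simp
    qed
    finally show ?thesis by simp
  qed (auto simp: I_def split: split_indicator)
  have "(\<integral>\<^sup>+s\<in>{0<..<1}. \<integral>\<^sup>+v\<in>{0<..<1}. \<integral>\<^sup>+p\<in>{0..}. ennreal (4 / pi * (s * (1 - s) * (1 + p\<^sup>2) /
      ((1 + (1 - s) * p\<^sup>2) * (1 + (1 - s) * p\<^sup>2 - s * v\<^sup>2)\<^sup>2))) \<partial>lborel \<partial>lborel \<partial>lborel)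
    = (\<integral>\<^sup>+s. (\<integral>\<^sup>+v. (\<integral>\<^sup>+p. ennreal (4 / pi) * (K s v p * I s * I v * J p) \<partial>lborel) \<partial>lborel) \<partial>lborel)"
    unfolding K_def I_def J_def pull
    by (intro nn_integral_cong) (auto split: split_indicator intro!: nn_integral_cong)
  also have "\<dots> = ennreal (4 / pi) * (\<integral>\<^sup>+s. (\<integral>\<^sup>+v. (\<integral>\<^sup>+p. K s v p * I s * I v * J p \<partial>lborel) \<partial>lborel) \<partial>lborel)"
    by (simp add: nn_integral_cmult)
  also have "(\<integral>\<^sup>+s. (\<integral>\<^sup>+v. (\<integral>\<^sup>+p. K s v p * I s * I v * J p \<partial>lborel) \<partial>lborel) \<partial>lborel)
      = (\<integral>\<^sup>+v. (\<integral>\<^sup>+s. (\<integral>\<^sup>+p. K s v p * I s * I v * J p \<partial>lborel) \<partial>lborel) \<partial>lborel)"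
    by (rule lborel_pair.Fubini') measurable
  also have "\<dots> = (\<integral>\<^sup>+v. (\<integral>\<^sup>+p. (\<integral>\<^sup>+s. K s v p * I s * I v * J p \<partial>lborel) \<partial>lborel) \<partial>lborel)"
    by (intro nn_integral_cong lborel_pair.Fubini') measurable
  also have "\<dots> = (\<integral>\<^sup>+v. (\<integral>\<^sup>+p. (\<integral>\<^sup>+s. K s v p * I s \<partial>lborel) * I v * J p \<partial>lborel) \<partial>lborel)"
    by (simp add: nn_integral_multc)
  also have "\<dots> = (\<integral>\<^sup>+v. (\<integral>\<^sup>+p. (\<integral>\<^sup>+u. H u v p * I u * I v * J p \<partial>lborel) \<partial>lborel) \<partial>lborel)"
    by (simp add: nn_integral_multc subst)
  also have "\<dots> = (\<integral>\<^sup>+v. (\<integral>\<^sup>+u. (\<integral>\<^sup>+p. H u v p * I u * I v * J p \<partial>lborel) \<partial>lborel) \<partial>lborel)"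
    by (intro nn_integral_cong lborel_pair.Fubini') measurable
  also have "\<dots> = (\<integral>\<^sup>+v. (\<integral>\<^sup>+u. (\<integral>\<^sup>+p. H u v p * J p \<partial>lborel) * I u * I v \<partial>lborel) \<partial>lborel)"
  proof (intro nn_integral_cong)
    fix v u
    have "(\<integral>\<^sup>+p. H u v p * I u * I v * J p \<partial>lborel) = (\<integral>\<^sup>+p. (H u v p * J p) * (I u * I v) \<partial>lborel)"
      by (simp only: mult_ac)
    also have "\<dots> = (\<integral>\<^sup>+p. H u v p * J p \<partial>lborel) * (I u * I v)"
      by (rule nn_integral_multc) measurable
    finally show "(\<integral>\<^sup>+p. H u v p * I u * I v * J p \<partial>lborel) = (\<integral>\<^sup>+p. H u v p * J p \<partial>lborel) * I u * I v"
      by (simp only: mult.assoc)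
  qed
  also have "ennreal (4 / pi) * \<dots> = (\<integral>\<^sup>+v. (\<integral>\<^sup>+u. ennreal (2 * sqrt u * (1 - u) / (1 - u * v\<^sup>2)\<^sup>2) * I u * I v \<partial>lborel) \<partial>lborel)"
    unfolding pint[symmetric] by (simp add: nn_integral_cmult mult.assoc)
  also have "\<dots> = (\<integral>\<^sup>+u. (\<integral>\<^sup>+v. ennreal (2 * sqrt u * (1 - u) / (1 - u * v\<^sup>2)\<^sup>2) * I u * I v \<partial>lborel) \<partial>lborel)"
    by (rule lborel_pair.Fubini') measurable
  also have "\<dots> = 1"
    unfolding double_integral_eq_1[symmetric] I_def
    by (intro nn_integral_cong) (auto split: split_indicator intro!: nn_integral_cong)
  finally show ?thesis .
qed

section \<open>The sign of a Brownian bridge\<close>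

lemma nn_integral_even:
  fixes f :: "real \<Rightarrow> ennreal"
  assumes [measurable]: "f \<in> borel_measurable borel" and even: "\<And>x. f (- x) = f x"
  shows "(\<integral>\<^sup>+x. f x \<partial>lborel) = 2 * (\<integral>\<^sup>+x\<in>{0..}. f x \<partial>lborel)"
proof -
  have "(\<integral>\<^sup>+x. f x \<partial>lborel) = (\<integral>\<^sup>+x. f x * indicator {0..} x + f x * indicator {..0} x \<partial>lborel)"
    by (intro nn_integral_cong_AE AE_I[where N = "{0}"]) (auto split: split_indicator)
  also have "\<dots> = (\<integral>\<^sup>+x\<in>{0..}. f x \<partial>lborel) + (\<integral>\<^sup>+x\<in>{..0}. f x \<partial>lborel)"
    by (rule nn_integral_add) measurable
  also have "(\<integral>\<^sup>+x\<in>{..0}. f x \<partial>lborel) = (\<integral>\<^sup>+x\<in>{0..}. f x \<partial>lborel)"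
    by (subst nn_integral_real_affine[where c = "- 1" and t = 0])
       (auto simp: even intro!: nn_integral_cong split: split_indicator)
  finally show ?thesis by (simp add: mult_2)
qed

lemma integrable_normal_times_bounded:
  fixes f :: "real \<Rightarrow> real"
  assumes "0 < \<sigma>" and [measurable]: "f \<in> borel_measurable borel" and "\<And>x. \<bar>f x\<bar> \<le> C"
  shows "integrable lborel (\<lambda>x. normal_density m \<sigma> x * f x)"
proof (rule Bochner_Integration.integrable_bound)
  show "integrable lborel (\<lambda>x. normal_density m \<sigma> x * C)"
    using assms(1) by (intro integrable_mult_left integrable_normal_density)
  have "0 \<le> C" using assms(3)[of 0] by linarith
  then show "AE x in lborel. norm (normal_density m \<sigma> x * f x) \<le> norm (normal_density m \<sigma> x * C)"
    using assms(3) by (intro AE_I2) (auto simp: abs_mult intro!: mult_left_mono)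
qed measurable

text \<open>
  Completing the square exhibits the product of the two exponentials as a multiple of the normal density
  with mean \<open>v\<^sup>2 * y\<close> and variance \<open>v\<^sup>2 * \<tau>\<close>, so that the integral is a first moment.
\<close>

lemma gauss_moment_convolution:
  assumes v: "0 < v" "v < 1" and \<tau>: "0 < \<tau>"
  shows "(\<integral>z. normal_density 0 (sqrt \<tau>) z * gauss_moment ((1 / v\<^sup>2 - 1) / \<tau>) (y + z) \<partial>lborel)
    = v ^ 3 * gauss_moment ((1 - v\<^sup>2) / \<tau>) y"
proof -
  have "(\<integral>z. normal_density 0 (sqrt \<tau>) z * gauss_moment ((1 / v\<^sup>2 - 1) / \<tau>) (y + z) \<partial>lborel)
      = (\<integral>x. normal_density 0 (sqrt \<tau>) (x - y) * gauss_moment ((1 / v\<^sup>2 - 1) / \<tau>) x \<partial>lborel)"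
    using lborel_integral_real_affine[of 1 "\<lambda>x. normal_density 0 (sqrt \<tau>) (x - y) * gauss_moment ((1 / v\<^sup>2 - 1) / \<tau>) x" y]
    by simp
  also have "\<dots> = (\<integral>x. (v * exp (- ((1 - v\<^sup>2) / \<tau> * y\<^sup>2 / 2))) * (normal_density (v\<^sup>2 * y) (v * sqrt \<tau>) x * x) \<partial>lborel)"
  proof (intro Bochner_Integration.integral_cong refl)
    fix x :: real
    have e: "- (x - y)\<^sup>2 / (2 * \<tau>) + - ((1 / v\<^sup>2 - 1) / \<tau> * x\<^sup>2 / 2)
        = - ((1 - v\<^sup>2) / \<tau> * y\<^sup>2 / 2) + - (x - v\<^sup>2 * y)\<^sup>2 / (2 * (v\<^sup>2 * \<tau>))"
      using v \<tau> by (simp add: divide_simps) (simp add: power2_eq_square algebra_simps)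
    have "normal_density 0 (sqrt \<tau>) (x - y) * gauss_moment ((1 / v\<^sup>2 - 1) / \<tau>) x
        = 1 / sqrt (2 * pi * \<tau>) * x * exp (- (x - y)\<^sup>2 / (2 * \<tau>) + - ((1 / v\<^sup>2 - 1) / \<tau> * x\<^sup>2 / 2))"
      using \<tau> unfolding exp_add by (simp add: normal_density_def gauss_moment_def)
    also have "\<dots> = (v * exp (- ((1 - v\<^sup>2) / \<tau> * y\<^sup>2 / 2))) * (normal_density (v\<^sup>2 * y) (v * sqrt \<tau>) x * x)"
      using v \<tau> unfolding e exp_add
      by (simp add: normal_density_def power_mult_distrib real_sqrt_mult ac_simps)
    finally show "normal_density 0 (sqrt \<tau>) (x - y) * gauss_moment ((1 / v\<^sup>2 - 1) / \<tau>) x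
        = (v * exp (- ((1 - v\<^sup>2) / \<tau> * y\<^sup>2 / 2))) * (normal_density (v\<^sup>2 * y) (v * sqrt \<tau>) x * x)" .
  qed
  also have "\<dots> = (v * exp (- ((1 - v\<^sup>2) / \<tau> * y\<^sup>2 / 2))) * (v\<^sup>2 * y)"
    using v \<tau> by (simp add: integral_normal_moment_nz_1)
  finally show ?thesis by (simp add: gauss_moment_def power2_eq_square power3_eq_cube ac_simps)
qed

text \<open>
  The joint density of Brownian motion at times \<open>r < s\<close>, factored into the density at \<open>s\<close> and the density at \<open>r\<close>
  of the bridge that ends in \<open>y\<close> at time \<open>s\<close>.
\<close>

lemma bridge_factorization:
  assumes "0 < r" "r < s"
  shows "normal_density 0 (sqrt r) x * normal_density 0 (sqrt (s - r)) (y - x)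
    = normal_density 0 (sqrt s) y * normal_density (r * y / s) (sqrt (r * (s - r) / s)) x"
proof -
  have s: "0 < s" "0 < s - r" using assms by auto
  have e: "- (x - 0)\<^sup>2 / (2 * r) + - (y - x - 0)\<^sup>2 / (2 * (s - r))
      = - (y - 0)\<^sup>2 / (2 * s) + - (x - r * y / s)\<^sup>2 / (2 * (r * (s - r) / s))"
    using assms s by (simp add: divide_simps) (simp add: power2_eq_square algebra_simps)
  have q: "sqrt (2 * pi * r) * sqrt (2 * pi * (s - r)) = sqrt (2 * pi * s) * sqrt (2 * pi * (r * (s - r) / s))"
    using assms s by (simp add: real_sqrt_mult[symmetric])
  have "normal_density 0 (sqrt r) x * normal_density 0 (sqrt (s - r)) (y - x)
      = 1 / (sqrt (2 * pi * r) * sqrt (2 * pi * (s - r))) * exp (- (x - 0)\<^sup>2 / (2 * r) + - (y - x - 0)\<^sup>2 / (2 * (s - r)))"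
    using assms s unfolding exp_add by (simp add: normal_density_def)
  also have "\<dots> = normal_density 0 (sqrt s) y * normal_density (r * y / s) (sqrt (r * (s - r) / s)) x"
    using assms s unfolding q e exp_add by (simp add: normal_density_def)
  finally show ?thesis .
qed

text \<open>
  The conditional expectation of \<open>sgn (B r)\<close> given \<open>B s = y\<close>.
\<close>

definition bridge_sign :: "real \<Rightarrow> real \<Rightarrow> real \<Rightarrow> real" where
  "bridge_sign r s y = (if r = s then sgn y
     else (\<integral>x. normal_density (r * y / s) (sqrt (r * (s - r) / s)) x * sgn x \<partial>lborel))"

lemma bridge_sign_measurable[measurable]: "bridge_sign r s \<in> borel_measurable borel"
proof (cases "r = s")
  case True then show ?thesis by (simp add: bridge_sign_def[abs_def])
next
  case False
  have "(\<lambda>y. \<integral>x. normal_density (r * y / s) (sqrt (r * (s - r) / s)) x * sgn x \<partial>lborel) \<in> borel_measurable borel"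
    unfolding normal_density_def by measurable
  then show ?thesis using False by (simp add: bridge_sign_def[abs_def])
qed

lemma integral_normal_sgn:
  assumes "0 < c"
  shows "(\<integral>x. normal_density m c x * sgn x \<partial>lborel) = (\<integral>z. std_normal_density z * sgn (m + c * z) \<partial>lborel)"
proof -
  have "(\<integral>x. normal_density m c x * sgn x \<partial>lborel)
      = \<bar>c\<bar> *\<^sub>R (\<integral>z. normal_density m c (m + c * z) * sgn (m + c * z) \<partial>lborel)"
    using assms by (intro lborel_integral_real_affine) simp
  also have "\<dots> = (\<integral>z. c * (normal_density m c (m + c * z) * sgn (m + c * z)) \<partial>lborel)"
    using assms by simp
  also have "\<dots> = (\<integral>z. std_normal_density z * sgn (m + c * z) \<partial>lborel)"
    using assms by (intro Bochner_Integration.integral_cong refl)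
      (simp add: normal_density_def power_mult_distrib real_sqrt_mult)
  finally show ?thesis .
qed

lemma integral_std_normal_reflect:
  "(\<integral>z. std_normal_density z * f (- z) \<partial>lborel) = (\<integral>z. std_normal_density z * f z \<partial>lborel)" for f :: "real \<Rightarrow> real"
  using lborel_integral_real_affine[of "- 1" "\<lambda>z. std_normal_density z * f z" 0]
  by (simp add: normal_density_def)

lemma bridge_sign_minus:
  assumes "0 < r" "r \<le> s"
  shows "bridge_sign r s (- y) = - bridge_sign r s y"
proof (cases "r = s")
  case True then show ?thesis by (simp add: bridge_sign_def sgn_minus)
next
  case False
  define c where "c = sqrt (r * (s - r) / s)"
  have c: "0 < c" using assms False by (simp add: c_def)
  have "(\<integral>x. normal_density (r * (- y) / s) c x * sgn x \<partial>lborel) = (\<integral>z. std_normal_density z * sgn (r * (- y) / s + c * z) \<partial>lborel)"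
    by (rule integral_normal_sgn[OF c])
  also have "\<dots> = (\<integral>z. std_normal_density z * sgn (- (r * y / s + c * (- z))) \<partial>lborel)"
    by (simp add: algebra_simps)
  also have "\<dots> = - (\<integral>z. std_normal_density z * sgn (r * y / s + c * (- z)) \<partial>lborel)"
    by (simp only: sgn_minus mult_minus_right Bochner_Integration.integral_minus)
  also have "(\<integral>z. std_normal_density z * sgn (r * y / s + c * (- z)) \<partial>lborel)
     = (\<integral>z. std_normal_density z * sgn (r * y / s + c * z) \<partial>lborel)"
    by (rule integral_std_normal_reflect[of "\<lambda>z. sgn (r * y / s + c * z)"])
  also have "\<dots> = (\<integral>x. normal_density (r * y / s) c x * sgn x \<partial>lborel)"
    by (rule integral_normal_sgn[OF c, symmetric])
  finally show ?thesis using False by (simp add: bridge_sign_def c_def)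
qed

lemma abs_bridge_sign_le:
  assumes "0 < r" "r \<le> s"
  shows "\<bar>bridge_sign r s y\<bar> \<le> 1"
proof (cases "r = s")
  case True then show ?thesis by (simp add: bridge_sign_def abs_sgn_eq)
next
  case False
  define c where "c = sqrt (r * (s - r) / s)"
  have c: "0 < c" using assms False by (simp add: c_def)
  have "\<bar>\<integral>x. normal_density (r * y / s) c x * sgn x \<partial>lborel\<bar> \<le> (\<integral>x. normal_density (r * y / s) c x \<partial>lborel)"
    using c by (intro integral_abs_bound_integral integrable_normal_times_bounded[where C = 1] integrable_normal_density)
      (auto simp: abs_mult abs_sgn_eq)
  then show ?thesis using False c by (simp add: bridge_sign_def c_def)
qed

text \<open>
  Averaging over \<open>z\<close> and \<open>- z\<close> replaces \<open>sgn (m + c * z)\<close> by the indicator of \<open>c * \<bar>z\<bar> < m\<close>.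
\<close>

lemma integral_sgn_shift:
  assumes "0 < c" "0 < m"
  shows "0 \<le> (\<integral>z. std_normal_density z * sgn (m + c * z) \<partial>lborel)"
    and "ennreal (\<integral>z. std_normal_density z * sgn (m + c * z) \<partial>lborel)
    = 2 * (\<integral>\<^sup>+z\<in>{0..}. ennreal (std_normal_density z) * of_bool (c * z < m) \<partial>lborel)"
proof -
  have int: "integrable lborel (\<lambda>z. std_normal_density z * f z)"
    if "f \<in> borel_measurable borel" "\<And>z. \<bar>f z\<bar> \<le> 1" for f :: "real \<Rightarrow> real"
    using that by (intro integrable_normal_times_bounded[where C = 1]) auto
  define I where "I = (\<integral>z. std_normal_density z * sgn (m + c * z) \<partial>lborel)"
  have "2 * I = I + (\<integral>z. std_normal_density z * sgn (m + c * (- z)) \<partial>lborel)"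
    using integral_std_normal_reflect[of "\<lambda>z. sgn (m + c * z)"] by (simp add: I_def)
  also have "\<dots> = (\<integral>z. std_normal_density z * sgn (m + c * z) + std_normal_density z * sgn (m + c * (- z)) \<partial>lborel)"
    unfolding I_def by (intro Bochner_Integration.integral_add[symmetric] int) (auto simp: abs_sgn_eq)
  also have "\<dots> = (\<integral>z. 2 * (std_normal_density z * of_bool (c * \<bar>z\<bar> < m)) \<partial>lborel)"
  proof (intro integral_cong_AE AE_I[where N = "{m / c, - (m / c)}"])
    show "{z \<in> space lborel. \<not> std_normal_density z * sgn (m + c * z) + std_normal_density z * sgn (m + c * (- z))
        = 2 * (std_normal_density z * of_bool (c * \<bar>z\<bar> < m))} \<subseteq> {m / c, - (m / c)}"
    proof (intro subsetI)
      fix z assume z: "z \<in> {z \<in> space lborel. \<not> std_normal_density z * sgn (m + c * z) + std_normal_density z * sgn (m + c * (- z))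
        = 2 * (std_normal_density z * of_bool (c * \<bar>z\<bar> < m))}"
      have "c * \<bar>z\<bar> = \<bar>c * z\<bar>" using assms by (simp add: abs_mult)
      then have "c * z = m \<or> c * z = - m"
        using z assms by (auto simp: sgn_if split: if_splits)
      then show "z \<in> {m / c, - (m / c)}" using assms by (auto simp: field_simps)
    qed
    show "emeasure lborel {m / c, - (m / c)} = 0"
      by (intro emeasure_lborel_countable) auto
  qed (auto intro!: borel_measurable_times)
  finally have I: "I = (\<integral>z. std_normal_density z * of_bool (c * \<bar>z\<bar> < m) \<partial>lborel)" by simp
  have "0 \<le> I" unfolding I by (intro Bochner_Integration.integral_nonneg) auto
  then show "0 \<le> (\<integral>z. std_normal_density z * sgn (m + c * z) \<partial>lborel)" by (simp add: I_def)
  have "ennreal I = (\<integral>\<^sup>+z. ennreal (std_normal_density z * of_bool (c * \<bar>z\<bar> < m)) \<partial>lborel)"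
    unfolding I by (intro nn_integral_eq_integral[symmetric] int AE_I2) auto
  also have "\<dots> = 2 * (\<integral>\<^sup>+z\<in>{0..}. ennreal (std_normal_density z * of_bool (c * \<bar>z\<bar> < m)) \<partial>lborel)"
    by (rule nn_integral_even) (auto simp: normal_density_def)
  also have "(\<integral>\<^sup>+z\<in>{0..}. ennreal (std_normal_density z * of_bool (c * \<bar>z\<bar> < m)) \<partial>lborel)
     = (\<integral>\<^sup>+z\<in>{0..}. ennreal (std_normal_density z) * of_bool (c * z < m) \<partial>lborel)"
    by (intro nn_integral_cong) (auto split: split_indicator)
  finally show "ennreal (\<integral>z. std_normal_density z * sgn (m + c * z) \<partial>lborel)
    = 2 * (\<integral>\<^sup>+z\<in>{0..}. ennreal (std_normal_density z) * of_bool (c * z < m) \<partial>lborel)"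
    by (simp add: I_def)
qed

lemma bridge_sign_nonneg:
  assumes "0 < r" "r \<le> s" "0 < y"
  shows "0 \<le> bridge_sign r s y"
proof (cases "r = s")
  case False
  define c where "c = sqrt (r * (s - r) / s)"
  have c: "0 < c" using assms False by (simp add: c_def)
  have "0 \<le> (\<integral>z. std_normal_density z * sgn (r * y / s + c * z) \<partial>lborel)"
    using assms c by (intro integral_sgn_shift(1)) auto
  then show ?thesis using False integral_normal_sgn[OF c] by (simp add: bridge_sign_def c_def)
qed (use assms in \<open>simp add: bridge_sign_def\<close>)

text \<open>
  The expected sign is a normal probability of a symmetric interval whose length grows with \<open>r\<close>. Scaling
  the integration variable by \<open>y / sqrt s\<close> makes the interval independent of \<open>y\<close>; its end point
  \<open>sqrt (r / (s - r))\<close> is encoded in the condition on \<open>p\<close>, which also covers the infinite interval for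
  \<open>r = s\<close>. Thus \<open>r\<close> enters only through that condition, and as \<open>r\<close> varies the formula is a
  distribution function.
\<close>

lemma bridge_sign_as_mixture:
  assumes rs: "0 < r" "r \<le> s" and y: "0 < y"
  shows "ennreal (bridge_sign r s y) = (\<integral>\<^sup>+p\<in>{0..}. ennreal (2 / sqrt (2 * pi) * (y / sqrt s) * exp (- (y\<^sup>2 * p\<^sup>2 / (2 * s)))) *
      of_bool (s * p\<^sup>2 / (1 + p\<^sup>2) < r) \<partial>lborel)"
proof -
  have s: "0 < s" using rs by simp
  have p1: "0 < 1 + p\<^sup>2" for p :: real by (simp add: add_pos_nonneg)
  define P where "P z \<longleftrightarrow> s * (z * sqrt s / y)\<^sup>2 / (1 + (z * sqrt s / y)\<^sup>2) < r" for z
  have [measurable]: "Measurable.pred borel P" unfolding P_def by measurable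
  have *: "ennreal (bridge_sign r s y) = 2 * (\<integral>\<^sup>+z\<in>{0..}. ennreal (std_normal_density z) * of_bool (P z) \<partial>lborel)"
  proof (cases "r = s")
    case True
    have P: "P z" for z
      using p1[of "z * sqrt s / y"] s unfolding P_def True by (simp add: pos_divide_less_eq)
    have "2 * (\<integral>\<^sup>+z\<in>{0..}. ennreal (std_normal_density z) * of_bool (P z) \<partial>lborel) = (\<integral>\<^sup>+z. ennreal (std_normal_density z) \<partial>lborel)"
      by (subst nn_integral_even) (auto simp: normal_density_def P)
    also have "\<dots> = ennreal 1"
      by (subst nn_integral_eq_integral) auto
    finally show ?thesis using True y by (simp add: bridge_sign_def)
  next
    case False
    define c where "c = sqrt (r * (s - r) / s)"
    have c: "0 < c" using rs False by (simp add: c_def)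
    have P: "P z \<longleftrightarrow> c * z < r * y / s" if "0 \<le> z" for z
    proof -
      have "c * z < r * y / s \<longleftrightarrow> (c * z)\<^sup>2 < (r * y / s)\<^sup>2"
        using power_mono_iff[of "r * y / s" "c * z" 2] that c rs y by (simp add: not_le[symmetric])
      also have "(c * z)\<^sup>2 = r * (s - r) / s * z\<^sup>2"
        using rs by (simp add: c_def power_mult_distrib)
      also have "r * (s - r) / s * z\<^sup>2 < (r * y / s)\<^sup>2 \<longleftrightarrow> (s - r) * s * z\<^sup>2 < r * y\<^sup>2"
      proof -
        have "r * (s - r) / s * z\<^sup>2 = (r / s\<^sup>2) * ((s - r) * s * z\<^sup>2)" using s by (simp add: power2_eq_square)
        moreover have "(r * y / s)\<^sup>2 = (r / s\<^sup>2) * (r * y\<^sup>2)" using s by (simp add: power2_eq_square)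
        moreover have "0 < r / s\<^sup>2" using rs s by simp
        ultimately show ?thesis by (simp only: mult_less_cancel_left_pos)
      qed
      also have "\<dots> \<longleftrightarrow> P z"
      proof -
        have "P z \<longleftrightarrow> s * (z * sqrt s / y)\<^sup>2 < r * (1 + (z * sqrt s / y)\<^sup>2)"
          unfolding P_def using p1 by (simp add: pos_divide_less_eq)
        also have "(z * sqrt s / y)\<^sup>2 = z\<^sup>2 * s / y\<^sup>2" using s by (simp add: power_mult_distrib power_divide)
        also have "s * (z\<^sup>2 * s / y\<^sup>2) < r * (1 + z\<^sup>2 * s / y\<^sup>2) \<longleftrightarrow> (s - r) * s * z\<^sup>2 < r * y\<^sup>2"
          using y by (simp add: field_simps)
        finally show ?thesis by simp
      qed
      finally show ?thesis by simp
    qed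
    have "ennreal (bridge_sign r s y) = ennreal (\<integral>z. std_normal_density z * sgn (r * y / s + c * z) \<partial>lborel)"
      using False integral_normal_sgn[OF c] by (simp add: bridge_sign_def c_def)
    also have "\<dots> = 2 * (\<integral>\<^sup>+z\<in>{0..}. ennreal (std_normal_density z) * of_bool (c * z < r * y / s) \<partial>lborel)"
      using c rs s y by (intro integral_sgn_shift(2)) auto
    also have "(\<integral>\<^sup>+z\<in>{0..}. ennreal (std_normal_density z) * of_bool (c * z < r * y / s) \<partial>lborel)
        = (\<integral>\<^sup>+z\<in>{0..}. ennreal (std_normal_density z) * of_bool (P z) \<partial>lborel)"
      by (intro nn_integral_cong) (auto simp: P split: split_indicator)
    finally show ?thesis .
  qed
  also have "(\<integral>\<^sup>+z\<in>{0..}. ennreal (std_normal_density z) * of_bool (P z) \<partial>lborel)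
      = ennreal \<bar>y / sqrt s\<bar> * (\<integral>\<^sup>+p. ennreal (std_normal_density (0 + (y / sqrt s) * p)) * of_bool (P (0 + (y / sqrt s) * p))
          * indicator {0..} (0 + (y / sqrt s) * p) \<partial>lborel)"
    using s y by (intro nn_integral_real_affine) auto
  also have "2 * \<dots> = (\<integral>\<^sup>+p. 2 * ennreal \<bar>y / sqrt s\<bar> * (ennreal (std_normal_density (0 + (y / sqrt s) * p)) * of_bool (P (0 + (y / sqrt s) * p))
          * indicator {0..} (0 + (y / sqrt s) * p)) \<partial>lborel)"
    by (subst nn_integral_cmult) (auto simp: mult.assoc)
  also have "\<dots> = (\<integral>\<^sup>+p\<in>{0..}. ennreal (2 / sqrt (2 * pi) * (y / sqrt s) * exp (- (y\<^sup>2 * p\<^sup>2 / (2 * s)))) *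
      of_bool (s * p\<^sup>2 / (1 + p\<^sup>2) < r) \<partial>lborel)"
  proof (intro nn_integral_cong)
    fix p :: real
    have "P (0 + (y / sqrt s) * p) \<longleftrightarrow> s * p\<^sup>2 / (1 + p\<^sup>2) < r" using s y by (simp add: P_def)
    moreover have "(indicator {0..} (0 + (y / sqrt s) * p) :: ennreal) = indicator {0..} p"
      using s y by (auto split: split_indicator simp: zero_le_mult_iff zero_le_divide_iff)
    moreover have "2 * ennreal \<bar>y / sqrt s\<bar> * ennreal (std_normal_density (0 + (y / sqrt s) * p))
       = ennreal (2 / sqrt (2 * pi) * (y / sqrt s) * exp (- (y\<^sup>2 * p\<^sup>2 / (2 * s))))"
    proof -
      have "2 * ennreal \<bar>y / sqrt s\<bar> * ennreal (std_normal_density (0 + (y / sqrt s) * p))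
         = ennreal (2 * \<bar>y / sqrt s\<bar> * std_normal_density (0 + (y / sqrt s) * p))"
        by (subst ennreal_numeral[symmetric], subst ennreal_mult[symmetric], simp, simp,
            subst ennreal_mult[symmetric]) auto
      also have "2 * \<bar>y / sqrt s\<bar> * std_normal_density (0 + (y / sqrt s) * p)
         = 2 / sqrt (2 * pi) * (y / sqrt s) * exp (- (y\<^sup>2 * p\<^sup>2 / (2 * s)))"
        using s y by (simp add: std_normal_density_def power_mult_distrib power_divide ac_simps)
      finally show ?thesis .
    qed
    ultimately show "2 * ennreal \<bar>y / sqrt s\<bar> * (ennreal (std_normal_density (0 + (y / sqrt s) * p)) * of_bool (P (0 + (y / sqrt s) * p))
          * indicator {0..} (0 + (y / sqrt s) * p))
      = ennreal (2 / sqrt (2 * pi) * (y / sqrt s) * exp (- (y\<^sup>2 * p\<^sup>2 / (2 * s)))) *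
      of_bool (s * p\<^sup>2 / (1 + p\<^sup>2) < r) * indicator {0..} p"
      by (simp only: mult.assoc[symmetric])
  qed
  finally show ?thesis .
qed

lemma integral_sign_convolution:
  fixes h :: "real \<Rightarrow> real"
  assumes rs: "0 < r" "r < s" and [measurable]: "h \<in> borel_measurable borel" and h: "\<And>y. \<bar>h y\<bar> \<le> C"
  shows "(\<integral>x. normal_density 0 (sqrt r) x * (sgn x * (\<integral>z. normal_density 0 (sqrt (s - r)) z * h (x + z) \<partial>lborel)) \<partial>lborel)
    = (\<integral>y. normal_density 0 (sqrt s) y * (h y * bridge_sign r s y) \<partial>lborel)"
proof -
  define c where "c = sqrt (r * (s - r) / s)"
  have c: "0 < c" using rs by (simp add: c_def)
  have C: "0 \<le> C" using h[of 0] by linarith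
  define F where "F x y = normal_density 0 (sqrt s) y * normal_density (r * y / s) c x * (sgn x * h y)" for x y
  have [measurable]: "case_prod F \<in> borel_measurable (lborel \<Otimes>\<^sub>M lborel)"
    unfolding F_def normal_density_def by measurable
  have int: "integrable (lborel \<Otimes>\<^sub>M lborel) (case_prod F)"
  proof (rule integrableI_bounded)
    have "(\<integral>\<^sup>+x. ennreal (norm (case_prod F x)) \<partial>(lborel \<Otimes>\<^sub>M lborel)) = (\<integral>\<^sup>+y. \<integral>\<^sup>+x. ennreal (norm (F x y)) \<partial>lborel \<partial>lborel)"
      by (subst lborel_pair.nn_integral_snd[symmetric]) simp_all
    also have "\<dots> \<le> (\<integral>\<^sup>+y. \<integral>\<^sup>+x. ennreal (C * normal_density 0 (sqrt s) y) * ennreal (normal_density (r * y / s) c x) \<partial>lborel \<partial>lborel)"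
    proof (intro nn_integral_mono)
      fix x y :: real
      have "\<bar>sgn x * h y\<bar> \<le> C" using h[of y] C by (auto simp: abs_mult abs_sgn_eq)
      then have "norm (F x y) \<le> normal_density 0 (sqrt s) y * normal_density (r * y / s) c x * C"
        unfolding F_def real_norm_def abs_mult[of "_ * _" "sgn x * h y"] by (intro mult_mono) auto
      then show "ennreal (norm (F x y)) \<le> ennreal (C * normal_density 0 (sqrt s) y) * ennreal (normal_density (r * y / s) c x)"
        using C by (simp add: ennreal_mult[symmetric] ennreal_leI ac_simps)
    qed
    also have "\<dots> = (\<integral>\<^sup>+y. ennreal (C * normal_density 0 (sqrt s) y) \<partial>lborel)"
      using c by (simp add: nn_integral_cmult nn_integral_eq_integral)
    also have "\<dots> = ennreal C"
      using rs C by (subst nn_integral_eq_integral) auto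
    finally show "(\<integral>\<^sup>+x. ennreal (norm (case_prod F x)) \<partial>(lborel \<Otimes>\<^sub>M lborel)) < \<infinity>"
      by (simp add: le_less_trans)
  qed measurable
  have "(\<integral>x. normal_density 0 (sqrt r) x * (sgn x * (\<integral>z. normal_density 0 (sqrt (s - r)) z * h (x + z) \<partial>lborel)) \<partial>lborel)
      = (\<integral>x. (\<integral>y. F x y \<partial>lborel) \<partial>lborel)"
  proof (intro Bochner_Integration.integral_cong refl)
    fix x :: real
    have "(\<integral>z. normal_density 0 (sqrt (s - r)) z * h (x + z) \<partial>lborel)
      = (\<integral>y. normal_density 0 (sqrt (s - r)) (y - x) * h y \<partial>lborel)"
      using lborel_integral_real_affine[of 1 "\<lambda>y. normal_density 0 (sqrt (s - r)) (y - x) * h y" x] by simp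
    then have "normal_density 0 (sqrt r) x * (sgn x * (\<integral>z. normal_density 0 (sqrt (s - r)) z * h (x + z) \<partial>lborel))
      = (\<integral>y. normal_density 0 (sqrt r) x * (sgn x * (normal_density 0 (sqrt (s - r)) (y - x) * h y)) \<partial>lborel)"
      by simp
    also have "\<dots> = (\<integral>y. F x y \<partial>lborel)"
    proof (intro Bochner_Integration.integral_cong refl)
      fix y :: real
      have "normal_density 0 (sqrt r) x * (sgn x * (normal_density 0 (sqrt (s - r)) (y - x) * h y))
         = (normal_density 0 (sqrt r) x * normal_density 0 (sqrt (s - r)) (y - x)) * (sgn x * h y)" by simp
      then show "normal_density 0 (sqrt r) x * (sgn x * (normal_density 0 (sqrt (s - r)) (y - x) * h y)) = F x y"
        unfolding bridge_factorization[OF rs] F_def c_def by simp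
    qed
    finally show "normal_density 0 (sqrt r) x * (sgn x * (\<integral>z. normal_density 0 (sqrt (s - r)) z * h (x + z) \<partial>lborel))
      = (\<integral>y. F x y \<partial>lborel)" .
  qed
  also have "\<dots> = (\<integral>y. (\<integral>x. F x y \<partial>lborel) \<partial>lborel)"
    by (rule lborel_pair.Fubini_integral[OF int, symmetric])
  also have "\<dots> = (\<integral>y. normal_density 0 (sqrt s) y * (h y * bridge_sign r s y) \<partial>lborel)"
  proof (intro Bochner_Integration.integral_cong refl)
    fix y :: real
    have "(\<integral>x. F x y \<partial>lborel) = (\<integral>x. (normal_density 0 (sqrt s) y * h y) * (normal_density (r * y / s) c x * sgn x) \<partial>lborel)"
      by (simp add: F_def ac_simps)
    also have "\<dots> = (normal_density 0 (sqrt s) y * h y) * (\<integral>x. normal_density (r * y / s) c x * sgn x \<partial>lborel)"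
      by simp
    finally show "(\<integral>x. F x y \<partial>lborel) = normal_density 0 (sqrt s) y * (h y * bridge_sign r s y)"
      using rs by (simp add: bridge_sign_def c_def)
  qed
  finally show ?thesis .
qed

lemma abs_times_gauss_moment_le:
  assumes "0 < \<mu>"
  shows "\<bar>\<bar>y\<bar> * gauss_moment \<mu> y\<bar> \<le> 2 / \<mu>"
proof -
  have "\<mu> * y\<^sup>2 / 2 \<le> exp (\<mu> * y\<^sup>2 / 2)"
    using exp_ge_add_one_self[of "\<mu> * y\<^sup>2 / 2"] by linarith
  then have "y\<^sup>2 * exp (- (\<mu> * y\<^sup>2 / 2)) \<le> 2 / \<mu>"
    using assms by (simp add: exp_minus field_simps)
  moreover have "\<bar>\<bar>y\<bar> * gauss_moment \<mu> y\<bar> = y\<^sup>2 * exp (- (\<mu> * y\<^sup>2 / 2))"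
    by (simp add: gauss_moment_def abs_mult power2_eq_square mult.assoc[symmetric])
  ultimately show ?thesis by simp
qed

text \<open>
  With the expected sign written as a mixture over \<open>p\<close>, all remaining factors are exponentials in \<open>y\<^sup>2\<close>, and the
  integral over \<open>y\<close> is a third absolute moment.
\<close>

lemma ennreal_bridge_integral:
  assumes rs: "0 < r" "r \<le> s" and \<mu>: "0 < \<mu>"
  shows "ennreal (\<integral>y. normal_density 0 (sqrt s) y * (\<bar>y\<bar> * gauss_moment \<mu> y * bridge_sign r s y) \<partial>lborel)
    = (\<integral>\<^sup>+p\<in>{0..}. ennreal (4 / (pi * s) / (\<mu> + (1 + p\<^sup>2) / s)\<^sup>2) * of_bool (s * p\<^sup>2 / (1 + p\<^sup>2) < r) \<partial>lborel)"
proof -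
  have s: "0 < s" using rs by simp
  define g where "g y = normal_density 0 (sqrt s) y * (\<bar>y\<bar> * gauss_moment \<mu> y * bridge_sign r s y)" for y
  define q :: "real \<Rightarrow> ennreal" where "q p = of_bool (s * p\<^sup>2 / (1 + p\<^sup>2) < r)" for p
  have [measurable]: "q \<in> borel_measurable borel" unfolding q_def by measurable
  have [measurable]: "g \<in> borel_measurable borel" unfolding g_def by measurable
  have g_minus: "g (- y) = g y" for y
    using rs by (simp add: g_def bridge_sign_minus gauss_moment_minus normal_density_def)
  have g_pos: "0 \<le> g y" if "0 < y" for y
    using that bridge_sign_nonneg[OF rs that] by (simp add: g_def gauss_moment_def)
  have g_nonneg: "0 \<le> g y" for y
  proof (cases y "0 :: real" rule: linorder_cases)
    case less
    then show ?thesis using g_pos[of "- y"] g_minus[of y] by linarith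
  next
    case equal
    then show ?thesis by (simp add: g_def)
  qed (rule g_pos)
  have int: "integrable lborel g"
    unfolding g_def
  proof (rule integrable_normal_times_bounded[where C = "2 / \<mu>"])
    show "\<bar>\<bar>y\<bar> * gauss_moment \<mu> y * bridge_sign r s y\<bar> \<le> 2 / \<mu>" for y
      using mult_mono[OF abs_times_gauss_moment_le[OF \<mu>, of y] abs_bridge_sign_le[OF rs, of y]] \<mu>
      by (simp add: abs_mult)
  qed (use s in auto)
  have "ennreal (\<integral>y. g y \<partial>lborel) = (\<integral>\<^sup>+y. ennreal (g y) \<partial>lborel)"
    using int g_nonneg by (intro nn_integral_eq_integral[symmetric]) auto
  also have "\<dots> = 2 * (\<integral>\<^sup>+y\<in>{0..}. ennreal (g y) \<partial>lborel)"
    by (rule nn_integral_even) (auto simp: g_minus)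
  also have "\<dots> = (\<integral>\<^sup>+y\<in>{0..}. 2 * ennreal (g y) \<partial>lborel)"
    by (subst nn_integral_cmult[symmetric]) (auto simp: mult.assoc)
  also have "\<dots> = (\<integral>\<^sup>+y. (\<integral>\<^sup>+p. ennreal (2 / (pi * s) * (y ^ 3 * exp (- ((\<mu> + (1 + p\<^sup>2) / s) * y\<^sup>2 / 2)))) * q p * indicator {0..} p * indicator {0..} y \<partial>lborel) \<partial>lborel)"
  proof (intro nn_integral_cong)
    fix y :: real
    consider "y < 0" | "y = 0" | "0 < y" by linarith
    then show "2 * ennreal (g y) * indicator {0..} y
       = (\<integral>\<^sup>+p. ennreal (2 / (pi * s) * (y ^ 3 * exp (- ((\<mu> + (1 + p\<^sup>2) / s) * y\<^sup>2 / 2)))) * q p * indicator {0..} p * indicator {0..} y \<partial>lborel)"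
    proof cases
      case 3
      define A where "A = 2 * (normal_density 0 (sqrt s) y * (\<bar>y\<bar> * gauss_moment \<mu> y))"
      have A: "0 \<le> A" using 3 by (simp add: A_def gauss_moment_def)
      have "2 * ennreal (g y) = ennreal (A * bridge_sign r s y)"
        using g_nonneg by (subst ennreal_numeral[symmetric], subst ennreal_mult[symmetric]) (auto simp: g_def A_def ac_simps)
      also have "\<dots> = ennreal A * ennreal (bridge_sign r s y)"
        using A by (rule ennreal_mult')
      also have "\<dots> = (\<integral>\<^sup>+p. ennreal A * (ennreal (2 / sqrt (2 * pi) * (y / sqrt s) * exp (- (y\<^sup>2 * p\<^sup>2 / (2 * s)))) * q p * indicator {0..} p) \<partial>lborel)"
        unfolding bridge_sign_as_mixture[OF rs 3] q_def by (rule nn_integral_cmult[symmetric]) measurable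
      also have "\<dots> = (\<integral>\<^sup>+p. ennreal (2 / (pi * s) * (y ^ 3 * exp (- ((\<mu> + (1 + p\<^sup>2) / s) * y\<^sup>2 / 2)))) * q p * indicator {0..} p \<partial>lborel)"
      proof (intro nn_integral_cong)
        fix p :: real
        have e: "- ((\<mu> + (1 + p\<^sup>2) / s) * y\<^sup>2 / 2) = - y\<^sup>2 / (2 * s) + - (\<mu> * y\<^sup>2 / 2) + - (y\<^sup>2 * p\<^sup>2 / (2 * s))"
          using s by (simp add: field_simps)
        have d: "sqrt (2 * pi * s) * sqrt (2 * pi) * sqrt s = 2 * pi * s"
        proof -
          have "sqrt (2 * pi) * sqrt s = sqrt (2 * pi * s)" by (rule real_sqrt_mult[symmetric])
          then have "sqrt (2 * pi * s) * sqrt (2 * pi) * sqrt s = sqrt (2 * pi * s) * sqrt (2 * pi * s)"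
            by (simp only: mult.assoc)
          then show ?thesis using s by simp
        qed
        have "A * (2 / sqrt (2 * pi) * (y / sqrt s) * exp (- (y\<^sup>2 * p\<^sup>2 / (2 * s))))
           = 4 / (sqrt (2 * pi * s) * sqrt (2 * pi) * sqrt s) * (y ^ 3 * exp (- ((\<mu> + (1 + p\<^sup>2) / s) * y\<^sup>2 / 2)))"
          using 3 s unfolding e exp_add A_def
          by (simp add: normal_density_def gauss_moment_def power3_eq_cube ac_simps)
        also have "\<dots> = 2 / (pi * s) * (y ^ 3 * exp (- ((\<mu> + (1 + p\<^sup>2) / s) * y\<^sup>2 / 2)))"
          unfolding d by simp
        finally show "ennreal A * (ennreal (2 / sqrt (2 * pi) * (y / sqrt s) * exp (- (y\<^sup>2 * p\<^sup>2 / (2 * s)))) * q p * indicator {0..} p)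
           = ennreal (2 / (pi * s) * (y ^ 3 * exp (- ((\<mu> + (1 + p\<^sup>2) / s) * y\<^sup>2 / 2)))) * q p * indicator {0..} p"
          using A by (simp only: mult.assoc[symmetric] ennreal_mult'[symmetric])
      qed
      finally show ?thesis using 3 by simp
    qed (auto simp: g_def)
  qed
  also have "\<dots> = (\<integral>\<^sup>+p. (\<integral>\<^sup>+y. ennreal (2 / (pi * s) * (y ^ 3 * exp (- ((\<mu> + (1 + p\<^sup>2) / s) * y\<^sup>2 / 2)))) * q p * indicator {0..} p * indicator {0..} y \<partial>lborel) \<partial>lborel)"
    by (rule lborel_pair.Fubini') measurable
  also have "\<dots> = (\<integral>\<^sup>+p. ennreal (4 / (pi * s) / (\<mu> + (1 + p\<^sup>2) / s)\<^sup>2) * q p * indicator {0..} p \<partial>lborel)"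
  proof (intro nn_integral_cong)
    fix p :: real
    define c where "c = \<mu> + (1 + p\<^sup>2) / s"
    have c: "0 < c" using \<mu> s by (simp add: c_def add_pos_nonneg)
    have "(\<integral>\<^sup>+y. ennreal (2 / (pi * s) * (y ^ 3 * exp (- (c * y\<^sup>2 / 2)))) * q p * indicator {0..} p * indicator {0..} y \<partial>lborel)
       = (\<integral>\<^sup>+y. (ennreal (2 / (pi * s)) * q p * indicator {0..} p) * (ennreal (y ^ 3 * exp (- (c * y\<^sup>2 / 2))) * indicator {0..} y) \<partial>lborel)"
    proof (intro nn_integral_cong)
      fix y
      have "ennreal (2 / (pi * s) * (y ^ 3 * exp (- (c * y\<^sup>2 / 2)))) = ennreal (2 / (pi * s)) * ennreal (y ^ 3 * exp (- (c * y\<^sup>2 / 2)))"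
        using s by (intro ennreal_mult') simp
      then show "ennreal (2 / (pi * s) * (y ^ 3 * exp (- (c * y\<^sup>2 / 2)))) * q p * indicator {0..} p * indicator {0..} y
        = (ennreal (2 / (pi * s)) * q p * indicator {0..} p) * (ennreal (y ^ 3 * exp (- (c * y\<^sup>2 / 2))) * indicator {0..} y)"
        by (simp only: mult_ac)
    qed
    also have "\<dots> = (ennreal (2 / (pi * s)) * q p * indicator {0..} p) * ennreal (2 / c\<^sup>2)"
      unfolding nn_integral_cubic_gaussian[OF c, symmetric] by (rule nn_integral_cmult) measurable
    also have "\<dots> = ennreal (2 / (pi * s)) * ennreal (2 / c\<^sup>2) * q p * indicator {0..} p"
      by (simp only: mult_ac)
    also have "ennreal (2 / (pi * s)) * ennreal (2 / c\<^sup>2) = ennreal (4 / (pi * s) / c\<^sup>2)"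
      using s by (subst ennreal_mult[symmetric]) auto
    finally show "(\<integral>\<^sup>+y. ennreal (2 / (pi * s) * (y ^ 3 * exp (- ((\<mu> + (1 + p\<^sup>2) / s) * y\<^sup>2 / 2)))) * q p * indicator {0..} p * indicator {0..} y \<partial>lborel)
      = ennreal (4 / (pi * s) / (\<mu> + (1 + p\<^sup>2) / s)\<^sup>2) * q p * indicator {0..} p"
      unfolding c_def .
  qed
  finally show ?thesis by (simp add: g_def[abs_def] q_def)
qed

section \<open>Integrating out Gaussian increments\<close>

lemma (in prob_space) expectation_indep:
  fixes f :: "'b \<times> 'b \<Rightarrow> real"
  assumes indep: "indep_var S X T Y" and f[measurable]: "f \<in> borel_measurable (S \<Otimes>\<^sub>M T)"
    and int: "integrable M (\<lambda>\<omega>. f (X \<omega>, Y \<omega>))"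
  shows "expectation (\<lambda>\<omega>. f (X \<omega>, Y \<omega>)) = expectation (\<lambda>\<omega>. \<integral>z. f (X \<omega>, z) \<partial>distr M T Y)"
proof -
  have [measurable]: "random_variable S X" "random_variable T Y"
    using indep by (auto dest: indep_var_rv1 indep_var_rv2)
  interpret X: prob_space "distr M S X" by (rule prob_space_distr) measurable
  interpret Y: prob_space "distr M T Y" by (rule prob_space_distr) measurable
  interpret XY: pair_prob_space "distr M S X" "distr M T Y" ..
  have eq: "distr M (S \<Otimes>\<^sub>M T) (\<lambda>\<omega>. (X \<omega>, Y \<omega>)) = distr M S X \<Otimes>\<^sub>M distr M T Y"
    using indep by (simp add: indep_var_distribution_eq)
  have "integrable (distr M (S \<Otimes>\<^sub>M T) (\<lambda>\<omega>. (X \<omega>, Y \<omega>))) f"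
    using int by (subst integrable_distr_eq) auto
  then have "(\<integral>x. (\<integral>z. f (x, z) \<partial>distr M T Y) \<partial>distr M S X) = integral\<^sup>L (distr M (S \<Otimes>\<^sub>M T) (\<lambda>\<omega>. (X \<omega>, Y \<omega>))) f"
    unfolding eq by (rule XY.integral_fst')
  also have "\<dots> = expectation (\<lambda>\<omega>. f (X \<omega>, Y \<omega>))"
    by (rule integral_distr) measurable
  also have "(\<integral>x. (\<integral>z. f (x, z) \<partial>distr M T Y) \<partial>distr M S X) = expectation (\<lambda>\<omega>. \<integral>z. f (X \<omega>, z) \<partial>distr M T Y)"
    by (rule integral_distr) measurable
  finally show ?thesis ..
qed

context brownian_motion
begin

text \<open>
  The Markov property in the only form needed: a function of \<open>B r\<close>, \<open>B s\<close> and the later increment.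
\<close>

lemma integrate_out_increment:
  fixes f :: "real \<times> real \<times> real \<Rightarrow> real"
  assumes rst: "0 \<le> r" "r \<le> s" "s < t"
    and [measurable]: "f \<in> borel_measurable (borel \<Otimes>\<^sub>M borel \<Otimes>\<^sub>M borel)"
    and int: "integrable M (\<lambda>\<omega>. f (B r \<omega>, B s \<omega>, B t \<omega> - B s \<omega>))"
  shows "expectation (\<lambda>\<omega>. f (B r \<omega>, B s \<omega>, B t \<omega> - B s \<omega>))
    = expectation (\<lambda>\<omega>. \<integral>z. normal_density 0 (sqrt (t - s)) z * f (B r \<omega>, B s \<omega>, z) \<partial>lborel)"
proof -
  define \<tau> :: "nat \<Rightarrow> real" where "\<tau> i = (if i = 0 then 0 else if i = 1 then r else if i = 2 then s else t)" for i
  define X where "X i \<omega> = B (\<tau> (Suc i)) \<omega> - B (\<tau> i) \<omega>" for i \<omega>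
  have "\<tau> i \<le> \<tau> (Suc i)" if "i < 3" for i
    using rst that by (auto simp: \<tau>_def numeral_3_eq_3 less_Suc_eq)
  then have ind: "indep_vars (\<lambda>_. borel) X {..<3::nat}"
    unfolding X_def[abs_def] by (intro increments_indep) (auto simp: \<tau>_def)
  have X_eq: "X 0 \<omega> = B r \<omega>" "X 0 \<omega> + X 1 \<omega> = B s \<omega>" "X 2 \<omega> = B t \<omega> - B s \<omega>" if "\<omega> \<in> space M" for \<omega>
    using that by (simp_all add: X_def \<tau>_def B_0)
  have [measurable]: "random_variable borel (X 0)" "random_variable borel (X 1)" "random_variable borel (X 2)"
    using ind by (auto simp: indep_vars_def)
  define past where "past \<omega> = restrict (\<lambda>i. X i \<omega>) {0, 1}" for \<omega>
  define future where "future \<omega> = restrict (\<lambda>i. X i \<omega>) {2}" for \<omega>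
  define F where "F p = f (fst p 0, fst p 0 + fst p 1, snd p 2)" for p :: "(nat \<Rightarrow> real) \<times> (nat \<Rightarrow> real)"
  have [measurable]: "F \<in> borel_measurable (PiM {0, 1} (\<lambda>_. borel) \<Otimes>\<^sub>M PiM {2} (\<lambda>_. borel))"
    unfolding F_def by measurable
  have future_m[measurable]: "future \<in> measurable M (PiM {2} (\<lambda>_. borel))"
    unfolding future_def by measurable auto
  have F_eq: "F (past \<omega>, future \<omega>) = f (B r \<omega>, B s \<omega>, B t \<omega> - B s \<omega>)" if "\<omega> \<in> space M" for \<omega>
    using X_eq[OF that] by (simp add: F_def past_def future_def)
  have F_eq': "F (past \<omega>, y) = f (B r \<omega>, B s \<omega>, y 2)" if "\<omega> \<in> space M" for \<omega> y
    using X_eq[OF that] by (simp add: F_def past_def)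
  have "expectation (\<lambda>\<omega>. f (B r \<omega>, B s \<omega>, B t \<omega> - B s \<omega>)) = expectation (\<lambda>\<omega>. F (past \<omega>, future \<omega>))"
    by (intro Bochner_Integration.integral_cong) (simp_all add: F_eq)
  also have "\<dots> = expectation (\<lambda>\<omega>. \<integral>y. F (past \<omega>, y) \<partial>distr M (PiM {2} (\<lambda>_. borel)) future)"
  proof (rule expectation_indep)
    show "indep_var (PiM {0, 1} (\<lambda>_. borel)) past (PiM {2} (\<lambda>_. borel)) future"
      unfolding past_def future_def by (rule indep_var_restrict[OF ind]) auto
    show "integrable M (\<lambda>\<omega>. F (past \<omega>, future \<omega>))"
      using int by (subst Bochner_Integration.integrable_cong[OF refl F_eq]) auto
  qed measurable
  also have "\<dots> = expectation (\<lambda>\<omega>. \<integral>z. normal_density 0 (sqrt (t - s)) z * f (B r \<omega>, B s \<omega>, z) \<partial>lborel)"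
  proof (intro Bochner_Integration.integral_cong refl)
    fix \<omega> assume \<omega>: "\<omega> \<in> space M"
    have "(\<integral>y. F (past \<omega>, y) \<partial>distr M (PiM {2} (\<lambda>_. borel)) future)
        = expectation (\<lambda>\<omega>'. F (past \<omega>, future \<omega>'))"
      unfolding F_eq'[OF \<omega>] by (rule integral_distr) measurable
    also have "\<dots> = expectation (\<lambda>\<omega>'. f (B r \<omega>, B s \<omega>, B t \<omega>' - B s \<omega>'))"
      using X_eq(3) by (intro Bochner_Integration.integral_cong) (simp_all add: F_eq'[OF \<omega>] future_def)
    also have "\<dots> = (\<integral>z. f (B r \<omega>, B s \<omega>, z) \<partial>distr M borel (\<lambda>\<omega>. B t \<omega> - B s \<omega>))"
      using rst by (intro integral_distr[symmetric]) (auto intro!: borel_measurable_diff B_measurable)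
    also have "\<dots> = (\<integral>z. normal_density 0 (sqrt (t - s)) z * f (B r \<omega>, B s \<omega>, z) \<partial>lborel)"
      using rst by (subst increment_distr) (auto simp: integral_density)
    finally show "(\<integral>y. F (past \<omega>, y) \<partial>distr M (PiM {2} (\<lambda>_. borel)) future)
        = (\<integral>z. normal_density 0 (sqrt (t - s)) z * f (B r \<omega>, B s \<omega>, z) \<partial>lborel)" .
  qed
  finally show ?thesis .
qed

lemma integrable_sgn_abs_B:
  assumes "0 \<le> r" "0 < s" "0 \<le> t" "0 < \<kappa>"
  shows "integrable M (\<lambda>\<omega>. sgn (B r \<omega>) * (\<bar>B s \<omega>\<bar> * gauss_moment \<kappa> (B t \<omega>)))"
proof (rule Bochner_Integration.integrable_bound)
  have [measurable]: "random_variable borel (B r)" "random_variable borel (B s)" "random_variable borel (B t)"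
    using assms by (auto intro: B_measurable)
  show "(\<lambda>\<omega>. sgn (B r \<omega>) * (\<bar>B s \<omega>\<bar> * gauss_moment \<kappa> (B t \<omega>))) \<in> borel_measurable M" by measurable
  show "integrable M (\<lambda>\<omega>. \<bar>B s \<omega>\<bar> * (1 / 2 + 1 / \<kappa>))"
    using integrable_abs_B assms by (intro integrable_mult_left) auto
  show "AE \<omega> in M. norm (sgn (B r \<omega>) * (\<bar>B s \<omega>\<bar> * gauss_moment \<kappa> (B t \<omega>))) \<le> norm (\<bar>B s \<omega>\<bar> * (1 / 2 + 1 / \<kappa>))"
  proof (intro AE_I2)
    fix \<omega>
    have "norm (sgn (B r \<omega>) * (\<bar>B s \<omega>\<bar> * gauss_moment \<kappa> (B t \<omega>))) \<le> \<bar>B s \<omega>\<bar> * \<bar>gauss_moment \<kappa> (B t \<omega>)\<bar>"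
      by (auto simp: abs_mult abs_sgn_eq)
    also have "\<dots> \<le> \<bar>B s \<omega>\<bar> * (1 / 2 + 1 / \<kappa>)"
      using abs_gauss_moment_le[OF assms(4)] by (intro mult_left_mono) auto
    finally show "norm (sgn (B r \<omega>) * (\<bar>B s \<omega>\<bar> * gauss_moment \<kappa> (B t \<omega>))) \<le> norm (\<bar>B s \<omega>\<bar> * (1 / 2 + 1 / \<kappa>))"
      using assms by simp
  qed
qed

lemma expectation_last_increment:
  assumes rs: "0 \<le> r" "r \<le> s" "0 < s" "s < 1" and v: "0 < v" "v < 1"
  shows "expectation (\<lambda>\<omega>. sgn (B r \<omega>) * (\<bar>B s \<omega>\<bar> * gauss_moment ((1 / v\<^sup>2 - 1) / (1 - s)) (B 1 \<omega>)))
    = v ^ 3 * expectation (\<lambda>\<omega>. sgn (B r \<omega>) * (\<bar>B s \<omega>\<bar> * gauss_moment ((1 - v\<^sup>2) / (1 - s)) (B s \<omega>)))"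
proof -
  define \<kappa> where "\<kappa> = (1 / v\<^sup>2 - 1) / (1 - s)"
  have "v\<^sup>2 < 1" using v by (simp add: power_less_one_iff)
  then have \<kappa>: "0 < \<kappa>" using v rs by (simp add: \<kappa>_def field_simps)
  define f where "f p = sgn (fst p) * (\<bar>fst (snd p)\<bar> * gauss_moment \<kappa> (fst (snd p) + snd (snd p)))" for p :: "real \<times> real \<times> real"
  have fm: "f \<in> borel_measurable (borel \<Otimes>\<^sub>M borel \<Otimes>\<^sub>M borel)"
    unfolding f_def by measurable
  have f_eq: "f (B r \<omega>, B s \<omega>, B 1 \<omega> - B s \<omega>) = sgn (B r \<omega>) * (\<bar>B s \<omega>\<bar> * gauss_moment \<kappa> (B 1 \<omega>))" for \<omega>
    by (simp add: f_def)
  have int: "integrable M (\<lambda>\<omega>. f (B r \<omega>, B s \<omega>, B 1 \<omega> - B s \<omega>))"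
    using integrable_sgn_abs_B[OF rs(1,3) _ \<kappa>, of 1] by (simp add: f_eq)
  have "expectation (\<lambda>\<omega>. sgn (B r \<omega>) * (\<bar>B s \<omega>\<bar> * gauss_moment \<kappa> (B 1 \<omega>)))
      = expectation (\<lambda>\<omega>. \<integral>z. normal_density 0 (sqrt (1 - s)) z * f (B r \<omega>, B s \<omega>, z) \<partial>lborel)"
    using integrate_out_increment[OF rs(1,2,4) fm int] by (simp add: f_eq)
  also have "\<dots> = expectation (\<lambda>\<omega>. v ^ 3 * (sgn (B r \<omega>) * (\<bar>B s \<omega>\<bar> * gauss_moment ((1 - v\<^sup>2) / (1 - s)) (B s \<omega>))))"
  proof (intro Bochner_Integration.integral_cong refl)
    fix \<omega>
    have "(\<integral>z. normal_density 0 (sqrt (1 - s)) z * f (B r \<omega>, B s \<omega>, z) \<partial>lborel)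
      = (\<integral>z. (sgn (B r \<omega>) * \<bar>B s \<omega>\<bar>) * (normal_density 0 (sqrt (1 - s)) z * gauss_moment \<kappa> (B s \<omega> + z)) \<partial>lborel)"
      by (simp add: f_def ac_simps)
    also have "\<dots> = (sgn (B r \<omega>) * \<bar>B s \<omega>\<bar>) * (v ^ 3 * gauss_moment ((1 - v\<^sup>2) / (1 - s)) (B s \<omega>))"
      using gauss_moment_convolution[OF v, of "1 - s" "B s \<omega>"] rs by (simp add: \<kappa>_def)
    finally show "(\<integral>z. normal_density 0 (sqrt (1 - s)) z * f (B r \<omega>, B s \<omega>, z) \<partial>lborel)
       = v ^ 3 * (sgn (B r \<omega>) * (\<bar>B s \<omega>\<bar> * gauss_moment ((1 - v\<^sup>2) / (1 - s)) (B s \<omega>)))" by simp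
  qed
  finally show ?thesis by (simp add: \<kappa>_def)
qed

lemma expectation_sgn_times:
  fixes h :: "real \<Rightarrow> real"
  assumes rs: "0 < r" "r \<le> s" and hm[measurable]: "h \<in> borel_measurable borel" and h: "\<And>y. \<bar>h y\<bar> \<le> C"
  shows "expectation (\<lambda>\<omega>. sgn (B r \<omega>) * h (B s \<omega>))
    = (\<integral>y. normal_density 0 (sqrt s) y * (h y * bridge_sign r s y) \<partial>lborel)"
proof (cases "r = s")
  case True
  have [measurable]: "random_variable borel (B s)" using rs by (intro B_measurable) auto
  have "expectation (\<lambda>\<omega>. sgn (B r \<omega>) * h (B s \<omega>)) = (\<integral>y. sgn y * h y \<partial>distr M borel (B s))"
    unfolding True by (subst integral_distr) auto
  also have "\<dots> = (\<integral>y. normal_density 0 (sqrt s) y * (sgn y * h y) \<partial>lborel)"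
    using rs by (subst B_distr) (auto simp: integral_density)
  finally show ?thesis using True by (simp add: bridge_sign_def mult.commute)
next
  case False
  have [measurable]: "random_variable borel (B s)" "random_variable borel (B r)" using rs by (auto intro: B_measurable)
  have C: "0 \<le> C" using h[of 0] by linarith
  define f where "f p = sgn (fst p) * h (fst p + snd (snd p))" for p :: "real \<times> real \<times> real"
  have fm: "f \<in> borel_measurable (borel \<Otimes>\<^sub>M borel \<Otimes>\<^sub>M borel)"
    unfolding f_def by measurable
  have f_eq: "f (B r \<omega>, B r \<omega>, B s \<omega> - B r \<omega>) = sgn (B r \<omega>) * h (B s \<omega>)" for \<omega>
    by (simp add: f_def)
  have int: "integrable M (\<lambda>\<omega>. f (B r \<omega>, B r \<omega>, B s \<omega> - B r \<omega>))"
    unfolding f_eq using h C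
    by (intro integrable_const_bound[where B = C] AE_I2) (auto simp: abs_mult abs_sgn_eq)
  have "expectation (\<lambda>\<omega>. sgn (B r \<omega>) * h (B s \<omega>))
      = expectation (\<lambda>\<omega>. \<integral>z. normal_density 0 (sqrt (s - r)) z * f (B r \<omega>, B r \<omega>, z) \<partial>lborel)"
    using integrate_out_increment[OF _ _ _ fm int] rs False by (simp add: f_eq)
  also have "\<dots> = expectation (\<lambda>\<omega>. sgn (B r \<omega>) * (\<integral>z. normal_density 0 (sqrt (s - r)) z * h (B r \<omega> + z) \<partial>lborel))"
  proof (intro Bochner_Integration.integral_cong refl)
    fix \<omega>
    have "(\<integral>z. normal_density 0 (sqrt (s - r)) z * f (B r \<omega>, B r \<omega>, z) \<partial>lborel)
      = (\<integral>z. sgn (B r \<omega>) * (normal_density 0 (sqrt (s - r)) z * h (B r \<omega> + z)) \<partial>lborel)"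
      by (simp add: f_def ac_simps)
    then show "(\<integral>z. normal_density 0 (sqrt (s - r)) z * f (B r \<omega>, B r \<omega>, z) \<partial>lborel)
       = sgn (B r \<omega>) * (\<integral>z. normal_density 0 (sqrt (s - r)) z * h (B r \<omega> + z) \<partial>lborel)" by simp
  qed
  also have "\<dots> = (\<integral>x. sgn x * (\<integral>z. normal_density 0 (sqrt (s - r)) z * h (x + z) \<partial>lborel) \<partial>distr M borel (B r))"
    by (subst integral_distr) auto
  also have "\<dots> = (\<integral>x. normal_density 0 (sqrt r) x * (sgn x * (\<integral>z. normal_density 0 (sqrt (s - r)) z * h (x + z) \<partial>lborel)) \<partial>lborel)"
    unfolding B_distr[OF rs(1)] by (subst integral_density) auto
  also have "\<dots> = (\<integral>y. normal_density 0 (sqrt s) y * (h y * bridge_sign r s y) \<partial>lborel)"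
    using rs False h by (intro integral_sign_convolution) auto
  finally show ?thesis .
qed

end


section \<open>The law of the last zero\<close>

context brownian_motion
begin

lemma last_zero_is_zero:
  assumes "\<omega> \<in> space M"
  shows "0 \<le> last_zero B \<omega>" "last_zero B \<omega> \<le> 1" "B (last_zero B \<omega>) \<omega> = 0"
proof -
  let ?Z = "{s. 0 \<le> s \<and> s \<le> 1 \<and> B s \<omega> = 0}"
  have "continuous_on {0..1} (\<lambda>t. B t \<omega>)"
    using assms by (intro continuous_on_subset[OF B_continuous]) auto
  then have "closed ({0..1} \<inter> (\<lambda>t. B t \<omega>) -` {0})"
    by (intro continuous_closed_preimage) auto
  also have "{0..1} \<inter> (\<lambda>t. B t \<omega>) -` {0} = ?Z" by auto
  finally have "closed ?Z" .
  moreover have "?Z \<noteq> {}" using B_0[OF assms] by (auto intro!: exI[of _ 0])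
  moreover have "bdd_above ?Z" by (rule bdd_aboveI[of _ 1]) auto
  ultimately have "last_zero B \<omega> \<in> ?Z"
    unfolding last_zero_def by (intro closed_contains_Sup) auto
  then show "0 \<le> last_zero B \<omega>" "last_zero B \<omega> \<le> 1" "B (last_zero B \<omega>) \<omega> = 0" by auto
qed

lemma zero_le_last_zero:
  assumes "0 \<le> t" "t \<le> 1" "B t \<omega> = 0"
  shows "t \<le> last_zero B \<omega>"
  unfolding last_zero_def using assms by (intro cSup_upper bdd_aboveI[of _ 1]) auto

lemma last_zero_less_iff:
  assumes "\<omega> \<in> space M" "0 \<le> r"  "r \<le> 1"
  shows "last_zero B \<omega> < r \<longleftrightarrow> \<not> (\<exists>t\<in>{r..1}. B t \<omega> = 0)"
proof
  assume "last_zero B \<omega> < r"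
  then show "\<not> (\<exists>t\<in>{r..1}. B t \<omega> = 0)"
    using zero_le_last_zero[of _ \<omega>] assms(2) by (meson atLeastAtMost_iff not_less order_trans)
next
  assume "\<not> (\<exists>t\<in>{r..1}. B t \<omega> = 0)"
  then show "last_zero B \<omega> < r"
    using last_zero_is_zero[OF assms(1)] by (meson atLeastAtMost_iff not_le)
qed

lemma last_zero_measurable[measurable]: "random_variable borel (last_zero B)"
  unfolding borel_measurable_iff_less
proof
  fix a :: real
  consider "a < 0" | "0 \<le> a" "a \<le> 1" | "1 < a" by linarith
  then show "{\<omega> \<in> space M. last_zero B \<omega> < a} \<in> sets M"
  proof cases
    case 1
    then have "{\<omega> \<in> space M. last_zero B \<omega> < a} = {}" using last_zero_is_zero(1) by fastforce
    then show ?thesis by (simp only: sets.empty_sets)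
  next
    case 2
    have [measurable]: "Measurable.pred M (\<lambda>\<omega>. \<exists>t\<in>{a..1}. B t \<omega> = 0)"
      using 2(1) by (rule measurable_zero_in_interval)
    have "{\<omega> \<in> space M. last_zero B \<omega> < a} = {\<omega> \<in> space M. \<not> (\<exists>t\<in>{a..1}. B t \<omega> = 0)}"
      using last_zero_less_iff 2 by blast
    then show ?thesis by (simp only:) measurable
  next
    case 3
    then have "{\<omega> \<in> space M. last_zero B \<omega> < a} = space M" using last_zero_is_zero(2) by fastforce
    then show ?thesis by (simp only: sets.top)
  qed
qed

text \<open>
  The density of the law of the last zero under \<open>weight s v\<close>, in the variable \<open>p\<close> for which the last zero is
  \<open>s * p\<^sup>2 / (1 + p\<^sup>2)\<close>.
\<close>

definition law_density :: "real \<Rightarrow> real \<Rightarrow> real \<Rightarrow> real" where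
  "law_density s v p = v ^ 3 * (4 / (pi * s) / ((1 - v\<^sup>2) / (1 - s) + (1 + p\<^sup>2) / s)\<^sup>2)"

text \<open>
  The part of \<open>\<bar>B s\<bar> / \<bar>B 1\<bar>\<close> that belongs to the parameter \<open>v\<close> of the Gaussian mixture, up to the factor
  \<open>1 / (v ^ 3 * (1 - s))\<close>.
\<close>

definition weight :: "real \<Rightarrow> real \<Rightarrow> 'a \<Rightarrow> ennreal" where
  "weight s v \<omega> = ennreal (\<bar>B s \<omega>\<bar> * \<bar>gauss_moment ((1 / v\<^sup>2 - 1) / (1 - s)) (B 1 \<omega>)\<bar>)"

lemma last_zero_cdf:
  assumes rs: "0 < r" "r \<le> s" "s < 1" and v: "0 < v" "v < 1"
  shows "(\<integral>\<^sup>+\<omega>. weight s v \<omega> * of_bool (last_zero B \<omega> < r) \<partial>M)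
      = (\<integral>\<^sup>+p\<in>{0..}. ennreal (law_density s v p) * of_bool (s * p\<^sup>2 / (1 + p\<^sup>2) < r) \<partial>lborel)" (is "?L = ?R")
    and "(\<integral>\<^sup>+\<omega>. weight s v \<omega> * of_bool (last_zero B \<omega> < r) \<partial>M) < \<infinity>"
proof -
  have s: "0 < s" using rs by simp
  have v2: "v\<^sup>2 < 1" using v by (simp add: power_less_one_iff)
  define \<kappa> where "\<kappa> = (1 / v\<^sup>2 - 1) / (1 - s)"
  define \<mu> where "\<mu> = (1 - v\<^sup>2) / (1 - s)"
  have \<kappa>: "0 < \<kappa>" using v v2 rs by (simp add: \<kappa>_def field_simps)
  have \<mu>: "0 < \<mu>" using v2 rs by (simp add: \<mu>_def)
  have "?L = (\<integral>\<^sup>+\<omega>. ennreal (\<bar>B s \<omega>\<bar> * \<bar>gauss_moment \<kappa> (B 1 \<omega>)\<bar>) * of_bool (\<not> (\<exists>t\<in>{r..1}. B t \<omega> = 0)) \<partial>M)"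
    using rs by (intro nn_integral_cong) (simp add: weight_def \<kappa>_def last_zero_less_iff)
  also have "\<dots> = ennreal (expectation (\<lambda>\<omega>. sgn (B r \<omega>) * (\<bar>B s \<omega>\<bar> * gauss_moment \<kappa> (B 1 \<omega>))))"
    using rs s \<kappa> by (intro nn_integral_no_zero) auto
  finally have L: "?L = \<dots>" .
  then show "?L < \<infinity>" by simp
  have "expectation (\<lambda>\<omega>. sgn (B r \<omega>) * (\<bar>B s \<omega>\<bar> * gauss_moment \<kappa> (B 1 \<omega>)))
      = v ^ 3 * expectation (\<lambda>\<omega>. sgn (B r \<omega>) * (\<bar>B s \<omega>\<bar> * gauss_moment \<mu> (B s \<omega>)))"
    unfolding \<kappa>_def \<mu>_def using rs s v by (intro expectation_last_increment) auto
  also have "expectation (\<lambda>\<omega>. sgn (B r \<omega>) * (\<bar>B s \<omega>\<bar> * gauss_moment \<mu> (B s \<omega>)))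
      = (\<integral>y. normal_density 0 (sqrt s) y * (\<bar>y\<bar> * gauss_moment \<mu> y * bridge_sign r s y) \<partial>lborel)"
    using rs abs_times_gauss_moment_le[OF \<mu>] by (intro expectation_sgn_times) auto
  also have "ennreal (v ^ 3 * \<dots>) = ennreal (v ^ 3) * ennreal \<dots>"
    using v by (intro ennreal_mult') simp
  also have "\<dots> = ennreal (v ^ 3) * (\<integral>\<^sup>+p\<in>{0..}. ennreal (4 / (pi * s) / (\<mu> + (1 + p\<^sup>2) / s)\<^sup>2) * of_bool (s * p\<^sup>2 / (1 + p\<^sup>2) < r) \<partial>lborel)"
    unfolding ennreal_bridge_integral[OF rs(1,2) \<mu>] ..
  also have "\<dots> = (\<integral>\<^sup>+p. ennreal (v ^ 3) * (ennreal (4 / (pi * s) / (\<mu> + (1 + p\<^sup>2) / s)\<^sup>2) * of_bool (s * p\<^sup>2 / (1 + p\<^sup>2) < r) * indicator {0..} p) \<partial>lborel)"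
    by (rule nn_integral_cmult[symmetric]) measurable
  also have "\<dots> = ?R"
  proof (intro nn_integral_cong)
    fix p :: real
    have "ennreal (law_density s v p) = ennreal (v ^ 3) * ennreal (4 / (pi * s) / (\<mu> + (1 + p\<^sup>2) / s)\<^sup>2)"
      unfolding law_density_def \<mu>_def using v by (intro ennreal_mult') simp
    then show "ennreal (v ^ 3) * (ennreal (4 / (pi * s) / (\<mu> + (1 + p\<^sup>2) / s)\<^sup>2) * of_bool (s * p\<^sup>2 / (1 + p\<^sup>2) < r) * indicator {0..} p)
      = ennreal (law_density s v p) * of_bool (s * p\<^sup>2 / (1 + p\<^sup>2) < r) * indicator {0..} p"
      by (simp only: mult.assoc)
  qed
  finally show "?L = ?R" using L by simp
qed

text \<open>
  Two finite measures on the line with the same distribution function agree. The map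
  \<open>p \<mapsto> s * p\<^sup>2 / (1 + p\<^sup>2)\<close> takes values in \<open>[0, s)\<close>, so that the measure on the right is carried by
  the range of last zeros admitted on the left.
\<close>

lemma last_zero_law:
  assumes s: "0 < s" "s < 1" and v: "0 < v" "v < 1"
    and [measurable]: "\<psi> \<in> borel_measurable borel"
  shows "(\<integral>\<^sup>+\<omega>. weight s v \<omega> * of_bool (last_zero B \<omega> < s) * \<psi> (last_zero B \<omega>) \<partial>M)
      = (\<integral>\<^sup>+p\<in>{0..}. ennreal (law_density s v p) * \<psi> (s * p\<^sup>2 / (1 + p\<^sup>2)) \<partial>lborel)"
proof -
  define \<rho> where "\<rho> p = s * p\<^sup>2 / (1 + p\<^sup>2)" for p
  have p1: "0 < 1 + p\<^sup>2" for p :: real by (simp add: add_pos_nonneg)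
  have \<rho>: "0 \<le> \<rho> p" "\<rho> p < s" for p
    using s p1[of p] by (simp_all add: \<rho>_def pos_divide_less_eq)
  have [measurable]: "\<rho> \<in> borel_measurable borel" unfolding \<rho>_def by measurable
  have [measurable]: "law_density s v \<in> borel_measurable borel" unfolding law_density_def by measurable
  have [measurable]: "random_variable borel (B s)" "random_variable borel (B 1)" using s by (auto intro: B_measurable)
  have [measurable]: "weight s v \<in> borel_measurable M" unfolding weight_def by measurable
  define m1 where "m1 = distr (density M (\<lambda>\<omega>. weight s v \<omega> * of_bool (last_zero B \<omega> < s))) borel (\<lambda>\<omega>. - last_zero B \<omega>)"
  define m2 where "m2 = distr (density lborel (\<lambda>p. ennreal (law_density s v p) * indicator {0..} p)) borel (\<lambda>p. - \<rho> p)"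
  have int1: "(\<integral>\<^sup>+x. f x \<partial>m1) = (\<integral>\<^sup>+\<omega>. weight s v \<omega> * of_bool (last_zero B \<omega> < s) * f (- last_zero B \<omega>) \<partial>M)"
    if [measurable]: "f \<in> borel_measurable borel" for f
    unfolding m1_def by (subst nn_integral_distr, measurable, subst nn_integral_density) auto
  have int2: "(\<integral>\<^sup>+x. f x \<partial>m2) = (\<integral>\<^sup>+p. ennreal (law_density s v p) * indicator {0..} p * f (- \<rho> p) \<partial>lborel)"
    if [measurable]: "f \<in> borel_measurable borel" for f
    unfolding m2_def by (subst nn_integral_distr, measurable, subst nn_integral_density) auto
  \<comment> \<open>The negated last zero turns the events \<open>g < r\<close> into the upper intervals for which the uniqueness theorem is stated.\<close>
  have m1: "emeasure m1 {x<..} = (\<integral>\<^sup>+\<omega>. weight s v \<omega> * of_bool (last_zero B \<omega> < min (- x) s) \<partial>M)" for x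
  proof -
    have "emeasure m1 {x<..} = (\<integral>\<^sup>+y. indicator {x<..} y \<partial>m1)"
      by (subst nn_integral_indicator) (auto simp: m1_def)
    also have "\<dots> = (\<integral>\<^sup>+\<omega>. weight s v \<omega> * of_bool (last_zero B \<omega> < min (- x) s) \<partial>M)"
      by (subst int1) (auto intro!: nn_integral_cong split: split_indicator)
    finally show ?thesis .
  qed
  have m2: "emeasure m2 {x<..} = (\<integral>\<^sup>+p\<in>{0..}. ennreal (law_density s v p) * of_bool (\<rho> p < min (- x) s) \<partial>lborel)" for x
  proof -
    have "emeasure m2 {x<..} = (\<integral>\<^sup>+y. indicator {x<..} y \<partial>m2)"
      by (subst nn_integral_indicator) (auto simp: m2_def)
    also have "\<dots> = (\<integral>\<^sup>+p\<in>{0..}. ennreal (law_density s v p) * of_bool (\<rho> p < min (- x) s) \<partial>lborel)"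
      using \<rho>(2) by (subst int2) (auto intro!: nn_integral_cong split: split_indicator)
    finally show ?thesis .
  qed
  have cdf: "emeasure m1 {x<..} = emeasure m2 {x<..} \<and> emeasure m1 {x<..} < \<infinity>" for x
  proof (cases "x < 0")
    case True
    then show ?thesis
      unfolding m1 m2 \<rho>_def using last_zero_cdf[of "min (- x) s" s v] s v by simp
  next
    case False
    have "emeasure m1 {x<..} = (\<integral>\<^sup>+\<omega>. 0 \<partial>M)"
      unfolding m1 using False last_zero_is_zero(1) by (intro nn_integral_cong) fastforce
    moreover have "emeasure m2 {x<..} = (\<integral>\<^sup>+p. 0 \<partial>lborel)"
    proof -
      have "\<not> \<rho> p < min (- x) s" for p
        using False \<rho>(1)[of p] by simp
      then show ?thesis unfolding m2 by (simp del: min_less_iff_conj)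
    qed
    ultimately show ?thesis by simp
  qed
  have "m1 = m2"
  proof (rule measure_eqI_lessThan)
    show "sets m1 = sets borel" "sets m2 = sets borel" by (simp_all add: m1_def m2_def)
  qed (use cdf in blast)+
  then have "(\<integral>\<^sup>+x. \<psi> (- x) \<partial>m1) = (\<integral>\<^sup>+x. \<psi> (- x) \<partial>m2)" by simp
  then show ?thesis
    by (subst (asm) int1, measurable, subst (asm) int2, measurable) (simp add: \<rho>_def mult_ac)
qed

section \<open>The normalized area of the meander\<close>

text \<open>
  Extending the paths constantly to negative times makes them continuous on the whole line.
\<close>

definition sample_path :: "real \<Rightarrow> 'a \<Rightarrow> real" where
  "sample_path s \<omega> = B (max 0 s) \<omega>"

lemma sample_path_continuous:
  assumes "\<omega> \<in> space M" shows "continuous_on UNIV (\<lambda>s. sample_path s \<omega>)"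
  unfolding sample_path_def
  by (rule continuous_on_compose2[OF B_continuous[OF assms]]) (auto intro: continuous_intros)

lemma sample_path_measurable[measurable]: "random_variable borel (sample_path s)"
  unfolding sample_path_def by (intro B_measurable) simp

text \<open>
  The path is the limit of its values at times rounded down to multiples of \<open>1 / Suc n\<close>, which range over a
  countable set.
\<close>

lemma sample_path_jointly_measurable: "(\<lambda>(s, \<omega>). sample_path s \<omega>) \<in> borel_measurable (borel \<Otimes>\<^sub>M M)"
proof (rule borel_measurable_LIMSEQ_metric)
  fix n :: nat
  have "(\<lambda>x. sample_path (of_int \<lfloor>real (Suc n) * fst x\<rfloor> / real (Suc n)) (snd x)) \<in> borel_measurable (borel \<Otimes>\<^sub>M M)"
    by (rule measurable_compose_countable[where g = "\<lambda>x. \<lfloor>real (Suc n) * fst x\<rfloor>"]) measurable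
  then show "(\<lambda>(s, \<omega>). sample_path (of_int \<lfloor>real (Suc n) * s\<rfloor> / real (Suc n)) \<omega>) \<in> borel_measurable (borel \<Otimes>\<^sub>M M)"
    by (simp add: case_prod_beta')
next
  fix x :: "real \<times> 'a" assume "x \<in> space (borel \<Otimes>\<^sub>M M)"
  then obtain s \<omega> where x: "x = (s, \<omega>)" and \<omega>: "\<omega> \<in> space M" by (auto simp: space_pair_measure)
  have "(\<lambda>n. of_int \<lfloor>real (Suc n) * s\<rfloor> / real (Suc n)) \<longlonglongrightarrow> s"
  proof (rule tendsto_sandwich)
    show "\<forall>\<^sub>F n in sequentially. s - 1 / real (Suc n) \<le> of_int \<lfloor>real (Suc n) * s\<rfloor> / real (Suc n)"
    proof (intro always_eventually allI)
      fix n :: nat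
      have "real (Suc n) * s - 1 \<le> of_int \<lfloor>real (Suc n) * s\<rfloor>" by linarith
      then have "(real (Suc n) * s - 1) / real (Suc n) \<le> of_int \<lfloor>real (Suc n) * s\<rfloor> / real (Suc n)"
        by (intro divide_right_mono) auto
      then show "s - 1 / real (Suc n) \<le> of_int \<lfloor>real (Suc n) * s\<rfloor> / real (Suc n)"
        by (simp add: diff_divide_distrib del: of_nat_Suc)
    qed
    show "\<forall>\<^sub>F n in sequentially. of_int \<lfloor>real (Suc n) * s\<rfloor> / real (Suc n) \<le> s"
    proof (intro always_eventually allI)
      fix n :: nat
      have "of_int \<lfloor>real (Suc n) * s\<rfloor> \<le> real (Suc n) * s" by linarith
      then show "of_int \<lfloor>real (Suc n) * s\<rfloor> / real (Suc n) \<le> s"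
        by (simp add: pos_divide_le_eq mult.commute del: of_nat_Suc)
    qed
    show "(\<lambda>n. s - 1 / real (Suc n)) \<longlonglongrightarrow> s" by real_asymp
  qed simp
  then have "(\<lambda>n. sample_path (of_int \<lfloor>real (Suc n) * s\<rfloor> / real (Suc n)) \<omega>) \<longlonglongrightarrow> sample_path s \<omega>"
    using sample_path_continuous[OF \<omega>]
    by (intro isCont_tendsto_compose[of s "\<lambda>s. sample_path s \<omega>"]) (auto simp: continuous_on_eq_continuous_at)
  then show "(\<lambda>n. case x of (s, \<omega>) \<Rightarrow> sample_path (of_int \<lfloor>real (Suc n) * s\<rfloor> / real (Suc n)) \<omega>) \<longlonglongrightarrow> (case x of (s, \<omega>) \<Rightarrow> sample_path s \<omega>)"
    by (simp add: x)
qed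

lemma sample_path_measurable2[measurable (raw)]:
  assumes f: "f \<in> borel_measurable N" and g: "g \<in> measurable N M"
  shows "(\<lambda>x. sample_path (f x) (g x)) \<in> borel_measurable N"
  using measurable_compose[OF measurable_Pair[OF f g] sample_path_jointly_measurable] by simp

definition normalized_area :: "'a \<Rightarrow> real" where
  "normalized_area \<omega> = 1 / brownian_meander B 1 \<omega> * (LBINT u:{0..1}. brownian_meander B u \<omega>)"

lemma normalized_area_nonneg:
  assumes "\<omega> \<in> space M"
  shows "0 \<le> normalized_area \<omega>"
proof -
  have "0 \<le> brownian_meander B u \<omega>" for u
    using last_zero_is_zero[OF assms] by (simp add: brownian_meander_def Let_def)
  then show ?thesis
    unfolding normalized_area_def set_lebesgue_integral_def
    by (intro mult_nonneg_nonneg Bochner_Integration.integral_nonneg) auto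
qed

text \<open>
  The factors \<open>sqrt (1 - g)\<close> cancel, and \<open>s = g + (1 - g) u\<close> maps \<open>(0, 1)\<close> onto \<open>(g, 1)\<close>, where \<open>g\<close> is
  the last zero. If \<open>g = 1\<close>, both sides are \<open>0\<close>: the left one by the convention for division by zero, the right one
  because \<open>s < 1\<close>.
\<close>

lemma normalized_area_eq:
  assumes \<omega>: "\<omega> \<in> space M"
  shows "ennreal (normalized_area \<omega>) = (\<integral>\<^sup>+s\<in>{0<..<1}. ennreal \<bar>sample_path s \<omega>\<bar> * of_bool (last_zero B \<omega> < s) *
      ennreal (1 / (1 - last_zero B \<omega>)) * ennreal (1 / \<bar>B 1 \<omega>\<bar>) \<partial>lborel)"
proof (cases "last_zero B \<omega> = 1")
  case True
  have "normalized_area \<omega> = 0" by (simp add: normalized_area_def brownian_meander_def True)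
  moreover have "(\<integral>\<^sup>+s\<in>{0<..<1}. ennreal \<bar>sample_path s \<omega>\<bar> * of_bool (1 < s) * ennreal (1 / (1 - 1)) * ennreal (1 / \<bar>B 1 \<omega>\<bar>) \<partial>lborel) = 0"
    by simp
  ultimately show ?thesis unfolding True by simp
next
  case False
  define g where "g = last_zero B \<omega>"
  have g: "0 \<le> g" "g < 1" using last_zero_is_zero[OF \<omega>] False by (auto simp: g_def)
  have B1: "B 1 \<omega> \<noteq> 0" using zero_le_last_zero[of 1 \<omega>] g by (auto simp: g_def)
  have [measurable]: "(\<lambda>s. sample_path s \<omega>) \<in> borel_measurable borel"
    using sample_path_continuous[OF \<omega>] by (rule borel_measurable_continuous_onI)
  have m: "brownian_meander B u \<omega> = \<bar>sample_path (g + (1 - g) * u) \<omega>\<bar> / sqrt (1 - g)" if "0 \<le> u" for u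
    using g that by (simp add: brownian_meander_def g_def[symmetric] sample_path_def mult.commute)
  have m1: "1 / brownian_meander B 1 \<omega> = sqrt (1 - g) / \<bar>B 1 \<omega>\<bar>"
    using m[of 1] by (simp add: sample_path_def)
  have "(LBINT u:{0..1}. brownian_meander B u \<omega>) = (LBINT u:{0..1}. \<bar>sample_path (g + (1 - g) * u) \<omega>\<bar> / sqrt (1 - g))"
    by (intro set_lebesgue_integral_cong) (auto simp: m)
  then have area: "normalized_area \<omega> = (LBINT u:{0..1}. \<bar>sample_path (g + (1 - g) * u) \<omega>\<bar> / \<bar>B 1 \<omega>\<bar>)"
    unfolding normalized_area_def m1 using g by simp
  have "continuous_on {0..1} (\<lambda>u. sample_path (g + (1 - g) * u) \<omega>)"
    by (rule continuous_on_compose2[OF sample_path_continuous[OF \<omega>]]) (auto intro: continuous_intros)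
  then have "set_integrable lborel {0..1} (\<lambda>u. \<bar>sample_path (g + (1 - g) * u) \<omega>\<bar> / \<bar>B 1 \<omega>\<bar>)"
    by (intro borel_integrable_atLeastAtMost' continuous_intros) (use B1 in auto)
  then have "ennreal (normalized_area \<omega>) = (\<integral>\<^sup>+u. ennreal (indicator {0..1} u * (\<bar>sample_path (g + (1 - g) * u) \<omega>\<bar> / \<bar>B 1 \<omega>\<bar>)) \<partial>lborel)"
    unfolding area set_lebesgue_integral_def set_integrable_def
    by (subst nn_integral_eq_integral) auto
  also have "\<dots> = (\<integral>\<^sup>+u. ennreal \<bar>1 - g\<bar> * (ennreal (\<bar>sample_path (g + (1 - g) * u) \<omega>\<bar> / (\<bar>B 1 \<omega>\<bar> * (1 - g))) * indicator {g<..<1} (g + (1 - g) * u)) \<partial>lborel)"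
  proof (intro nn_integral_cong_AE AE_I[where N = "{0, 1}"])
    show "{u \<in> space lborel. \<not> ennreal (indicator {0..1} u * (\<bar>sample_path (g + (1 - g) * u) \<omega>\<bar> / \<bar>B 1 \<omega>\<bar>))
        = ennreal \<bar>1 - g\<bar> * (ennreal (\<bar>sample_path (g + (1 - g) * u) \<omega>\<bar> / (\<bar>B 1 \<omega>\<bar> * (1 - g))) * indicator {g<..<1} (g + (1 - g) * u))} \<subseteq> {0, 1}"
    proof (intro subsetI, rule ccontr)
      fix u assume u: "u \<in> {u \<in> space lborel. \<not> ennreal (indicator {0..1} u * (\<bar>sample_path (g + (1 - g) * u) \<omega>\<bar> / \<bar>B 1 \<omega>\<bar>))
        = ennreal \<bar>1 - g\<bar> * (ennreal (\<bar>sample_path (g + (1 - g) * u) \<omega>\<bar> / (\<bar>B 1 \<omega>\<bar> * (1 - g))) * indicator {g<..<1} (g + (1 - g) * u))}"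
        and "u \<notin> {0, 1}"
      then have "u \<noteq> 0" "u \<noteq> 1" by auto
      have "g + (1 - g) * u < 1 \<longleftrightarrow> (1 - g) * u < (1 - g) * 1" by (simp add: less_diff_eq add.commute)
      also have "\<dots> \<longleftrightarrow> u < 1" using g by (intro mult_less_cancel_left_pos) simp
      finally have ind: "(indicator {g<..<1} (g + (1 - g) * u) :: ennreal) = indicator {0..1} u"
        using g \<open>u \<noteq> 0\<close> \<open>u \<noteq> 1\<close> by (auto split: split_indicator simp: zero_less_mult_iff)
      have eq1: "ennreal (\<bar>sample_path (g + (1 - g) * u) \<omega>\<bar> / \<bar>B 1 \<omega>\<bar>)
          = ennreal \<bar>1 - g\<bar> * ennreal (\<bar>sample_path (g + (1 - g) * u) \<omega>\<bar> / (\<bar>B 1 \<omega>\<bar> * (1 - g)))"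
        using g by (subst ennreal_mult[symmetric]) auto
      have eq2: "ennreal (indicator {0..1} u * (\<bar>sample_path (g + (1 - g) * u) \<omega>\<bar> / \<bar>B 1 \<omega>\<bar>))
          = ennreal (\<bar>sample_path (g + (1 - g) * u) \<omega>\<bar> / \<bar>B 1 \<omega>\<bar>) * indicator {0..1} u"
        by (cases "u \<in> {0..1}") auto
      have "ennreal (indicator {0..1} u * (\<bar>sample_path (g + (1 - g) * u) \<omega>\<bar> / \<bar>B 1 \<omega>\<bar>))
        = ennreal \<bar>1 - g\<bar> * (ennreal (\<bar>sample_path (g + (1 - g) * u) \<omega>\<bar> / (\<bar>B 1 \<omega>\<bar> * (1 - g))) * indicator {g<..<1} (g + (1 - g) * u))"
        unfolding ind eq2 eq1 by (simp only: mult.assoc)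
      then show False using u by blast
    qed
  qed (auto intro: emeasure_lborel_countable)
  also have "\<dots> = ennreal \<bar>1 - g\<bar> * (\<integral>\<^sup>+u. ennreal (\<bar>sample_path (g + (1 - g) * u) \<omega>\<bar> / (\<bar>B 1 \<omega>\<bar> * (1 - g))) * indicator {g<..<1} (g + (1 - g) * u) \<partial>lborel)"
    by (rule nn_integral_cmult) measurable
  also have "\<dots> = (\<integral>\<^sup>+s. ennreal (\<bar>sample_path s \<omega>\<bar> / (\<bar>B 1 \<omega>\<bar> * (1 - g))) * indicator {g<..<1} s \<partial>lborel)"
    using g by (intro nn_integral_real_affine[symmetric]) auto
  also have "\<dots> = (\<integral>\<^sup>+s\<in>{0<..<1}. ennreal \<bar>sample_path s \<omega>\<bar> * of_bool (g < s) * ennreal (1 / (1 - g)) * ennreal (1 / \<bar>B 1 \<omega>\<bar>) \<partial>lborel)"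
  proof (intro nn_integral_cong)
    fix s :: real
    have "ennreal (\<bar>sample_path s \<omega>\<bar> / (\<bar>B 1 \<omega>\<bar> * (1 - g))) = ennreal (\<bar>sample_path s \<omega>\<bar> * (1 / (1 - g)) * (1 / \<bar>B 1 \<omega>\<bar>))"
      by (simp add: mult.commute)
    also have "\<dots> = ennreal \<bar>sample_path s \<omega>\<bar> * ennreal (1 / (1 - g)) * ennreal (1 / \<bar>B 1 \<omega>\<bar>)"
      using g by (subst ennreal_mult, simp, simp, subst ennreal_mult) auto
    finally show "ennreal (\<bar>sample_path s \<omega>\<bar> / (\<bar>B 1 \<omega>\<bar> * (1 - g))) * indicator {g<..<1} s
        = ennreal \<bar>sample_path s \<omega>\<bar> * of_bool (g < s) * ennreal (1 / (1 - g)) * ennreal (1 / \<bar>B 1 \<omega>\<bar>) * indicator {0<..<1} s"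
      using g by (auto split: split_indicator)
  qed
  finally show ?thesis by (simp add: g_def)
qed

lemma nn_integral_normalized_area: "(\<integral>\<^sup>+\<omega>. ennreal (normalized_area \<omega>) \<partial>M) = 1"
proof -
  interpret P: pair_sigma_finite M "lborel :: real measure" ..
  have [measurable]: "random_variable borel (B 1)" by (intro B_measurable) simp
  define I :: "real \<Rightarrow> ennreal" where "I = indicator {0<..<1}"
  have [measurable]: "I \<in> borel_measurable borel" unfolding I_def by measurable
  define G :: "real \<Rightarrow> real \<Rightarrow> 'a \<Rightarrow> ennreal" where
    "G s v \<omega> = ennreal \<bar>sample_path s \<omega>\<bar> * ennreal \<bar>gauss_moment ((1 / v\<^sup>2 - 1) / (1 - s)) (B 1 \<omega>)\<bar> *
        (of_bool (last_zero B \<omega> < s) * ennreal (1 / (1 - last_zero B \<omega>)))" for s v \<omega>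
  have Gm[measurable]: "(\<lambda>x. G (f x) (g x) (h x)) \<in> borel_measurable N"
    if [measurable]: "f \<in> borel_measurable N" "g \<in> borel_measurable N" "h \<in> measurable N M"
    for f g h and N :: "'x measure"
    unfolding G_def gauss_moment_def by measurable
  \<comment> \<open>The factor \<open>1 / \<bar>B 1 \<omega>\<bar>\<close> is replaced by its Gaussian mixture; on \<open>last_zero B \<omega> < s\<close> with \<open>s < 1\<close> the end point is not a zero.\<close>
  have expand: "ennreal (normalized_area \<omega>) = (\<integral>\<^sup>+s. \<integral>\<^sup>+v. ennreal (1 / (v ^ 3 * (1 - s))) * G s v \<omega> * I s * I v \<partial>lborel \<partial>lborel)"
    if \<omega>: "\<omega> \<in> space M" for \<omega>
    unfolding normalized_area_eq[OF \<omega>]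
  proof (intro nn_integral_cong)
    fix s :: real
    define A where "A = ennreal \<bar>sample_path s \<omega>\<bar> * (of_bool (last_zero B \<omega> < s) * ennreal (1 / (1 - last_zero B \<omega>)))"
    show "ennreal \<bar>sample_path s \<omega>\<bar> * of_bool (last_zero B \<omega> < s) * ennreal (1 / (1 - last_zero B \<omega>)) * ennreal (1 / \<bar>B 1 \<omega>\<bar>) * indicator {0<..<1} s
      = (\<integral>\<^sup>+v. ennreal (1 / (v ^ 3 * (1 - s))) * G s v \<omega> * I s * I v \<partial>lborel)"
    proof (cases "0 < s \<and> s < 1 \<and> last_zero B \<omega> < s")
      case True
      then have "B 1 \<omega> \<noteq> 0" using zero_le_last_zero[of 1 \<omega>] by auto
      then have "ennreal (1 / \<bar>B 1 \<omega>\<bar>) = (\<integral>\<^sup>+v\<in>{0<..<1}. ennreal (\<bar>B 1 \<omega>\<bar> *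
          exp (- (((1 / v\<^sup>2 - 1) / (1 - s)) * \<bar>B 1 \<omega>\<bar>\<^sup>2 / 2)) / (v ^ 3 * (1 - s))) \<partial>lborel)"
        using True by (intro inverse_as_gaussian_mixture[symmetric]) auto
      also have "\<dots> = (\<integral>\<^sup>+v. ennreal (1 / (v ^ 3 * (1 - s))) *
          ennreal \<bar>gauss_moment ((1 / v\<^sup>2 - 1) / (1 - s)) (B 1 \<omega>)\<bar> * I v \<partial>lborel)"
        using True unfolding I_def
        by (intro nn_integral_cong) (auto simp: gauss_moment_def abs_mult ennreal_mult[symmetric] split: split_indicator)
      finally have "A * ennreal (1 / \<bar>B 1 \<omega>\<bar>) = (\<integral>\<^sup>+v. A * (ennreal (1 / (v ^ 3 * (1 - s))) *
          ennreal \<bar>gauss_moment ((1 / v\<^sup>2 - 1) / (1 - s)) (B 1 \<omega>)\<bar> * I v) \<partial>lborel)"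
        by (simp only:) (rule nn_integral_cmult[symmetric], unfold gauss_moment_def, measurable)
      also have "\<dots> = (\<integral>\<^sup>+v. ennreal (1 / (v ^ 3 * (1 - s))) * G s v \<omega> * I s * I v \<partial>lborel)"
        using True by (intro nn_integral_cong) (simp add: A_def G_def I_def ac_simps)
      finally show ?thesis using True by (simp add: A_def ac_simps)
    next
      case False
      then show ?thesis by (auto simp: G_def I_def)
    qed
  qed
  have inner: "(\<integral>\<^sup>+\<omega>. ennreal (1 / (v ^ 3 * (1 - s))) * G s v \<omega> * I s * I v \<partial>M)
     = (\<integral>\<^sup>+p\<in>{0..}. ennreal (4 / pi * (s * (1 - s) * (1 + p\<^sup>2) /
          ((1 + (1 - s) * p\<^sup>2) * (1 + (1 - s) * p\<^sup>2 - s * v\<^sup>2)\<^sup>2))) \<partial>lborel) * I s * I v" for s v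
  proof (cases "0 < s \<and> s < 1 \<and> 0 < v \<and> v < 1")
    case True
    then have I1: "I s = 1" "I v = 1" by (auto simp: I_def)
    have "(\<integral>\<^sup>+\<omega>. ennreal (1 / (v ^ 3 * (1 - s))) * G s v \<omega> * I s * I v \<partial>M)
       = (\<integral>\<^sup>+\<omega>. ennreal (1 / (v ^ 3 * (1 - s))) * G s v \<omega> \<partial>M)"
      by (simp add: I1)
    also have "\<dots> = ennreal (1 / (v ^ 3 * (1 - s))) * (\<integral>\<^sup>+\<omega>. G s v \<omega> \<partial>M)"
      by (rule nn_integral_cmult) measurable
    also have "(\<integral>\<^sup>+\<omega>. G s v \<omega> \<partial>M) = (\<integral>\<^sup>+\<omega>. weight s v \<omega> * of_bool (last_zero B \<omega> < s) * ennreal (1 / (1 - last_zero B \<omega>)) \<partial>M)"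
      using True by (intro nn_integral_cong) (simp add: G_def weight_def sample_path_def ennreal_mult mult.assoc)
    also have "\<dots> = (\<integral>\<^sup>+p\<in>{0..}. ennreal (law_density s v p) * ennreal (1 / (1 - s * p\<^sup>2 / (1 + p\<^sup>2))) \<partial>lborel)"
      using True by (intro last_zero_law) auto
    also have "ennreal (1 / (v ^ 3 * (1 - s))) * \<dots>
      = (\<integral>\<^sup>+p. ennreal (1 / (v ^ 3 * (1 - s))) * (ennreal (law_density s v p) * ennreal (1 / (1 - s * p\<^sup>2 / (1 + p\<^sup>2))) * indicator {0..} p) \<partial>lborel)"
      unfolding law_density_def by (rule nn_integral_cmult[symmetric]) measurable
    also have "\<dots> = (\<integral>\<^sup>+p\<in>{0..}. ennreal (4 / pi * (s * (1 - s) * (1 + p\<^sup>2) /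
          ((1 + (1 - s) * p\<^sup>2) * (1 + (1 - s) * p\<^sup>2 - s * v\<^sup>2)\<^sup>2))) \<partial>lborel)"
    proof (intro nn_integral_cong)
      fix p :: real
      define T where "T = 1 - s"
      define Q where "Q = 1 + p\<^sup>2"
      define R where "R = 1 + T * p\<^sup>2"
      define D where "D = 1 + T * p\<^sup>2 - s * v\<^sup>2"
      have T: "0 < T" using True by (simp add: T_def)
      have Q: "0 < Q" by (simp add: Q_def add_pos_nonneg)
      have R: "0 < R" using T by (simp add: R_def add_pos_nonneg)
      have a: "1 - s * p\<^sup>2 / Q = R / Q"
        using Q by (simp add: field_simps) (simp add: Q_def R_def T_def algebra_simps)
      have b: "(1 - v\<^sup>2) / T + Q / s = D / (s * T)"
        using T True by (simp add: field_simps) (simp add: Q_def D_def T_def algebra_simps)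
      have "ennreal (1 / (v ^ 3 * T)) * (ennreal (law_density s v p) * ennreal (1 / (1 - s * p\<^sup>2 / Q)))
          = ennreal (1 / (v ^ 3 * T) * (law_density s v p * (1 / (1 - s * p\<^sup>2 / Q))))"
        using T True R Q unfolding a
        by (subst ennreal_mult[symmetric], simp add: law_density_def, simp, subst ennreal_mult[symmetric])
          (simp_all add: law_density_def)
      also have "1 / (v ^ 3 * T) * (law_density s v p * (1 / (1 - s * p\<^sup>2 / Q)))
          = 1 / (v ^ 3 * T) * (v ^ 3 * (4 / (pi * s) / (D / (s * T))\<^sup>2) * (1 / (R / Q)))"
        unfolding a law_density_def T_def[symmetric] Q_def[symmetric] b ..
      also have "\<dots> = 4 / pi * (s * T * Q / (R * D\<^sup>2))"
        using T True by (simp add: power_divide power_mult_distrib) (simp add: power2_eq_square ac_simps)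
      finally show "ennreal (1 / (v ^ 3 * (1 - s))) * (ennreal (law_density s v p) * ennreal (1 / (1 - s * p\<^sup>2 / (1 + p\<^sup>2))) * indicator {0..} p)
        = ennreal (4 / pi * (s * (1 - s) * (1 + p\<^sup>2) / ((1 + (1 - s) * p\<^sup>2) * (1 + (1 - s) * p\<^sup>2 - s * v\<^sup>2)\<^sup>2))) * indicator {0..} p"
        unfolding R_def D_def Q_def T_def by (simp only: mult.assoc[symmetric])
    qed
    finally show ?thesis by (simp add: I1)
  qed (auto simp: I_def)
  have "(\<integral>\<^sup>+\<omega>. ennreal (normalized_area \<omega>) \<partial>M)
      = (\<integral>\<^sup>+\<omega>. \<integral>\<^sup>+s. \<integral>\<^sup>+v. ennreal (1 / (v ^ 3 * (1 - s))) * G s v \<omega> * I s * I v \<partial>lborel \<partial>lborel \<partial>M)"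
    by (intro nn_integral_cong expand)
  also have "\<dots> = (\<integral>\<^sup>+s. \<integral>\<^sup>+\<omega>. \<integral>\<^sup>+v. ennreal (1 / (v ^ 3 * (1 - s))) * G s v \<omega> * I s * I v \<partial>lborel \<partial>M \<partial>lborel)"
    by (rule P.Fubini'[symmetric]) measurable
  also have "\<dots> = (\<integral>\<^sup>+s. \<integral>\<^sup>+v. \<integral>\<^sup>+\<omega>. ennreal (1 / (v ^ 3 * (1 - s))) * G s v \<omega> * I s * I v \<partial>M \<partial>lborel \<partial>lborel)"
    by (intro nn_integral_cong P.Fubini'[symmetric]) measurable
  also have "\<dots> = (\<integral>\<^sup>+s. \<integral>\<^sup>+v. (\<integral>\<^sup>+p\<in>{0..}. ennreal (4 / pi * (s * (1 - s) * (1 + p\<^sup>2) /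
          ((1 + (1 - s) * p\<^sup>2) * (1 + (1 - s) * p\<^sup>2 - s * v\<^sup>2)\<^sup>2))) \<partial>lborel) * I s * I v \<partial>lborel \<partial>lborel)"
    by (simp only: inner)
  also have "\<dots> = 1"
    unfolding triple_integral_eq_1[symmetric] I_def
    by (intro nn_integral_cong) (auto split: split_indicator intro!: nn_integral_cong)
  finally show ?thesis .
qed

lemma normalized_area_measurable: "random_variable borel normalized_area"
proof -
  have [measurable]: "random_variable borel (B 1)" by (intro B_measurable) simp
  have "(\<lambda>\<omega>. enn2real (\<integral>\<^sup>+s\<in>{0<..<1}. ennreal \<bar>sample_path s \<omega>\<bar> * of_bool (last_zero B \<omega> < s) *
      ennreal (1 / (1 - last_zero B \<omega>)) * ennreal (1 / \<bar>B 1 \<omega>\<bar>) \<partial>lborel)) \<in> borel_measurable M"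
    by measurable
  moreover have "normalized_area \<omega> = enn2real (\<integral>\<^sup>+s\<in>{0<..<1}. ennreal \<bar>sample_path s \<omega>\<bar> * of_bool (last_zero B \<omega> < s) *
      ennreal (1 / (1 - last_zero B \<omega>)) * ennreal (1 / \<bar>B 1 \<omega>\<bar>) \<partial>lborel)" if "\<omega> \<in> space M" for \<omega>
    using normalized_area_eq[OF that] normalized_area_nonneg[OF that] by (metis enn2real_ennreal)
  ultimately show ?thesis by (simp cong: measurable_cong)
qed

lemma expectation_normalized_area: "expectation normalized_area = 1"
  using normalized_area_nonneg normalized_area_measurable
  by (subst integral_eq_nn_integral) (auto simp: nn_integral_normalized_area)

end

theorem corollary2p2:
  fixes M :: "'a measure" and B :: "real \<Rightarrow> 'a \<Rightarrow> real"
  assumes "standard_brownian_motion M B"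
  shows "prob_space.expectation M
           (\<lambda>\<omega>. 1 / brownian_meander B 1 \<omega> * (LBINT u:{0..1}. brownian_meander B u \<omega>)) = 1"
proof -
  interpret prob_space M using assms by (simp add: standard_brownian_motion_def)
  interpret brownian_motion M B by unfold_locales fact
  show ?thesis using expectation_normalized_area by (simp add: normalized_area_def[abs_def])
qed

end
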